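(* Let $F\in\mathbb{D}^{1,2}$ and $u:\Omega\to\mathfrak{H}$, and suppose that $\langle DF,u\rangle_{\mathfrak{H}}\neq 0$ a.s. and that $\frac{u}{\langle DF,u\rangle_{\mathfrak{H}}}$ belongs to the domain of $\delta$. Then the law of $F$ has a continuous density $\rho_F$ given by $$\rho_F(x)=\rho_F(a)\exp\left(-\int_a^x w(z)\,dz\right),\qquad x\in\mathrm{supp}\,\rho_F,$$ where $a$ is a point in the interior of $\mathrm{supp}\,\rho_F$ and $$w(z):=E\left[\delta\left(\frac{u}{\langle DF,u\rangle_{\mathfrak{H}}}\right)\Big|\,F=z\right].$$
   Context: $\mathfrak{H}$ is a real separable Hilbert space with scalar product $\langle\cdot,\cdot\rangle_{\mathfrak{H}}$. $W=\{W(h):h\in\mathfrak{H}\}$ is an isonormal Gaussian process on a complete probability space $(\Omega,\mathcal{F},P)$, where $\mathcal{F}$ is the $\sigma$-field generated by $W$. $\mathcal{S}$ is the set of random variables $F=f(W(h_1),\dots,W(h_n))$ with $n\in\mathbb{N}$, $h_i\in\mathfrak{H}$, and $f\in C_b^\infty(\mathbb{R}^n)$ (bounded, infinitely differentiable, with bounded partial derivatives). For such $F$ the Malliavin derivative is $DF=\sum_{k=1}^n\frac{\partial f}{\partial x_k}(W(h_1),\dots,W(h_n))h_k\in L^2(\Omega,\mathfrak{H})$. $\mathbb{D}^{1,2}$ is the closure of $\mathcal{S}$ with respect to $\|F\|_{1,2}^2=E|F|^2+E\|DF\|_{\mathfrak{H}}^2$, and $D$ is extended to $\mathbb{D}^{1,2}$.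 The divergence operator $\delta$ is the adjoint of $D$: its domain $\mathrm{Dom}\,\delta$ is the set of $u\in L^2(\Omega,\mathfrak{H})$ such that $|E\langle DF,u\rangle_{\mathfrak{H}}|\le C(u)\|F\|_{L^2(\Omega)}$ for all $F\in\mathcal{S}$, with $C(u)$ a positive constant depending only on $u$, and $\delta(u)\in L^2(\Omega)$ is characterized by $E\langle DF,u\rangle_{\mathfrak{H}}=E[F\delta(u)]$ for all $F\in\mathcal{S}$. $\mathrm{supp}\,\rho_F$ denotes the (closed) support of the law of $F$, which is a closed interval of $\mathbb{R}$. *)

theory Defs
  imports "HOL-Probability.Probability"
begin

definition L2 :: "'a measure \<Rightarrow> ('a \<Rightarrow> 'b::{banach, second_countable_topology}) set" where
  "L2 M = {X \<in> borel_measurable M. integrable M (\<lambda>\<omega>. (norm (X \<omega>))\<^sup>2)}"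

(* A point mass at 0 counts as a (degenerate) Gaussian law. *)
definition centered_gaussian :: "'a measure \<Rightarrow> ('a \<Rightarrow> real) \<Rightarrow> bool" where
  "centered_gaussian M X \<longleftrightarrow>
     X \<in> borel_measurable M \<and>
     ((AE \<omega> in M. X \<omega> = 0) \<or>
      (\<exists>\<sigma>>0. distributed M lborel X (\<lambda>x. ennreal (normal_density 0 \<sigma> x))))"

(* The Hilbert space is the type 'h. Since the probability space is complete, "the sigma-field
   generated by W" is understood, as usual, to include the null sets. *)
locale isonormal_gaussian_process = prob_space M + complete_measure M
  for M :: "'a measure" and
      W :: "'h::{real_inner, banach, second_countable_topology} \<Rightarrow> 'a \<Rightarrow> real" +
  assumes gaussian_family:
    "finite A \<Longrightarrow> centered_gaussian M (\<lambda>\<omega>. \<Sum>h\<in>A. c h * W h \<omega>)"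
  and covariance: "expectation (\<lambda>\<omega>. W g \<omega> * W h \<omega>) = inner g h"
  and generated: "sets M =
    sigma_sets (space M) ((\<Union>h. {W h -` B \<inter> space M | B. B \<in> sets borel}) \<union> null_sets M)"

definition partial_deriv :: "nat \<Rightarrow> ((nat \<Rightarrow> real) \<Rightarrow> real) \<Rightarrow> (nat \<Rightarrow> real) \<Rightarrow> real" where
  "partial_deriv k f x = deriv (\<lambda>t. f (x(k := t))) (x k)"

(* A function on R^n is represented by a function of sequences that depends only on the
   coordinates 0, ..., n - 1; for such functions continuity in the product topology is
   continuity on R^n. The list ks runs over all iterated partial derivatives, including f
   itself (ks = []). *)
definition Cb_smooth :: "nat \<Rightarrow> ((nat \<Rightarrow> real) \<Rightarrow> real) set" where
  "Cb_smooth n = {f.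
     (\<forall>x y. (\<forall>i<n. x i = y i) \<longrightarrow> f x = f y) \<and>
     (\<forall>ks. set ks \<subseteq> {..<n} \<longrightarrow>
        (let g = fold partial_deriv ks f in
           continuous_on UNIV g \<and> bounded (range g) \<and>
           (\<forall>k<n. \<forall>x. (\<lambda>t. g (x(k := t))) differentiable (at (x k)))))}"

(* F = f(W(h_0), ..., W(h_(n-1))) together with its derivative. This is a relation because
   the expression for DF refers to the chosen representation of F. *)
definition smooth_with_deriv ::
  "('h::real_inner \<Rightarrow> 'a \<Rightarrow> real) \<Rightarrow> ('a \<Rightarrow> real) \<Rightarrow> ('a \<Rightarrow> 'h) \<Rightarrow> bool" where
  "smooth_with_deriv W F G \<longleftrightarrow>
     (\<exists>n f h. f \<in> Cb_smooth n \<and>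
        F = (\<lambda>\<omega>. f (\<lambda>i. W (h i) \<omega>)) \<and>
        G = (\<lambda>\<omega>. \<Sum>k<n. partial_deriv k f (\<lambda>i. W (h i) \<omega>) *\<^sub>R h k))"

definition sobolev_norm_sq ::
  "'a measure \<Rightarrow> ('a \<Rightarrow> real) \<Rightarrow> ('a \<Rightarrow> 'h::{real_inner, banach, second_countable_topology}) \<Rightarrow> real"
  where "sobolev_norm_sq M F G = (\<integral>\<omega>. (F \<omega>)\<^sup>2 \<partial>M) + (\<integral>\<omega>. (norm (G \<omega>))\<^sup>2 \<partial>M)"

(* The closure of the derivative operator. *)
definition has_malliavin_deriv ::
  "'a measure \<Rightarrow> ('h::{real_inner, banach, second_countable_topology} \<Rightarrow> 'a \<Rightarrow> real)
     \<Rightarrow> ('a \<Rightarrow> real) \<Rightarrow> ('a \<Rightarrow> 'h) \<Rightarrow> bool" where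
  "has_malliavin_deriv M W F G \<longleftrightarrow>
     F \<in> L2 M \<and> G \<in> L2 M \<and>
     (\<exists>Fn Gn. (\<forall>n. smooth_with_deriv W (Fn n) (Gn n)) \<and>
        (\<lambda>n. sobolev_norm_sq M (\<lambda>\<omega>. Fn n \<omega> - F \<omega>) (\<lambda>\<omega>. Gn n \<omega> - G \<omega>)) \<longlonglongrightarrow> 0)"

definition D12 ::
  "'a measure \<Rightarrow> ('h::{real_inner, banach, second_countable_topology} \<Rightarrow> 'a \<Rightarrow> real)
     \<Rightarrow> ('a \<Rightarrow> real) set" where
  "D12 M W = {F. \<exists>G. has_malliavin_deriv M W F G}"

(* A version; by closability it is determined up to almost sure equality. *)
definition malliavin_deriv ::
  "'a measure \<Rightarrow> ('h::{real_inner, banach, second_countable_topology} \<Rightarrow> 'a \<Rightarrow> real)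
     \<Rightarrow> ('a \<Rightarrow> real) \<Rightarrow> 'a \<Rightarrow> 'h" where
  "malliavin_deriv M W F = (SOME G. has_malliavin_deriv M W F G)"

definition dom_divergence ::
  "'a measure \<Rightarrow> ('h::{real_inner, banach, second_countable_topology} \<Rightarrow> 'a \<Rightarrow> real)
     \<Rightarrow> ('a \<Rightarrow> 'h) set" where
  "dom_divergence M W = {u \<in> L2 M. \<exists>C>0. \<forall>F G. smooth_with_deriv W F G \<longrightarrow>
     \<bar>\<integral>\<omega>. inner (G \<omega>) (u \<omega>) \<partial>M\<bar> \<le> C * sqrt (\<integral>\<omega>. (F \<omega>)\<^sup>2 \<partial>M)}"

(* A version; it exists on dom_divergence by the Riesz representation theorem and is unique up
   to almost sure equality because the smooth random variables are dense in L^2. *)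
definition divergence ::
  "'a measure \<Rightarrow> ('h::{real_inner, banach, second_countable_topology} \<Rightarrow> 'a \<Rightarrow> real)
     \<Rightarrow> ('a \<Rightarrow> 'h) \<Rightarrow> 'a \<Rightarrow> real" where
  "divergence M W u = (SOME d. d \<in> L2 M \<and> (\<forall>F G. smooth_with_deriv W F G \<longrightarrow>
     (\<integral>\<omega>. inner (G \<omega>) (u \<omega>) \<partial>M) = (\<integral>\<omega>. F \<omega> * d \<omega> \<partial>M)))"

(* w is a version of z \<mapsto> E[X | F = z]. *)
definition cond_exp_given ::
  "'a measure \<Rightarrow> ('a \<Rightarrow> real) \<Rightarrow> ('a \<Rightarrow> real) \<Rightarrow> (real \<Rightarrow> real) \<Rightarrow> bool" where
  "cond_exp_given M X F w \<longleftrightarrow>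
     w \<in> borel_measurable borel \<and>
     (AE \<omega> in M. real_cond_exp M (vimage_algebra (space M) F borel) X \<omega> = w (F \<omega>))"

definition law_support :: "'a measure \<Rightarrow> ('a \<Rightarrow> real) \<Rightarrow> real set" where
  "law_support M F =
     {x. \<forall>U. open U \<longrightarrow> x \<in> U \<longrightarrow> measure (distr M borel F) U > 0}"

(* L is the integral of w from a to x: the Lebesgue integral (negative if x < a) if it
   converges, and otherwise the improper integral at the endpoint x, possibly infinite.
   The second case is needed when x is a finite endpoint of the support of F: there the
   continuous density vanishes, so the integral in the formula for the density diverges to
   \<infinity>. *)
definition has_integral_from_to :: "(real \<Rightarrow> real) \<Rightarrow> real \<Rightarrow> real \<Rightarrow> ereal \<Rightarrow> bool" where
  "has_integral_from_to w a x L \<longleftrightarrow>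
     (if interval_lebesgue_integrable lborel (ereal a) (ereal x) w
      then L = ereal (interval_lebesgue_integral lborel (ereal a) (ereal x) w)
      else (\<forall>y\<in>open_segment a x. interval_lebesgue_integrable lborel (ereal a) (ereal y) w) \<and>
           ((\<lambda>y. ereal (interval_lebesgue_integral lborel (ereal a) (ereal y) w)) \<longlongrightarrow> L)
             (at x within open_segment a x))"

definition ereal_exp :: "ereal \<Rightarrow> ereal" where
  "ereal_exp x = (case x of ereal r \<Rightarrow> ereal (exp r) | PInfty \<Rightarrow> \<infinity> | MInfty \<Rightarrow> 0)"

end

theory Submission
  imports Defs
begin

text \<open>
The vector \<open>v = u / \<langle>DF, u\<rangle>\<close> satisfies \<open>\<langle>DF, v\<rangle> = 1\<close>, so the duality between \<open>D\<close> and \<open>\<delta>\<close>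
together with the chain rule gives \<open>E[\<phi>'(F)] = E[\<phi>(F) d]\<close> with \<open>d = \<delta>(v)\<close>. Choosing for \<open>\<phi>\<close> smooth
approximations of \<open>x \<mapsto> \<bar>x - a\<bar> - \<bar>x - b\<bar>\<close>, whose derivative tends to \<open>sgn (x - a) - sgn (x - b)\<close>,
turns this into an exact identity (\<open>malliavin_sgn_duality\<close>) that determines the distribution
function of \<open>F\<close>. It rules out atoms, and differentiating it shows that
\<open>\<rho>(x) = E[sgn (F - x) d] / 2\<close> is a continuous density (\<open>sgn_duality_density\<close>). The increments of \<open>\<rho>\<close>
are \<open>\<rho>(x) - \<rho>(y) = E[d; x < F \<le> y] = \<integral> w \<rho>\<close> over \<open>{x<..y}\<close>, that is, \<open>\<rho>' = - w \<rho>\<close> in integrated form.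
Where \<open>\<rho>\<close> is positive, division by \<open>\<rho>\<close> gives the exponential formula
(\<open>ln_integral_of_log_derivative\<close>, \<open>density_formula\<close>); at an endpoint of the support at which \<open>\<rho>\<close>
vanishes the integral of \<open>w\<close> diverges.

The delicate point is that \<open>\<rho>\<close> cannot vanish between two points of the support. The relation
\<open>\<rho>' = - w \<rho>\<close> alone does not exclude this: \<open>\<rho>(x) = x\<^sup>2\<close> near \<open>0\<close> goes with \<open>w(x) = - 2 / x\<close>, and \<open>w\<close> is
square integrable for \<open>\<rho>\<close>. The regularity of \<open>F\<close> has to be used again. If \<open>\<rho>(z) = 0\<close>, the
Cauchy-Schwarz inequality in the formula for the increments bounds \<open>\<rho>\<close> by the square root of the
distribution function, whence \<open>P(\<bar>F - z\<bar> \<le> \<epsilon>) = O(\<epsilon>\<^sup>2)\<close>. Smoothed versions of \<open>sgn (F - z)\<close> have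
derivative \<open>DF / \<epsilon>\<close> on \<open>{\<bar>F - z\<bar> \<le> \<epsilon>}\<close>, and by Cauchy-Schwarz the \<open>L\<^sup>1\<close> norm of this tends to zero. A
random variable that is approximated in this way by smooth ones whose derivatives vanish in the
limit must be constant (\<open>small_ball_imp_sgn_constant\<close>), so \<open>z\<close> cannot separate two points of the
support (\<open>density_pos_between_support_points\<close>).

Constancy is obtained from Gaussian integration by parts
(\<open>gaussian_integration_by_parts\<close>): it shows that \<open>Z = sgn (F - z)\<close> satisfies
\<open>E[Z (s'(\<xi>) - \<xi> s(\<xi>))] = 0\<close> for every standard Gaussian \<open>\<xi>\<close> in the linear span of \<open>W\<close> and suitable \<open>s\<close>.
With \<open>s\<close> a solution of Stein's equation for a cosine, \<open>Z - E[Z]\<close> becomes orthogonal to all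
\<open>cos (W h)\<close> and \<open>sin (W h)\<close>, and these determine the law of the whole process
(\<open>trig_orthogonal_restrict\<close>). The same orthogonality argument yields the independence of orthogonal
Gaussian variables that the integration by parts rests on.
\<close>

section \<open>Bounded smooth functions of finitely many coordinates\<close>

lemma partial_deriv_eqI:
  "((\<lambda>t. f (x(k := t))) has_real_derivative D) (at (x k)) \<Longrightarrow> partial_deriv k f x = D"
  unfolding partial_deriv_def by (rule DERIV_imp_deriv)

text \<open>
Membership in \<open>Cb_smooth\<close> speaks about all iterated partial derivatives. Since the
derivatives of a composite function get ever more complicated, it is proved by exhibiting a class
that is closed under partial derivatives, so that no iterated derivative has to be computed.
\<close>
lemma Cb_smooth_coinduct:
  assumes "f \<in> C"
    and C: "\<And>g. g \<in> C \<Longrightarrow> (\<forall>x y. (\<forall>i<n. x i = y i) \<longrightarrow> g x = g y)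
      \<and> continuous_on UNIV g \<and> bounded (range g)
      \<and> (\<forall>k<n. \<exists>p\<in>C. \<forall>x. ((\<lambda>t. g (x(k := t))) has_real_derivative p x) (at (x k)))"
  shows "f \<in> Cb_smooth n"
proof -
  have partial: "partial_deriv k g \<in> C"
    "((\<lambda>t. g (x(k := t))) has_real_derivative partial_deriv k g x) (at (x k))"
    if gk: "g \<in> C" "k < n" for g k x
  proof -
    obtain p where p: "p \<in> C" "\<And>x. ((\<lambda>t. g (x(k := t))) has_real_derivative p x) (at (x k))"
      using C[OF gk(1)] gk(2) by blast
    have "partial_deriv k g = p"
      by (rule ext) (rule partial_deriv_eqI[OF p(2)])
    with p show "partial_deriv k g \<in> C"
      "((\<lambda>t. g (x(k := t))) has_real_derivative partial_deriv k g x) (at (x k))"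
      by simp_all
  qed
  have "fold partial_deriv ks g \<in> C" if "g \<in> C" "set ks \<subseteq> {..<n}" for ks g
    using that by (induction ks arbitrary: g) (auto intro: partial)
  with C partial(2) assms(1) show ?thesis
    unfolding Cb_smooth_def Let_def real_differentiable_def by blast
qed

lemma Cb_smoothD:
  assumes f: "f \<in> Cb_smooth n"
  shows Cb_smooth_cong: "\<And>x y. (\<And>i. i < n \<Longrightarrow> x i = y i) \<Longrightarrow> f x = f y"
    and Cb_smooth_continuous: "continuous_on UNIV f"
    and Cb_smooth_bounded: "bounded (range f)"
    and Cb_smooth_partial: "\<And>k. k < n \<Longrightarrow> partial_deriv k f \<in> Cb_smooth n"
    and Cb_smooth_has_deriv: "\<And>k x. k < n \<Longrightarrow>
      ((\<lambda>t. f (x(k := t))) has_real_derivative partial_deriv k f x) (at (x k))"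
proof -
  have *: "continuous_on UNIV (fold partial_deriv ks f)" "bounded (range (fold partial_deriv ks f))"
     "\<And>k x. k < n \<Longrightarrow> (\<lambda>t. fold partial_deriv ks f (x(k := t))) differentiable (at (x k))"
    if "set ks \<subseteq> {..<n}" for ks
    using f that unfolding Cb_smooth_def Let_def by blast+
  show cong: "f x = f y" if "\<And>i. i < n \<Longrightarrow> x i = y i" for x y
    using f that unfolding Cb_smooth_def by blast
  show "continuous_on UNIV f" "bounded (range f)"
    using *[of "[]"] by auto
  show "((\<lambda>t. f (x(k := t))) has_real_derivative partial_deriv k f x) (at (x k))" if "k < n" for k x
    using *(3)[of "[]" k x] that unfolding partial_deriv_def
    by (simp add: DERIV_deriv_iff_real_differentiable)
  show "partial_deriv k f \<in> Cb_smooth n" if k: "k < n" for k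
  proof -
    have "partial_deriv k f x = partial_deriv k f y" if "\<forall>i<n. x i = y i" for x y
    proof -
      have "(\<lambda>t. f (x(k := t))) = (\<lambda>t. f (y(k := t)))"
        using that by (intro ext cong) auto
      then show ?thesis using that k by (simp add: partial_deriv_def)
    qed
    moreover have "fold partial_deriv ks (partial_deriv k f) = fold partial_deriv (k # ks) f" for ks
      by simp
    ultimately show ?thesis
      using *[of "k # _"] k unfolding Cb_smooth_def Let_def by simp
  qed
qed

lemma Cb_smooth_partial_high:
  assumes f: "f \<in> Cb_smooth n" and "n \<le> k"
  shows "partial_deriv k f = (\<lambda>x. 0)"
proof
  fix x
  have "(\<lambda>t. f (x(k := t))) = (\<lambda>t. f x)"
    using assms(2) by (intro ext Cb_smooth_cong[OF f]) auto
  then show "partial_deriv k f x = 0"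
    by (intro partial_deriv_eqI) simp
qed

text \<open>
Beyond the first \<open>n\<close> coordinates the function is constant, so both sides are zero there.
\<close>
lemma Cb_smooth_has_deriv':
  assumes f: "f \<in> Cb_smooth n"
  shows "((\<lambda>t. f (x(k := t))) has_real_derivative partial_deriv k f x) (at (x k))"
proof (cases "k < n")
  case True then show ?thesis by (rule Cb_smooth_has_deriv[OF f])
next
  case False
  then have "(\<lambda>t. f (x(k := t))) = (\<lambda>t. f x)"
    by (intro ext Cb_smooth_cong[OF f]) auto
  then show ?thesis using Cb_smooth_partial_high[OF f, of k] False by simp
qed

lemma Cb_smooth_const: "(\<lambda>x. c) \<in> Cb_smooth n"
  by (rule Cb_smooth_coinduct[where C = "{\<lambda>x. b | b. True}"]) (auto intro!: exI[of _ "\<lambda>x. 0::real"])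

text \<open>
The algebra generated by \<open>Cb_smooth n\<close> and the functions \<open>\<Phi> j \<circ> f\<close>; it serves as the class in
\<open>Cb_smooth_coinduct\<close>.
\<close>
inductive_set chain_algebra :: "nat \<Rightarrow> (nat \<Rightarrow> real \<Rightarrow> real) \<Rightarrow> ((nat \<Rightarrow> real) \<Rightarrow> real)
    \<Rightarrow> ((nat \<Rightarrow> real) \<Rightarrow> real) set"
  for n \<Phi> f where
  base: "g \<in> Cb_smooth n \<Longrightarrow> g \<in> chain_algebra n \<Phi> f"
| comp: "(\<lambda>x. \<Phi> j (f x)) \<in> chain_algebra n \<Phi> f"
| add: "g \<in> chain_algebra n \<Phi> f \<Longrightarrow> h \<in> chain_algebra n \<Phi> f \<Longrightarrow>
    (\<lambda>x. g x + h x) \<in> chain_algebra n \<Phi> f"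
| mult: "g \<in> chain_algebra n \<Phi> f \<Longrightarrow> h \<in> chain_algebra n \<Phi> f \<Longrightarrow>
    (\<lambda>x. g x * h x) \<in> chain_algebra n \<Phi> f"

text \<open>
The sequence \<open>\<Phi>\<close> consists of a function and its successive derivatives. Products and sums of
the \<open>\<Phi> j \<circ> f\<close> with functions in \<open>Cb_smooth n\<close> form a class closed under partial derivatives, by the
chain and product rules.
\<close>
lemma Cb_smooth_compose:
  fixes \<Phi> :: "nat \<Rightarrow> real \<Rightarrow> real"
  assumes f: "f \<in> Cb_smooth n"
    and deriv: "\<And>j x. (\<Phi> j has_real_derivative \<Phi> (Suc j) x) (at x)"
    and bdd: "\<And>j. bounded (range (\<Phi> j))"
  shows "(\<lambda>x. \<Phi> j (f x)) \<in> Cb_smooth n"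
    and "partial_deriv k (\<lambda>x. \<Phi> j (f x)) x = \<Phi> (Suc j) (f x) * partial_deriv k f x"
proof -
  have cont: "continuous_on UNIV (\<Phi> j)" for j
    using deriv DERIV_isCont continuous_at_imp_continuous_on by blast
  have chain: "((\<lambda>t. \<Phi> j (f (x(k := t)))) has_real_derivative
      \<Phi> (Suc j) (f x) * partial_deriv k f x) (at (x k))" for j k x
    by (rule DERIV_chain2[OF _ Cb_smooth_has_deriv'[OF f]]) (simp add: deriv)
  show "partial_deriv k (\<lambda>x. \<Phi> j (f x)) x = \<Phi> (Suc j) (f x) * partial_deriv k f x"
    by (rule partial_deriv_eqI[OF chain])
  let ?C = "chain_algebra n \<Phi> f"
  have step: "(\<forall>x y. (\<forall>i<n. x i = y i) \<longrightarrow> g x = g y)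
      \<and> continuous_on UNIV g \<and> bounded (range g)
      \<and> (\<forall>k<n. \<exists>p\<in>?C. \<forall>x. ((\<lambda>t. g (x(k := t))) has_real_derivative p x) (at (x k)))"
    if "g \<in> ?C" for g
    using that
  proof induction
    case (base g)
    have "g x = g y" if "\<forall>i<n. x i = y i" for x y
      using that by (intro Cb_smooth_cong[OF base]) auto
    then show ?case
      using Cb_smooth_continuous[OF base] Cb_smooth_bounded[OF base] Cb_smooth_partial[OF base]
        Cb_smooth_has_deriv[OF base]
      by (blast intro: chain_algebra.base)
  next
    case (comp j)
    have "\<exists>p\<in>?C. \<forall>x. ((\<lambda>t. \<Phi> j (f (x(k := t)))) has_real_derivative p x) (at (x k))"
      if "k < n" for k
      by (intro bexI[of _ "\<lambda>x. \<Phi> (Suc j) (f x) * partial_deriv k f x"] allI chain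
          chain_algebra.mult[OF chain_algebra.comp] chain_algebra.base Cb_smooth_partial[OF f] that)
    moreover have "bounded (range (\<lambda>x. \<Phi> j (f x)))"
      by (rule bounded_subset[OF bdd[of j]]) auto
    moreover have "continuous_on UNIV (\<lambda>x. \<Phi> j (f x))"
      using continuous_on_compose2[OF cont Cb_smooth_continuous[OF f]] by simp
    moreover have "\<Phi> j (f x) = \<Phi> j (f y)" if "\<forall>i<n. x i = y i" for x y
      using Cb_smooth_cong[OF f, of x y] that by simp
    ultimately show ?case by blast
  next
    case (add g h)
    have "\<exists>p\<in>?C. \<forall>x. ((\<lambda>t. g (x(k := t)) + h (x(k := t))) has_real_derivative p x) (at (x k))"
      if k: "k < n" for k
    proof -
      obtain p q where "p \<in> ?C" "q \<in> ?C"
        "\<And>x. ((\<lambda>t. g (x(k := t))) has_real_derivative p x) (at (x k))"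
        "\<And>x. ((\<lambda>t. h (x(k := t))) has_real_derivative q x) (at (x k))"
        using add.IH k by meson
      then show ?thesis
        by (intro bexI[of _ "\<lambda>x. p x + q x"] allI DERIV_add chain_algebra.add)
    qed
    moreover have "g x + h x = g y + h y" if "\<forall>i<n. x i = y i" for x y
      using add.IH that by metis
    moreover have "continuous_on UNIV (\<lambda>x. g x + h x)" "bounded (range (\<lambda>x. g x + h x))"
      using add.IH by (auto intro: continuous_on_add bounded_plus_comp)
    ultimately show ?case by blast
  next
    case (mult g h)
    have "\<exists>p\<in>?C. \<forall>x. ((\<lambda>t. g (x(k := t)) * h (x(k := t))) has_real_derivative p x) (at (x k))"
      if k: "k < n" for k
    proof -
      obtain p q where pq: "p \<in> ?C" "q \<in> ?C"
        "\<And>x. ((\<lambda>t. g (x(k := t))) has_real_derivative p x) (at (x k))"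
        "\<And>x. ((\<lambda>t. h (x(k := t))) has_real_derivative q x) (at (x k))"
        using mult.IH k by meson
      have "((\<lambda>t. g (x(k := t)) * h (x(k := t))) has_real_derivative p x * h x + q x * g x) (at (x k))"
        for x
        using DERIV_mult[OF pq(3)[of x] pq(4)[of x]] by simp
      with pq(1,2) mult.hyps show ?thesis
        by (intro bexI[of _ "\<lambda>x. p x * h x + q x * g x"] allI chain_algebra.add chain_algebra.mult)
    qed
    moreover have "g x * h x = g y * h y" if "\<forall>i<n. x i = y i" for x y
      using mult.IH that by metis
    moreover have "bounded (range (\<lambda>x. g x * h x))"
    proof -
      obtain a b where "\<And>x. \<bar>g x\<bar> \<le> a" "\<And>x. \<bar>h x\<bar> \<le> b"
        using mult.IH by (auto simp: bounded_iff)
      then have "\<bar>g x * h x\<bar> \<le> a * b" for x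
        by (simp add: abs_mult mult_mono' order_trans[OF abs_ge_zero])
      then show ?thesis by (auto simp: bounded_iff)
    qed
    moreover have "continuous_on UNIV (\<lambda>x. g x * h x)"
      using mult.IH by (auto intro: continuous_on_mult)
    ultimately show ?case by blast
  qed
  show "(\<lambda>x. \<Phi> j (f x)) \<in> Cb_smooth n"
    using step by (rule Cb_smooth_coinduct[OF chain_algebra.comp])
qed

lemma shift_upd:
  "(\<lambda>i. (x(k := t)) (i + n :: nat)) = (if k < n then (\<lambda>i. x (i + n)) else (\<lambda>i. x (i + n))(k - n := t))"
  by (auto simp: fun_eq_iff)

text \<open>
Two smooth random variables use different lists of Gaussian variables. A linear combination of
them is a function of the concatenated list: the first \<open>n\<close> coordinates go to \<open>f\<close>, the others,
shifted by \<open>n\<close>, to \<open>g\<close>.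
\<close>
lemma Cb_smooth_lincomb:
  fixes a b :: real
  assumes f: "f \<in> Cb_smooth n" and g: "g \<in> Cb_smooth m"
  shows "(\<lambda>x. a * f x + b * g (\<lambda>i. x (i + n))) \<in> Cb_smooth (n + m)"
    and "k < n \<Longrightarrow> partial_deriv k (\<lambda>x. a * f x + b * g (\<lambda>i. x (i + n))) x = a * partial_deriv k f x"
    and "n \<le> k \<Longrightarrow> partial_deriv k (\<lambda>x. a * f x + b * g (\<lambda>i. x (i + n))) x
      = b * partial_deriv (k - n) g (\<lambda>i. x (i + n))"
proof -
  let ?T = "\<lambda>f g x. a * f x + b * g (\<lambda>i. x (i + n))"
  have d1: "((\<lambda>t. ?T p q (z(j := t))) has_real_derivative a * partial_deriv j p z) (at (z j))"
    if "j < n" "p \<in> Cb_smooth n" for j z p q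
    using that unfolding shift_upd
    by (auto intro!: derivative_eq_intros Cb_smooth_has_deriv)
  have d2: "((\<lambda>t. ?T p q (z(j := t))) has_real_derivative
      b * partial_deriv (j - n) q (\<lambda>i. z (i + n))) (at (z j))"
    if "n \<le> j" "p \<in> Cb_smooth n" "q \<in> Cb_smooth m" for j z p q
  proof -
    have "p (z(j := t)) = p z" for t
      using that by (intro Cb_smooth_cong[OF that(2)]) auto
    then show ?thesis
      using that Cb_smooth_has_deriv'[OF that(3), where x = "\<lambda>i. z (i + n)" and k = "j - n"]
      unfolding shift_upd by (auto intro!: derivative_eq_intros)
  qed
  show p1: "k < n \<Longrightarrow> partial_deriv k (?T f g) x = a * partial_deriv k f x"
    using d1 f by (intro partial_deriv_eqI)
  show p2: "n \<le> k \<Longrightarrow> partial_deriv k (?T f g) x = b * partial_deriv (k - n) g (\<lambda>i. x (i + n))"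
    using d2 f g by (intro partial_deriv_eqI)
  let ?C = "{?T f g | f g. f \<in> Cb_smooth n \<and> g \<in> Cb_smooth m}"
  show "?T f g \<in> Cb_smooth (n + m)"
  proof (rule Cb_smooth_coinduct[where C = ?C])
    show "?T f g \<in> ?C" using f g by blast
    fix h assume "h \<in> ?C"
    then obtain f g where f: "f \<in> Cb_smooth n" and g: "g \<in> Cb_smooth m" and h: "h = ?T f g"
      by blast
    have "h x = h y" if "\<forall>i<n+m. x i = y i" for x y
    proof -
      have "f x = f y" using that by (intro Cb_smooth_cong[OF f]) auto
      moreover have "g (\<lambda>i. x (i + n)) = g (\<lambda>i. y (i + n))"
        using that by (intro Cb_smooth_cong[OF g]) auto
      ultimately show ?thesis by (simp add: h)
    qed
    moreover have "continuous_on UNIV (\<lambda>x. g (\<lambda>i. x (i + n)))"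
      by (rule continuous_on_compose2[OF Cb_smooth_continuous[OF g]])
         (auto intro!: continuous_on_coordinatewise_then_product continuous_on_product_coordinates)
    then have "continuous_on UNIV h"
      unfolding h by (intro continuous_intros Cb_smooth_continuous[OF f])
    moreover have "bounded (range h)"
    proof -
      obtain A B where "\<And>x. \<bar>f x\<bar> \<le> A" "\<And>x. \<bar>g x\<bar> \<le> B"
        using Cb_smooth_bounded[OF f] Cb_smooth_bounded[OF g] by (auto simp: bounded_iff)
      then have "\<bar>h x\<bar> \<le> \<bar>a\<bar> * A + \<bar>b\<bar> * B" for x
        unfolding h by (intro order_trans[OF abs_triangle_ineq] add_mono)
          (simp_all add: abs_mult mult_left_mono)
      then show ?thesis by (auto simp: bounded_iff)
    qed
    moreover have "\<exists>p\<in>?C. \<forall>x. ((\<lambda>t. h (x(k := t))) has_real_derivative p x) (at (x k))"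
      if k: "k < n + m" for k
    proof (cases "k < n")
      case True
      have "?T (partial_deriv k f) (\<lambda>x. 0) \<in> ?C"
        by (intro CollectI exI[of _ "partial_deriv k f"] exI[of _ "\<lambda>x. 0"] conjI refl
            Cb_smooth_partial[OF f True] Cb_smooth_const)
      then show ?thesis
        by (rule rev_bexI) (use d1[OF True f] in \<open>simp add: h\<close>)
    next
      case False
      then have "partial_deriv (k - n) g \<in> Cb_smooth m"
        using k by (intro Cb_smooth_partial[OF g]) auto
      then have "?T (\<lambda>x. 0) (partial_deriv (k - n) g) \<in> ?C"
        by (intro CollectI exI[of _ "\<lambda>x. 0"] exI[of _ "partial_deriv (k - n) g"] conjI refl
            Cb_smooth_const)
      then show ?thesis
        by (rule rev_bexI) (use d2[OF _ f g] False in \<open>simp add: h\<close>)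
    qed
    ultimately show "(\<forall>x y. (\<forall>i<n+m. x i = y i) \<longrightarrow> h x = h y)
      \<and> continuous_on UNIV h \<and> bounded (range h)
      \<and> (\<forall>k<n+m. \<exists>p\<in>?C. \<forall>x. ((\<lambda>t. h (x(k := t))) has_real_derivative p x) (at (x k)))"
      by blast
  qed
qed

text \<open>
The partial derivatives are defined one coordinate at a time, so the chain rule along a line is
not immediate. It follows by releasing the coordinates one after the other: at each step the
function of the already moving point and of the next coordinate is differentiable because the
partial derivative in that coordinate is continuous.
\<close>
lemma Cb_smooth_line_deriv:
  fixes a y :: "nat \<Rightarrow> real"
  assumes f: "f \<in> Cb_smooth n"
  shows "((\<lambda>t. f (\<lambda>i. a i * t + y i)) has_real_derivative
    (\<Sum>k<n. a k * partial_deriv k f (\<lambda>i. a i * t + y i))) (at t)"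
proof -
  define p where "p m z s = (\<lambda>i. if i < m then a i * s + y i else z i)"
    for m :: nat and z s
  have "((\<lambda>s. f (p m z s)) has_real_derivative (\<Sum>k<m. a k * partial_deriv k f (p m z s))) (at s)"
    if "m \<le> n" for m z s
    using that
  proof (induction m arbitrary: z s)
    case 0
    then show ?case by (simp add: p_def)
  next
    case (Suc m)
    let ?g = "\<lambda>s t. f (p m (z(m := t)) s)"
    let ?D = "\<lambda>s t. partial_deriv m f (p m (z(m := t)) s)"
    have upd: "p m (z(m := t)) s = (p m z s)(m := t)" for s t
      by (auto simp: p_def)
    have diag: "p (Suc m) z s = p m (z(m := a m * s + y m)) s" for s
      by (auto simp: p_def less_Suc_eq)
    define t where "t = a m * s + y m"
    define A where "A = (\<Sum>k<m. a k * partial_deriv k f (p m (z(m := t)) s))"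
    have 1: "((\<lambda>s. ?g s t) has_derivative (*) A) (at s within UNIV)"
      using Suc.IH[of "z(m := t)" s] Suc.prems unfolding has_field_derivative_def A_def by linarith
    have 2: "(?g s has_derivative blinfun_apply (blinfun_mult_right (?D s t))) (at t within UNIV)" for s t
    proof -
      have "((\<lambda>u. f (((p m z s)(m := t))(m := u))) has_real_derivative
          partial_deriv m f ((p m z s)(m := t))) (at (((p m z s)(m := t)) m))"
        using Suc.prems by (intro Cb_smooth_has_deriv[OF f]) simp
      then show ?thesis
        by (simp add: upd has_field_derivative_def)
    qed
    have "continuous_on UNIV (\<lambda>u. p m (z(m := snd u)) (fst u))"
    proof (rule continuous_on_coordinatewise_then_product)
      fix i
      consider "i < m" | "i = m" | "i > m" by linarith
      then show "continuous_on UNIV (\<lambda>u::real \<times> real. p m (z(m := snd u)) (fst u) i)"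
        by cases (auto simp: p_def intro!: continuous_intros)
    qed
    note path = this
    have "continuous_on UNIV (partial_deriv m f)"
      using Suc.prems by (intro Cb_smooth_continuous[OF Cb_smooth_partial[OF f]]) simp
    then have "continuous_on UNIV (\<lambda>u. ?D (fst u) (snd u))"
      by (rule continuous_on_compose2[OF _ path]) (rule subset_UNIV)
    then have "continuous_on UNIV (\<lambda>u. blinfun_mult_right (?D (fst u) (snd u)))"
      by (rule bounded_linear.continuous_on[OF bounded_linear_blinfun_mult_right])
    then have 3: "continuous (at (s, t) within UNIV \<times> UNIV) (\<lambda>(s, t). blinfun_mult_right (?D s t))"
      by (simp add: case_prod_beta' continuous_on_eq_continuous_at)
    have "((\<lambda>(s, t). ?g s t) has_derivative (\<lambda>(u, v). A * u + blinfun_mult_right (?D s t) v))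
      (at (s, t) within UNIV \<times> UNIV)"
      by (rule has_derivative_partialsI[OF 1 2 3]) auto
    then have "((\<lambda>(s, t). ?g s t) has_derivative (\<lambda>(u, v). A * u + blinfun_mult_right (?D s t) v))
      (at (s, a m * s + y m))"
      by (simp add: t_def)
    moreover have "((\<lambda>u. (u, a m * u + y m)) has_derivative (\<lambda>h. (h, a m * h))) (at s)"
      by (rule derivative_eq_intros refl | simp)+
    ultimately have "((\<lambda>u. (\<lambda>(s, t). ?g s t) (u, a m * u + y m)) has_derivative
        (\<lambda>h. (\<lambda>(u, v). A * u + blinfun_mult_right (?D s t) v) (h, a m * h))) (at s)"
      by (rule has_derivative_compose[rotated])
    moreover have "(\<lambda>h. (\<lambda>(u, v). A * u + blinfun_mult_right (?D s t) v) (h, a m * h))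
      = (*) (\<Sum>k<Suc m. a k * partial_deriv k f (p (Suc m) z s))"
      by (auto simp: diag A_def t_def algebra_simps)
    ultimately show ?case
      by (simp add: has_field_derivative_def diag)
  qed
  from this[OF order_refl] have "((\<lambda>s. f (p n y s)) has_real_derivative
      (\<Sum>k<n. a k * partial_deriv k f (p n y t))) (at t)" .
  moreover have "f (p n y s) = f (\<lambda>i. a i * s + y i)" for s
    by (rule Cb_smooth_cong[OF f]) (simp add: p_def)
  moreover have "(\<Sum>k<n. a k * partial_deriv k f (p n y t))
      = (\<Sum>k<n. a k * partial_deriv k f (\<lambda>i. a i * t + y i))"
  proof (intro sum.cong refl arg_cong2[where f = "(*)"])
    fix k assume "k \<in> {..<n}"
    then have "partial_deriv k f \<in> Cb_smooth n" by (intro Cb_smooth_partial[OF f]) simp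
    then show "partial_deriv k f (p n y t) = partial_deriv k f (\<lambda>i. a i * t + y i)"
      by (rule Cb_smooth_cong) (simp add: p_def)
  qed
  ultimately show ?thesis by simp
qed

section \<open>Square-integrable random variables\<close>

lemma L2_D:
  assumes "X \<in> L2 M"
  shows "X \<in> borel_measurable M" "integrable M (\<lambda>\<omega>. (norm (X \<omega>))\<^sup>2)"
  using assms by (auto simp: L2_def)

lemma L2_I:
  "X \<in> borel_measurable M \<Longrightarrow> integrable M (\<lambda>\<omega>. (norm (X \<omega>))\<^sup>2) \<Longrightarrow> X \<in> L2 M"
  by (auto simp: L2_def)

lemma L2_real_square: "(X :: 'a \<Rightarrow> real) \<in> L2 M \<Longrightarrow> integrable M (\<lambda>\<omega>. (X \<omega>)\<^sup>2)"
  by (drule L2_D(2)) simp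

lemma L2_mult_bound:
  fixes Y :: "'a \<Rightarrow> 'b::{banach, second_countable_topology}" and X :: "'a \<Rightarrow> 'c::{banach, second_countable_topology}"
  assumes "X \<in> L2 M" "Y \<in> borel_measurable M" "\<And>\<omega>. norm (Y \<omega>) \<le> c * norm (X \<omega>)"
  shows "Y \<in> L2 M"
proof (rule L2_I[OF assms(2)])
  note [measurable] = L2_D(1)[OF assms(1)] assms(2)
  show "integrable M (\<lambda>\<omega>. (norm (Y \<omega>))\<^sup>2)"
    by (rule Bochner_Integration.integrable_bound[OF integrable_mult_right[OF L2_D(2)[OF assms(1)], of "c\<^sup>2"]])
       (auto simp: power_mult_distrib[symmetric] intro!: power_mono assms(3))
qed

lemma L2_norm: "X \<in> L2 M \<Longrightarrow> (\<lambda>\<omega>. norm (X \<omega>)) \<in> L2 M"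
  by (auto simp: L2_def)

lemma L2_scaleR: "X \<in> L2 M \<Longrightarrow> (\<lambda>\<omega>. c *\<^sub>R X \<omega>) \<in> L2 M"
  by (auto simp: L2_def power_mult_distrib)

lemma L2_add:
  assumes "X \<in> L2 M" "Y \<in> L2 M"
  shows "(\<lambda>\<omega>. X \<omega> + Y \<omega>) \<in> L2 M"
proof (rule L2_I)
  note [measurable] = L2_D(1)[OF assms(1)] L2_D(1)[OF assms(2)]
  show "(\<lambda>\<omega>. X \<omega> + Y \<omega>) \<in> borel_measurable M" by measurable
  have "(norm (x + y))\<^sup>2 \<le> 2 * ((norm x)\<^sup>2 + (norm y)\<^sup>2)" for x y :: 'b
  proof -
    have "(norm (x + y))\<^sup>2 \<le> (norm x + norm y)\<^sup>2"
      by (intro power_mono norm_triangle_ineq) simp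
    also have "\<dots> \<le> 2 * ((norm x)\<^sup>2 + (norm y)\<^sup>2)"
      using sum_squares_bound[of "norm x" "norm y"] by (simp add: power2_sum)
    finally show ?thesis .
  qed
  then show "integrable M (\<lambda>\<omega>. (norm (X \<omega> + Y \<omega>))\<^sup>2)"
    by (intro Bochner_Integration.integrable_bound[OF integrable_mult_right[OF
          Bochner_Integration.integrable_add[OF L2_D(2)[OF assms(1)] L2_D(2)[OF assms(2)]], of 2]])
       (auto intro!: always_eventually)
qed

lemma L2_diff: "X \<in> L2 M \<Longrightarrow> Y \<in> L2 M \<Longrightarrow> (\<lambda>\<omega>. X \<omega> - Y \<omega>) \<in> L2 M"
  using L2_add[of X M "\<lambda>\<omega>. (-1) *\<^sub>R Y \<omega>"] L2_scaleR[of Y M "-1"] by simp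

lemma L2_Cauchy_Schwarz:
  fixes X Y :: "'a \<Rightarrow> real"
  assumes X: "X \<in> L2 M" and Y: "Y \<in> L2 M"
  shows L2_integrable_mult: "integrable M (\<lambda>\<omega>. X \<omega> * Y \<omega>)"
    and "(\<integral>\<omega>. \<bar>X \<omega> * Y \<omega>\<bar> \<partial>M) \<le> sqrt (\<integral>\<omega>. (X \<omega>)\<^sup>2 \<partial>M) * sqrt (\<integral>\<omega>. (Y \<omega>)\<^sup>2 \<partial>M)"
proof -
  note [measurable] = L2_D(1)[OF X] L2_D(1)[OF Y]
  note i = L2_real_square[OF X] L2_real_square[OF Y]
  have "\<bar>x * y\<bar> \<le> x\<^sup>2 + y\<^sup>2" for x y :: real
    using sum_squares_bound[of "\<bar>x\<bar>" "\<bar>y\<bar>"] by (simp add: abs_mult)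
      (metis (no_types) abs_ge_zero add_increasing2 mult_nonneg_nonneg order_trans
        mult.assoc mult_2 le_add_same_cancel1)
  then show int: "integrable M (\<lambda>\<omega>. X \<omega> * Y \<omega>)"
    by (intro Bochner_Integration.integrable_bound[OF Bochner_Integration.integrable_add[OF i]])
       (auto intro!: always_eventually)
  have "(\<integral>\<^sup>+\<omega>. ennreal \<bar>X \<omega>\<bar> * ennreal \<bar>Y \<omega>\<bar> \<partial>M)\<^sup>2
      \<le> (\<integral>\<^sup>+\<omega>. (ennreal \<bar>X \<omega>\<bar>)\<^sup>2 \<partial>M) * (\<integral>\<^sup>+\<omega>. (ennreal \<bar>Y \<omega>\<bar>)\<^sup>2 \<partial>M)"
    by (rule Cauchy_Schwarz_nn_integral) measurable
  also have "(\<integral>\<^sup>+\<omega>. ennreal \<bar>X \<omega>\<bar> * ennreal \<bar>Y \<omega>\<bar> \<partial>M) = ennreal (\<integral>\<omega>. \<bar>X \<omega> * Y \<omega>\<bar> \<partial>M)"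
    using int by (subst nn_integral_eq_integral[symmetric])
      (simp_all add: ennreal_mult[symmetric] abs_mult[symmetric])
  also have "(\<integral>\<^sup>+\<omega>. (ennreal \<bar>X \<omega>\<bar>)\<^sup>2 \<partial>M) = ennreal (\<integral>\<omega>. (X \<omega>)\<^sup>2 \<partial>M)"
    using i by (subst nn_integral_eq_integral[symmetric]) (auto simp: ennreal_power)
  also have "(\<integral>\<^sup>+\<omega>. (ennreal \<bar>Y \<omega>\<bar>)\<^sup>2 \<partial>M) = ennreal (\<integral>\<omega>. (Y \<omega>)\<^sup>2 \<partial>M)"
    using i by (subst nn_integral_eq_integral[symmetric]) (auto simp: ennreal_power)
  finally have "(\<integral>\<omega>. \<bar>X \<omega> * Y \<omega>\<bar> \<partial>M)\<^sup>2 \<le> (\<integral>\<omega>. (X \<omega>)\<^sup>2 \<partial>M) * (\<integral>\<omega>. (Y \<omega>)\<^sup>2 \<partial>M)"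
    by (simp add: ennreal_power ennreal_mult[symmetric])
  then show "(\<integral>\<omega>. \<bar>X \<omega> * Y \<omega>\<bar> \<partial>M) \<le> sqrt (\<integral>\<omega>. (X \<omega>)\<^sup>2 \<partial>M) * sqrt (\<integral>\<omega>. (Y \<omega>)\<^sup>2 \<partial>M)"
    by (metis real_le_rsqrt real_sqrt_mult)
qed

lemma L2_integrable_inner:
  fixes X Y :: "'a \<Rightarrow> 'h::{real_inner, banach, second_countable_topology}"
  assumes X: "X \<in> L2 M" and Y: "Y \<in> L2 M"
  shows "integrable M (\<lambda>\<omega>. inner (X \<omega>) (Y \<omega>))"
proof -
  note [measurable] = L2_D(1)[OF X] L2_D(1)[OF Y]
  show ?thesis
    by (rule Bochner_Integration.integrable_bound[OF L2_integrable_mult[OF L2_norm[OF X] L2_norm[OF Y]]])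
       (auto simp: Cauchy_Schwarz_ineq2)
qed

context prob_space
begin

lemma L2_bounded:
  fixes X :: "'a \<Rightarrow> 'b::{banach, second_countable_topology}"
  assumes "X \<in> borel_measurable M" "\<And>\<omega>. norm (X \<omega>) \<le> B"
  shows "X \<in> L2 M"
  using assms
  by (intro L2_I integrable_const_bound[of _ "B\<^sup>2"]) (auto intro!: power_mono)

lemma L2_integrable:
  assumes "(X :: 'a \<Rightarrow> real) \<in> L2 M" shows "integrable M X"
  using L2_integrable_mult[OF assms L2_bounded[of "\<lambda>_. 1" 1]] by simp

lemma L2_expectation_le:
  assumes "(X :: 'a \<Rightarrow> real) \<in> L2 M"
  shows "expectation (\<lambda>\<omega>. \<bar>X \<omega>\<bar>) \<le> sqrt (expectation (\<lambda>\<omega>. (X \<omega>)\<^sup>2))"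
  using L2_Cauchy_Schwarz(2)[OF assms L2_bounded[of "\<lambda>_. 1" 1]] by (simp add: prob_space)

text \<open>
The rate \<open>(1/4)^n\<close> makes the \<open>L\<^sup>1\<close> norms of the increments summable, so the sequence converges
almost surely; Fatou's lemma turns this into convergence in \<open>L\<^sup>2\<close>.
\<close>
lemma L2_complete:
  fixes X :: "nat \<Rightarrow> 'a \<Rightarrow> real"
  assumes X: "\<And>n. X n \<in> L2 M"
    and cauchy: "\<And>n k. n \<le> k \<Longrightarrow> expectation (\<lambda>\<omega>. (X n \<omega> - X k \<omega>)\<^sup>2) \<le> (1/4)^n"
  obtains d where "d \<in> L2 M" "(\<lambda>n. expectation (\<lambda>\<omega>. (X n \<omega> - d \<omega>)\<^sup>2)) \<longlonglongrightarrow> 0"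
proof -
  note [measurable] = L2_D(1)[OF X]
  note diffL2 = L2_diff[OF X X]
  define d where "d \<omega> = lim (\<lambda>n. X n \<omega>)" for \<omega>
  have [measurable]: "d \<in> borel_measurable M"
    unfolding d_def by (intro borel_measurable_lim_metric) auto
  have step: "(\<integral>\<^sup>+\<omega>. ennreal \<bar>X (Suc n) \<omega> - X n \<omega>\<bar> \<partial>M) \<le> ennreal ((1/2)^n)" for n
  proof -
    have "expectation (\<lambda>\<omega>. \<bar>X n \<omega> - X (Suc n) \<omega>\<bar>) \<le> sqrt ((1/4)^n)"
      using L2_expectation_le[OF diffL2[of n "Suc n"]] cauchy[of n "Suc n"]
      by (meson le_SucI order_refl order_trans real_sqrt_le_mono)
    also have "sqrt ((1/4)^n) = (1/2)^n"
      by (simp add: real_sqrt_power real_sqrt_divide)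
    finally show ?thesis
      using L2_integrable[OF diffL2[of n "Suc n"]]
      by (subst nn_integral_eq_integral) (auto simp: abs_minus_commute)
  qed
  have "(\<integral>\<^sup>+\<omega>. (\<Sum>n. ennreal \<bar>X (Suc n) \<omega> - X n \<omega>\<bar>) \<partial>M)
      = (\<Sum>n. \<integral>\<^sup>+\<omega>. ennreal \<bar>X (Suc n) \<omega> - X n \<omega>\<bar> \<partial>M)"
    by (rule nn_integral_suminf) measurable
  also have "\<dots> \<le> (\<Sum>n. ennreal ((1/2)^n))"
    by (intro suminf_le step) auto
  also have "\<dots> = ennreal (\<Sum>n. (1/2)^n)"
    by (intro suminf_ennreal2) (auto intro: summable_geometric)
  also have "\<dots> < \<infinity>" by simp
  finally have "AE \<omega> in M. (\<Sum>n. ennreal \<bar>X (Suc n) \<omega> - X n \<omega>\<bar>) \<noteq> \<infinity>"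
    by (intro nn_integral_PInf_AE) auto
  then have lim: "AE \<omega> in M. (\<lambda>n. X n \<omega>) \<longlonglongrightarrow> d \<omega>"
  proof eventually_elim
    case (elim \<omega>)
    then have "summable (\<lambda>n. \<bar>X (Suc n) \<omega> - X n \<omega>\<bar>)"
      by (intro summable_suminf_not_top) auto
    then have "summable (\<lambda>n. X (Suc n) \<omega> - X n \<omega>)"
      by (rule summable_rabs_cancel)
    then have "convergent (\<lambda>n. \<Sum>i<n. X (Suc i) \<omega> - X i \<omega>)"
      by (simp add: summable_iff_convergent)
    then have "convergent (\<lambda>n. X n \<omega> - X 0 \<omega>)"
      by (simp add: sum_lessThan_telescope[of "\<lambda>n. X n \<omega>"])
    then have "convergent (\<lambda>n. X n \<omega>)"
      by (simp add: convergent_diff_const_right_iff)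
    then show ?case
      unfolding d_def by (simp add: convergent_LIMSEQ_iff)
  qed
  have bound: "(\<integral>\<^sup>+\<omega>. ennreal ((X n \<omega> - d \<omega>)\<^sup>2) \<partial>M) \<le> ennreal ((1/4)^n)" for n
  proof -
    have "(\<integral>\<^sup>+\<omega>. ennreal ((X n \<omega> - d \<omega>)\<^sup>2) \<partial>M)
        = (\<integral>\<^sup>+\<omega>. liminf (\<lambda>k. ennreal ((X n \<omega> - X k \<omega>)\<^sup>2)) \<partial>M)"
    proof (rule nn_integral_cong_AE)
      show "AE \<omega> in M. ennreal ((X n \<omega> - d \<omega>)\<^sup>2) = liminf (\<lambda>k. ennreal ((X n \<omega> - X k \<omega>)\<^sup>2))"
        using lim
      proof eventually_elim
        case (elim \<omega>)
        have "(\<lambda>k. ennreal ((X n \<omega> - X k \<omega>)\<^sup>2)) \<longlonglongrightarrow> ennreal ((X n \<omega> - d \<omega>)\<^sup>2)"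
          by (intro tendsto_ennrealI tendsto_intros elim)
        then show ?case
          by (rule lim_imp_Liminf[OF trivial_limit_sequentially, symmetric])
      qed
    qed
    also have "\<dots> \<le> liminf (\<lambda>k. \<integral>\<^sup>+\<omega>. ennreal ((X n \<omega> - X k \<omega>)\<^sup>2) \<partial>M)"
      by (rule nn_integral_liminf) measurable
    also have "\<dots> \<le> ennreal ((1/4)^n)"
    proof (rule order_trans[OF Liminf_mono])
      show "\<forall>\<^sub>F k in sequentially. (\<integral>\<^sup>+\<omega>. ennreal ((X n \<omega> - X k \<omega>)\<^sup>2) \<partial>M) \<le> ennreal ((1/4)^n)"
        using eventually_ge_at_top[of n]
      proof eventually_elim
        case (elim k)
        then show ?case
          using cauchy[of n k] L2_real_square[OF diffL2[of n k]]
          by (subst nn_integral_eq_integral) (auto simp: ennreal_leI)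
      qed
    qed (simp add: Liminf_const)
    finally show ?thesis .
  qed
  have dL2: "(\<lambda>\<omega>. X n \<omega> - d \<omega>) \<in> L2 M" for n
  proof (rule L2_I)
    show "integrable M (\<lambda>\<omega>. (norm (X n \<omega> - d \<omega>))\<^sup>2)"
      using bound[of n] by (intro integrableI_nonneg) (auto simp: le_less_trans)
  qed measurable
  have "d \<in> L2 M"
    using L2_diff[OF X[of 0] dL2[of 0]] by simp
  moreover have "(\<lambda>n. expectation (\<lambda>\<omega>. (X n \<omega> - d \<omega>)\<^sup>2)) \<longlonglongrightarrow> 0"
  proof (rule tendsto_sandwich[OF _ _ tendsto_const LIMSEQ_power_zero[of "1/4 :: real"]])
    show "\<forall>\<^sub>F n in sequentially. expectation (\<lambda>\<omega>. (X n \<omega> - d \<omega>)\<^sup>2) \<le> (1/4)^n"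
    proof (intro always_eventually allI)
      fix n
      show "expectation (\<lambda>\<omega>. (X n \<omega> - d \<omega>)\<^sup>2) \<le> (1/4)^n"
        using bound[of n] L2_real_square[OF dL2[of n]]
        by (subst (asm) nn_integral_eq_integral) (auto simp: ennreal_le_iff)
    qed
  qed auto
  ultimately show thesis by (rule that)
qed

text \<open>
A quadratic in \<open>t\<close> that is minimal at \<open>0\<close> has no linear term.
\<close>
lemma quadratic_nonneg_imp_linear_zero:
  fixes c B :: real
  assumes "\<And>t. 0 \<le> 2 * t * c + t\<^sup>2 * B" "B \<ge> 0"
  shows "c = 0"
proof -
  define t where "t = - c / (B + 1)"
  have c: "c = - t * (B + 1)"
    using assms(2) by (simp add: t_def)
  have "2 * t * c + t\<^sup>2 * B = - (t\<^sup>2 * (B + 2))"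
    unfolding c by (simp add: power2_eq_square algebra_simps)
  then have "t\<^sup>2 * (B + 2) \<le> 0"
    using assms(1)[of t] by simp
  then have "t = 0"
    using assms(2) by (simp add: mult_le_0_iff)
  then show ?thesis using c by simp
qed

text \<open>
The Riesz representation theorem for a linear functional that is given as a linear relation \<open>S\<close>
between square-integrable functions on an arbitrary subspace and their values. The representing function is the limit of a minimizing sequence for
\<open>E[X\<^sup>2] - 2 p\<close> over the pairs \<open>(X, p)\<close> in \<open>S\<close>.
\<close>
lemma L2_riesz:
  fixes S :: "(('a \<Rightarrow> real) \<times> real) set"
  assumes ne: "S \<noteq> {}"
    and lin: "\<And>X p Y q a b. (X, p) \<in> S \<Longrightarrow> (Y, q) \<in> S \<Longrightarrow> (\<lambda>\<omega>. a * X \<omega> + b * Y \<omega>, a * p + b * q) \<in> S"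
    and L2: "\<And>X p. (X, p) \<in> S \<Longrightarrow> X \<in> L2 M"
    and bound: "\<And>X p. (X, p) \<in> S \<Longrightarrow> \<bar>p\<bar> \<le> C * sqrt (expectation (\<lambda>\<omega>. (X \<omega>)\<^sup>2))"
  obtains d where "d \<in> L2 M" "\<And>X p. (X, p) \<in> S \<Longrightarrow> p = expectation (\<lambda>\<omega>. X \<omega> * d \<omega>)"
proof -
  (* Minimizing J over S is minimizing the distance to the function to be found. *)
  define J where "J u = expectation (\<lambda>\<omega>. (fst u \<omega>)\<^sup>2) - 2 * snd u" for u :: "('a \<Rightarrow> real) \<times> real"
  have J_ge: "J u \<ge> - C\<^sup>2" if "u \<in> S" for u
  proof -
    obtain X p where u: "u = (X, p)" by force
    (* Completing the square in 2 p \<le> 2 C s, where s is the norm of X. *)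
    let ?s = "sqrt (expectation (\<lambda>\<omega>. (X \<omega>)\<^sup>2))"
    have "2 * p \<le> 2 * (C * ?s)" using bound[of X p] that u by auto
    also have "\<dots> \<le> C\<^sup>2 + ?s\<^sup>2" using sum_squares_bound[of C ?s] by simp
    finally show ?thesis by (simp add: J_def u)
  qed
  define m where "m = Inf (J ` S)"
  have bdd: "bdd_below (J ` S)" using J_ge by (auto intro!: bdd_belowI2)
  have m_le: "m \<le> J u" if "u \<in> S" for u
    unfolding m_def using bdd that by (rule cINF_lower)
  have "\<exists>u. u \<in> S \<and> J u < m + (1/4)^n / 4" for n :: nat
    using cInf_lessD[of "J ` S" "m + (1/4)^n / 4"] ne by (auto simp: m_def)
  then obtain u where u: "\<And>n. u n \<in> S" "\<And>n. J (u n) < m + (1/4)^n / 4"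
    by metis
  define X where "X n = fst (u n)" for n
  define p where "p n = snd (u n)" for n
  have Xp: "(X n, p n) \<in> S" "J (X n, p n) < m + (1/4)^n / 4" for n
    using u by (simp_all add: X_def p_def)
  note XL2 = L2[OF Xp(1)]
  have cauchy: "expectation (\<lambda>\<omega>. (X n \<omega> - X k \<omega>)\<^sup>2) \<le> (1/4)^n" if "n \<le> k" for n k
  proof -
    note [simp] = L2_real_square[OF XL2] L2_integrable_mult[OF XL2 XL2]
    let ?a = "expectation (\<lambda>\<omega>. (X n \<omega>)\<^sup>2)" and ?b = "expectation (\<lambda>\<omega>. (X k \<omega>)\<^sup>2)"
      and ?c = "expectation (\<lambda>\<omega>. X n \<omega> * X k \<omega>)"
    (* The parallelogram identity: the midpoint of X n and X k is again a candidate. *)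
    have "m \<le> J (\<lambda>\<omega>. 1/2 * X n \<omega> + 1/2 * X k \<omega>, 1/2 * p n + 1/2 * p k)"
      by (intro m_le lin Xp)
    also have "\<dots> = expectation (\<lambda>\<omega>. 1/4 * (X n \<omega>)\<^sup>2 + 1/4 * (X k \<omega>)\<^sup>2 + 1/2 * (X n \<omega> * X k \<omega>)) - p n - p k"
      unfolding J_def fst_conv snd_conv
      by (simp add: power2_sum power_mult_distrib power2_eq_square field_simps)
    also have "\<dots> = 1/4 * ?a + 1/4 * ?b + 1/2 * ?c - p n - p k"
      by simp
    finally have 1: "m \<le> 1/4 * ?a + 1/4 * ?b + 1/2 * ?c - p n - p k" .
    have "expectation (\<lambda>\<omega>. (X n \<omega> - X k \<omega>)\<^sup>2)
        = expectation (\<lambda>\<omega>. (X n \<omega>)\<^sup>2 + (X k \<omega>)\<^sup>2 - 2 * (X n \<omega> * X k \<omega>))"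
      by (simp add: power2_diff algebra_simps)
    also have "\<dots> = ?a + ?b - 2 * ?c" by simp
    finally have 2: "expectation (\<lambda>\<omega>. (X n \<omega> - X k \<omega>)\<^sup>2) = ?a + ?b - 2 * ?c" .
    have "(1/4)^k \<le> ((1/4)^n :: real)" using that by (intro power_decreasing) auto
    then show ?thesis
      using 1 2 Xp(2)[of n, unfolded J_def fst_conv snd_conv]
        Xp(2)[of k, unfolded J_def fst_conv snd_conv] by linarith
  qed
  obtain d where d: "d \<in> L2 M" "(\<lambda>n. expectation (\<lambda>\<omega>. (X n \<omega> - d \<omega>)\<^sup>2)) \<longlonglongrightarrow> 0"
    using L2_complete[OF XL2 cauchy] by blast
  have "q = expectation (\<lambda>\<omega>. Y \<omega> * d \<omega>)" if Yq: "(Y, q) \<in> S" for Y q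
  proof -
    note YL2 = L2[OF Yq]
    note [simp] = L2_real_square[OF XL2] L2_real_square[OF YL2] L2_integrable_mult[OF XL2 YL2]
      L2_integrable_mult[OF YL2 XL2] L2_integrable_mult[OF YL2 d(1)]
    let ?B = "expectation (\<lambda>\<omega>. (Y \<omega>)\<^sup>2)"
    let ?c = "\<lambda>n. expectation (\<lambda>\<omega>. Y \<omega> * X n \<omega>)"
    define c where "c = expectation (\<lambda>\<omega>. Y \<omega> * d \<omega>) - q"
    have lim: "?c \<longlonglongrightarrow> expectation (\<lambda>\<omega>. Y \<omega> * d \<omega>)"
    proof (rule LIM_zero_cancel, rule Lim_null_comparison)
      show "\<forall>\<^sub>F n in sequentially. norm (?c n - expectation (\<lambda>\<omega>. Y \<omega> * d \<omega>))
          \<le> sqrt ?B * sqrt (expectation (\<lambda>\<omega>. (X n \<omega> - d \<omega>)\<^sup>2))"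
      proof (intro always_eventually allI)
        fix n
        have "?c n - expectation (\<lambda>\<omega>. Y \<omega> * d \<omega>) = expectation (\<lambda>\<omega>. Y \<omega> * (X n \<omega> - d \<omega>))"
          by (simp add: right_diff_distrib)
        also have "norm \<dots> \<le> expectation (\<lambda>\<omega>. \<bar>Y \<omega> * (X n \<omega> - d \<omega>)\<bar>)"
          using integral_norm_bound[of M "\<lambda>\<omega>. Y \<omega> * (X n \<omega> - d \<omega>)"] by simp
        also have "\<dots> \<le> sqrt ?B * sqrt (expectation (\<lambda>\<omega>. (X n \<omega> - d \<omega>)\<^sup>2))"
          by (rule L2_Cauchy_Schwarz(2)[OF YL2 L2_diff[OF XL2 d(1)]])
        finally show "norm (?c n - expectation (\<lambda>\<omega>. Y \<omega> * d \<omega>))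
          \<le> sqrt ?B * sqrt (expectation (\<lambda>\<omega>. (X n \<omega> - d \<omega>)\<^sup>2))" .
      qed
      show "(\<lambda>n. sqrt ?B * sqrt (expectation (\<lambda>\<omega>. (X n \<omega> - d \<omega>)\<^sup>2))) \<longlonglongrightarrow> 0"
        using tendsto_mult_right_zero[OF tendsto_real_sqrt[OF d(2), unfolded real_sqrt_zero]] by simp
    qed
    have "0 \<le> 2 * t * c + t\<^sup>2 * ?B" for t
    proof -
      have "0 \<le> (1/4)^n / 4 + 2 * t * (?c n - q) + t\<^sup>2 * ?B" for n
      proof -
        have "m \<le> J (\<lambda>\<omega>. 1 * X n \<omega> + t * Y \<omega>, 1 * p n + t * q)"
          by (intro m_le lin Xp Yq)
        also have "\<dots> = expectation (\<lambda>\<omega>. (X n \<omega>)\<^sup>2 + t\<^sup>2 * (Y \<omega>)\<^sup>2 + 2 * t * (Y \<omega> * X n \<omega>)) - 2 * p n - 2 * t * q"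
          unfolding J_def fst_conv snd_conv
          by (simp add: power2_sum power_mult_distrib algebra_simps)
        finally have le: "m \<le> expectation (\<lambda>\<omega>. (X n \<omega>)\<^sup>2 + t\<^sup>2 * (Y \<omega>)\<^sup>2 + 2 * t * (Y \<omega> * X n \<omega>))
            - 2 * p n - 2 * t * q" .
        have "expectation (\<lambda>\<omega>. (X n \<omega>)\<^sup>2 + t\<^sup>2 * (Y \<omega>)\<^sup>2 + 2 * t * (Y \<omega> * X n \<omega>))
            = expectation (\<lambda>\<omega>. (X n \<omega>)\<^sup>2) + t\<^sup>2 * ?B + 2 * t * ?c n"
          by simp
        with le have "m \<le> J (X n, p n) + 2 * t * (?c n - q) + t\<^sup>2 * ?B"
          by (simp add: J_def right_diff_distrib)
        then show ?thesis using Xp(2)[of n] by simp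
      qed
      moreover have "(\<lambda>n. (1/4)^n / 4 + 2 * t * (?c n - q) + t\<^sup>2 * ?B)
          \<longlonglongrightarrow> 0 / 4 + 2 * t * c + t\<^sup>2 * ?B"
        unfolding c_def by (intro tendsto_intros lim LIMSEQ_power_zero) auto
      ultimately have "0 \<le> 0 / 4 + 2 * t * c + t\<^sup>2 * ?B"
        by (intro LIMSEQ_le_const) auto
      then show ?thesis by simp
    qed
    then have "c = 0"
      by (rule quadratic_nonneg_imp_linear_zero) simp
    then show ?thesis by (simp add: c_def)
  qed
  with d(1) show thesis by (rule that)
qed

end

section \<open>Duality for Malliavin differentiable random variables\<close>

lemma abs_integral_le:
  fixes f g :: "'a \<Rightarrow> real"
  assumes "integrable M f" "integrable M g" "\<And>x. \<bar>f x\<bar> \<le> g x"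
  shows "\<bar>integral\<^sup>L M f\<bar> \<le> integral\<^sup>L M g"
  using integral_abs_bound[of M f] integral_mono[OF integrable_abs[OF assms(1)] assms(2)] assms(3)
  by (meson order_trans)

text \<open>
Every derivative of \<open>tanh\<close> is a polynomial in \<open>tanh\<close>, because \<open>tanh' = 1 - tanh\<^sup>2\<close>; this gives
all derivatives and their boundedness at once.
\<close>
lemma tanh_deriv_sequence:
  obtains P :: "nat \<Rightarrow> real \<Rightarrow> real"
  where "P 0 = (\<lambda>x. tanh (k * (x - a)))"
    "\<And>j x. (P j has_real_derivative P (Suc j) x) (at x)"
    "\<And>j. bounded (range (P j))"
proof -
  (* Q j is the polynomial in tanh that represents the j-th derivative. *)
  define Q where "Q = rec_nat [:0, 1:] (\<lambda>_ p. smult k ([:1, 0, -1:] * pderiv p))"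
  have Q: "Q 0 = [:0, 1:]" "Q (Suc j) = smult k ([:1, 0, -1:] * pderiv (Q j))" for j
    by (simp_all add: Q_def)
  define P where "P j x = poly (Q j) (tanh (k * (x - a)))" for j x
  have "(P j has_real_derivative P (Suc j) x) (at x)" for j x
  proof -
    have "((\<lambda>x. tanh (k * (x - a))) has_real_derivative (1 - (tanh (k * (x - a)))\<^sup>2) * k) (at x)"
      by (rule derivative_eq_intros refl | simp)+
    from DERIV_chain2[OF poly_DERIV this] show ?thesis
      unfolding P_def Q by (simp add: algebra_simps power2_eq_square)
  qed
  moreover have "bounded (range (P j))" for j
  proof (rule bounded_subset)
    show "bounded (poly (Q j) ` {-1..1})"
      by (intro compact_imp_bounded compact_continuous_image continuous_intros) simp
    show "range (P j) \<subseteq> poly (Q j) ` {-1..1}"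
      unfolding P_def using tanh_real_lt_1 tanh_real_gt_neg1 by (force simp: less_imp_le)
  qed
  moreover have "P 0 = (\<lambda>x. tanh (k * (x - a)))"
    by (simp add: P_def fun_eq_iff Q)
  ultimately show thesis using that by blast
qed

lemma ln_cosh_bounds: "\<bar>x\<bar> - ln 2 \<le> ln (cosh x)" "ln (cosh x) \<le> \<bar>x\<bar>" for x :: real
proof -
  have c: "cosh x = cosh \<bar>x\<bar>" by (simp add: abs_if)
  have "exp \<bar>x\<bar> / 2 \<le> cosh x"
    by (cases "x \<ge> 0") (simp_all add: cosh_def)
  then have "ln (exp \<bar>x\<bar> / 2) \<le> ln (cosh x)"
    by (subst ln_le_cancel_iff) (auto simp: cosh_real_pos)
  then show "\<bar>x\<bar> - ln 2 \<le> ln (cosh x)" by (simp add: ln_div)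
  have "cosh x \<le> exp \<bar>x\<bar>"
    by (cases "x \<ge> 0") (simp_all add: cosh_def)
  then have "ln (cosh x) \<le> ln (exp \<bar>x\<bar>)"
    by (subst ln_le_cancel_iff) (auto simp: cosh_real_pos)
  then show "ln (cosh x) \<le> \<bar>x\<bar>" by simp
qed

text \<open>
An antiderivative of \<open>tanh (k (x - a)) - tanh (k (x - b))\<close>, which approximates
\<open>x \<mapsto> \<bar>x - a\<bar> - \<bar>x - b\<bar>\<close> as \<open>k\<close> grows. Subtracting two copies keeps it bounded.
\<close>
definition smooth_ramp :: "real \<Rightarrow> real \<Rightarrow> real \<Rightarrow> real \<Rightarrow> real" where
  "smooth_ramp k a b x = (ln (cosh (k * (x - a))) - ln (cosh (k * (x - b)))) / k"

text \<open>
The approximation is uniform, which is what makes the passage \<open>k \<longlonglongrightarrow> \<infinity>\<close> below a matter of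
dominated convergence.
\<close>
lemma smooth_ramp_close:
  assumes "k > 0"
  shows "\<bar>smooth_ramp k a b x - (\<bar>x - a\<bar> - \<bar>x - b\<bar>)\<bar> \<le> 1 / k"
proof -
  have "\<bar>(ln (cosh (k * (x - a))) - ln (cosh (k * (x - b)))) - (\<bar>k * (x - a)\<bar> - \<bar>k * (x - b)\<bar>)\<bar> \<le> ln 2"
    using ln_cosh_bounds[of "k * (x - a)"] ln_cosh_bounds[of "k * (x - b)"] by linarith
  also have "\<dots> \<le> 1" using ln_2_less_1 by simp
  finally have "\<bar>(ln (cosh (k * (x - a))) - ln (cosh (k * (x - b)))) - (\<bar>k * (x - a)\<bar> - \<bar>k * (x - b)\<bar>)\<bar> / k \<le> 1 / k"
    using assms by (intro divide_right_mono) auto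
  also have "\<bar>(ln (cosh (k * (x - a))) - ln (cosh (k * (x - b)))) - (\<bar>k * (x - a)\<bar> - \<bar>k * (x - b)\<bar>)\<bar> / k
    = \<bar>((ln (cosh (k * (x - a))) - ln (cosh (k * (x - b)))) - (\<bar>k * (x - a)\<bar> - \<bar>k * (x - b)\<bar>)) / k\<bar>"
    using assms by simp
  also have "\<dots> = \<bar>smooth_ramp k a b x - (\<bar>x - a\<bar> - \<bar>x - b\<bar>)\<bar>"
    using assms unfolding smooth_ramp_def by (simp add: abs_mult diff_divide_distrib)
  finally show ?thesis .
qed

lemma smooth_ramp_deriv_sequence:
  assumes "k > 0"
  obtains \<Phi> :: "nat \<Rightarrow> real \<Rightarrow> real"
  where "\<Phi> 0 = smooth_ramp k a b"
    "\<Phi> 1 = (\<lambda>x. tanh (k * (x - a)) - tanh (k * (x - b)))"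
    "\<And>j x. (\<Phi> j has_real_derivative \<Phi> (Suc j) x) (at x)"
    "\<And>j. bounded (range (\<Phi> j))"
proof -
  obtain P where P: "P 0 = (\<lambda>x. tanh (k * (x - a)))"
    "\<And>j x. (P j has_real_derivative P (Suc j) x) (at x)" "\<And>j. bounded (range (P j))"
    by (rule tanh_deriv_sequence[of k a]) blast
  obtain Q where Q: "Q 0 = (\<lambda>x. tanh (k * (x - b)))"
    "\<And>j x. (Q j has_real_derivative Q (Suc j) x) (at x)" "\<And>j. bounded (range (Q j))"
    by (rule tanh_deriv_sequence[of k b]) blast
  define \<Phi> where "\<Phi> j = (case j of 0 \<Rightarrow> smooth_ramp k a b | Suc i \<Rightarrow> (\<lambda>x. P i x - Q i x))" for j
  have "(\<Phi> j has_real_derivative \<Phi> (Suc j) x) (at x)" for j x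
  proof (cases j)
    case 0
    have "((\<lambda>x. ln (cosh (k * (x - c)))) has_real_derivative tanh (k * (x - c)) * k) (at x)" for c
      by (rule derivative_eq_intros refl cosh_real_pos | simp add: tanh_def)+
    then have "(smooth_ramp k a b has_real_derivative
        (tanh (k * (x - a)) * k - tanh (k * (x - b)) * k) / k) (at x)"
      unfolding smooth_ramp_def by (intro DERIV_cdivide DERIV_diff)
    then show ?thesis
      using assms by (simp add: 0 \<Phi>_def P Q diff_divide_distrib)
  next
    case (Suc i)
    then show ?thesis by (auto simp: \<Phi>_def intro!: DERIV_diff P Q)
  qed
  moreover have "bounded (range (\<Phi> j))" for j
  proof (cases j)
    case 0
    have "\<bar>smooth_ramp k a b x\<bar> \<le> 1 / k + \<bar>a - b\<bar>" for x
      using smooth_ramp_close[OF assms, of a b x] by linarith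
    then show ?thesis by (auto simp: 0 \<Phi>_def bounded_iff)
  next
    case (Suc i)
    then show ?thesis by (auto simp: \<Phi>_def intro!: bounded_minus_comp P Q)
  qed
  moreover have "\<Phi> 0 = smooth_ramp k a b" "\<Phi> 1 = (\<lambda>x. tanh (k * (x - a)) - tanh (k * (x - b)))"
    by (simp_all add: \<Phi>_def P Q)
  ultimately show thesis using that by blast
qed

lemma smooth_with_deriv_lincomb:
  assumes "smooth_with_deriv W F G" "smooth_with_deriv W F' G'"
  shows "smooth_with_deriv W (\<lambda>\<omega>. a * F \<omega> + b * F' \<omega>) (\<lambda>\<omega>. a *\<^sub>R G \<omega> + b *\<^sub>R G' \<omega>)"
proof -
  obtain n f h where f: "f \<in> Cb_smooth n" and F: "F = (\<lambda>\<omega>. f (\<lambda>i. W (h i) \<omega>))"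
    and G: "G = (\<lambda>\<omega>. \<Sum>k<n. partial_deriv k f (\<lambda>i. W (h i) \<omega>) *\<^sub>R h k)"
    using assms(1) unfolding smooth_with_deriv_def by blast
  obtain m f' h' where f': "f' \<in> Cb_smooth m" and F': "F' = (\<lambda>\<omega>. f' (\<lambda>i. W (h' i) \<omega>))"
    and G': "G' = (\<lambda>\<omega>. \<Sum>k<m. partial_deriv k f' (\<lambda>i. W (h' i) \<omega>) *\<^sub>R h' k)"
    using assms(2) unfolding smooth_with_deriv_def by blast
  define g where "g x = a * f x + b * f' (\<lambda>i. x (i + n))" for x
  define l where "l i = (if i < n then h i else h' (i - n))" for i
  note comb = Cb_smooth_lincomb[OF f f', where a = a and b = b, folded g_def]
  have f_eq: "p (\<lambda>i. W (l i) \<omega>) = p (\<lambda>i. W (h i) \<omega>)" if "p \<in> Cb_smooth n" for p \<omega>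
    by (rule Cb_smooth_cong[OF that]) (simp add: l_def)
  have split: "(\<Sum>k<n+j. q k) = (\<Sum>k<n. q k) + (\<Sum>k<j. q (n + k))" for q :: "nat \<Rightarrow> 'a" and j
    by (induction j) (simp_all add: add.assoc)
  have shift: "(\<lambda>i. W (l (i + n)) \<omega>) = (\<lambda>i. W (h' i) \<omega>)" for \<omega>
    by (simp add: l_def)
  have "(\<lambda>\<omega>. a * F \<omega> + b * F' \<omega>) = (\<lambda>\<omega>. g (\<lambda>i. W (l i) \<omega>))"
    by (simp add: F F' g_def f_eq[OF f] shift)
  moreover have "(\<lambda>\<omega>. a *\<^sub>R G \<omega> + b *\<^sub>R G' \<omega>)
      = (\<lambda>\<omega>. \<Sum>k<n+m. partial_deriv k g (\<lambda>i. W (l i) \<omega>) *\<^sub>R l k)"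
  proof
    fix \<omega>
    let ?x = "\<lambda>i. W (l i) \<omega>"
    have "(\<Sum>k<n+m. partial_deriv k g ?x *\<^sub>R l k)
        = (\<Sum>k<n. partial_deriv k g ?x *\<^sub>R l k) + (\<Sum>k<m. partial_deriv (n + k) g ?x *\<^sub>R l (n + k))"
      by (rule split)
    also have "(\<Sum>k<n. partial_deriv k g ?x *\<^sub>R l k) = a *\<^sub>R G \<omega>"
      unfolding G scaleR_sum_right
      by (intro sum.cong refl) (simp add: comb(2) f_eq[OF Cb_smooth_partial[OF f]], simp add: l_def)
    also have "(\<Sum>k<m. partial_deriv (n + k) g ?x *\<^sub>R l (n + k)) = b *\<^sub>R G' \<omega>"
      unfolding G' scaleR_sum_right
      by (intro sum.cong refl) (simp add: comb(3) shift, simp add: l_def)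
    finally show "a *\<^sub>R G \<omega> + b *\<^sub>R G' \<omega> = (\<Sum>k<n+m. partial_deriv k g ?x *\<^sub>R l k)" ..
  qed
  ultimately show ?thesis
    unfolding smooth_with_deriv_def using comb(1) by blast
qed

lemma smooth_with_deriv_compose:
  assumes "smooth_with_deriv W F G"
    and "\<And>j x. (\<Phi> j has_real_derivative \<Phi> (Suc j) x) (at x)" "\<And>j. bounded (range (\<Phi> j))"
  shows "smooth_with_deriv W (\<lambda>\<omega>. \<Phi> j (F \<omega>)) (\<lambda>\<omega>. \<Phi> (Suc j) (F \<omega>) *\<^sub>R G \<omega>)"
proof -
  obtain n f h where f: "f \<in> Cb_smooth n" and F: "F = (\<lambda>\<omega>. f (\<lambda>i. W (h i) \<omega>))"
    and G: "G = (\<lambda>\<omega>. \<Sum>k<n. partial_deriv k f (\<lambda>i. W (h i) \<omega>) *\<^sub>R h k)"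
    using assms(1) unfolding smooth_with_deriv_def by blast
  note comp = Cb_smooth_compose[where \<Phi> = \<Phi>, OF f assms(2,3)]
  show ?thesis
    unfolding smooth_with_deriv_def
    by (intro exI[of _ n] exI[of _ "\<lambda>x. \<Phi> j (f x)"] exI[of _ h] conjI comp(1))
       (simp_all add: F G comp(2) scaleR_sum_right)
qed

lemma tanh_tendsto_sgn: "(\<lambda>n. tanh (real (Suc n) * x)) \<longlonglongrightarrow> sgn x" for x :: real
proof -
  have Suc: "filterlim (\<lambda>n. real (Suc n)) at_top sequentially"
    by (rule filterlim_compose[OF filterlim_real_sequentially filterlim_Suc])
  consider "x > 0" | "x = 0" | "x < 0" by linarith
  then show ?thesis
  proof cases
    case 1
    from filterlim_compose[OF tanh_real_at_top filterlim_tendsto_pos_mult_at_top[OF tendsto_const 1 Suc]]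
    show ?thesis using 1 by (simp add: mult.commute)
  next
    case 3
    from filterlim_compose[OF tanh_real_at_bot filterlim_tendsto_neg_mult_at_bot[OF tendsto_const 3 Suc]]
    show ?thesis using 3 by (simp add: mult.commute)
  qed simp
qed

context isonormal_gaussian_process
begin

lemma W_measurable [measurable]: "W h \<in> borel_measurable M"
  using gaussian_family[of "{h}" "\<lambda>_. 1"] by (simp add: centered_gaussian_def)

lemma smooth_with_deriv_bounded:
  assumes "smooth_with_deriv W F G"
  shows "F \<in> borel_measurable M" "G \<in> borel_measurable M"
    and "\<exists>B. \<forall>\<omega>. \<bar>F \<omega>\<bar> \<le> B" "\<exists>B. \<forall>\<omega>. norm (G \<omega>) \<le> B"
proof -
  obtain n f h where f: "f \<in> Cb_smooth n" and F: "F = (\<lambda>\<omega>. f (\<lambda>i. W (h i) \<omega>))"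
    and G: "G = (\<lambda>\<omega>. \<Sum>k<n. partial_deriv k f (\<lambda>i. W (h i) \<omega>) *\<^sub>R h k)"
    using assms(1) unfolding smooth_with_deriv_def by blast
  have "(\<lambda>\<omega>. (\<lambda>i. W (h i) \<omega>)) \<in> borel_measurable M"
    by (intro measurable_coordinatewise_then_product) simp
  then have meas: "(\<lambda>\<omega>. p (\<lambda>i. W (h i) \<omega>)) \<in> borel_measurable M" if "p \<in> Cb_smooth n" for p
    by (rule borel_measurable_continuous_on[OF Cb_smooth_continuous[OF that]])
  show "F \<in> borel_measurable M" "G \<in> borel_measurable M"
    unfolding F G by (auto intro!: borel_measurable_sum borel_measurable_scaleR meas f Cb_smooth_partial)
  show "\<exists>B. \<forall>\<omega>. \<bar>F \<omega>\<bar> \<le> B"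
    using Cb_smooth_bounded[OF f] unfolding F bounded_iff by auto
  have "\<exists>B. \<forall>x. \<bar>partial_deriv k f x\<bar> \<le> B" if "k < n" for k
    using Cb_smooth_bounded[OF Cb_smooth_partial[OF f that]] unfolding bounded_iff by auto
  then obtain B where B: "\<And>k x. k < n \<Longrightarrow> \<bar>partial_deriv k f x\<bar> \<le> B k" by metis
  have "norm (G \<omega>) \<le> (\<Sum>k<n. B k * norm (h k))" for \<omega>
    unfolding G by (intro sum_norm_le) (auto intro!: mult_right_mono B)
  then show "\<exists>B. \<forall>\<omega>. norm (G \<omega>) \<le> B" by blast
qed

lemma smooth_with_deriv_L2:
  assumes "smooth_with_deriv W F G"
  shows "F \<in> L2 M" "G \<in> L2 M"
  using smooth_with_deriv_bounded[OF assms] by (metis L2_bounded real_norm_def)+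

text \<open>
Passing to a subsequence gives almost sure convergence of the approximating random variables, so
that nonlinear functions of them converge as well.
\<close>
lemma malliavin_approximation:
  assumes "has_malliavin_deriv M W F G"
  obtains Fn Gn where "\<And>n. smooth_with_deriv W (Fn n) (Gn n)"
    "AE \<omega> in M. (\<lambda>n. Fn n \<omega>) \<longlonglongrightarrow> F \<omega>"
    "(\<lambda>n. expectation (\<lambda>\<omega>. (norm (Gn n \<omega> - G \<omega>))\<^sup>2)) \<longlonglongrightarrow> 0"
proof -
  obtain Fn Gn where s: "\<And>n. smooth_with_deriv W (Fn n) (Gn n)"
    and lim: "(\<lambda>n. sobolev_norm_sq M (\<lambda>\<omega>. Fn n \<omega> - F \<omega>) (\<lambda>\<omega>. Gn n \<omega> - G \<omega>)) \<longlonglongrightarrow> 0"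
    and F: "F \<in> L2 M"
    using assms unfolding has_malliavin_deriv_def by blast
  note diff = L2_diff[OF smooth_with_deriv_L2(1)[OF s] F]
  have "(\<lambda>n. expectation (\<lambda>\<omega>. (Fn n \<omega> - F \<omega>)\<^sup>2)) \<longlonglongrightarrow> 0"
    by (rule tendsto_sandwich[OF _ _ tendsto_const lim]) (auto simp: sobolev_norm_sq_def)
  then have sq: "(\<lambda>n. sqrt (expectation (\<lambda>\<omega>. (Fn n \<omega> - F \<omega>)\<^sup>2))) \<longlonglongrightarrow> 0"
    using tendsto_real_sqrt by fastforce
  have "(\<lambda>n. expectation (\<lambda>\<omega>. norm (Fn n \<omega> - F \<omega>))) \<longlonglongrightarrow> 0"
    by (rule tendsto_sandwich[OF _ _ tendsto_const sq]) (use L2_expectation_le[OF diff] in \<open>auto intro!: always_eventually\<close>)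
  from tendsto_L1_AE_subseq[OF L2_integrable[OF diff] this]
  obtain r where r: "strict_mono r" "AE \<omega> in M. (\<lambda>n. Fn (r n) \<omega> - F \<omega>) \<longlonglongrightarrow> 0" by blast
  have "(\<lambda>n. expectation (\<lambda>\<omega>. (norm (Gn n \<omega> - G \<omega>))\<^sup>2)) \<longlonglongrightarrow> 0"
    by (rule tendsto_sandwich[OF _ _ tendsto_const lim]) (auto simp: sobolev_norm_sq_def)
  from LIMSEQ_subseq_LIMSEQ[OF this r(1)] r(2) s show thesis
    by (intro that[of "\<lambda>n. Fn (r n)" "\<lambda>n. Gn (r n)"]) (auto simp: o_def LIM_zero_iff)
qed

text \<open>
The chain rule \<open>D \<phi>(F) = \<phi>'(F) DF\<close> combined with a duality relation, stated only in the form in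
which it is used: a relation that holds for smooth random variables is tested with \<open>\<phi>(F)\<close>. The
hypothesis \<open>dual\<close> covers both the divergence operator and Gaussian integration by parts.
\<close>
lemma malliavin_chain_duality:
  assumes FG: "has_malliavin_deriv M W F G"
    and v: "v \<in> L2 M" and d: "d \<in> L2 M"
    and dual: "\<And>H K. smooth_with_deriv W H K \<Longrightarrow>
      expectation (\<lambda>\<omega>. inner (K \<omega>) (v \<omega>)) = expectation (\<lambda>\<omega>. H \<omega> * d \<omega>)"
    and \<Phi>: "\<And>j x. (\<Phi> j has_real_derivative \<Phi> (Suc j) x) (at x)" "\<And>j. bounded (range (\<Phi> j))"
  shows "expectation (\<lambda>\<omega>. \<Phi> 1 (F \<omega>) * inner (G \<omega>) (v \<omega>)) = expectation (\<lambda>\<omega>. \<Phi> 0 (F \<omega>) * d \<omega>)"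
proof -
  obtain Fn Gn where s: "\<And>n. smooth_with_deriv W (Fn n) (Gn n)"
    and lim_F: "AE \<omega> in M. (\<lambda>n. Fn n \<omega>) \<longlonglongrightarrow> F \<omega>"
    and lim_G: "(\<lambda>n. expectation (\<lambda>\<omega>. (norm (Gn n \<omega> - G \<omega>))\<^sup>2)) \<longlonglongrightarrow> 0"
    using malliavin_approximation[OF FG] by blast
  have F: "F \<in> L2 M" and G: "G \<in> L2 M"
    using FG by (auto simp: has_malliavin_deriv_def)
  obtain B where B: "\<And>j x. \<bar>\<Phi> j x\<bar> \<le> B j"
    using \<Phi>(2) unfolding bounded_iff by (metis rangeI real_norm_def)
  have cont: "isCont (\<Phi> j) x" for j x by (rule DERIV_isCont[OF \<Phi>(1)])
  have [measurable]: "\<Phi> j \<in> borel_measurable borel" for j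
    by (intro borel_measurable_continuous_onI continuous_at_imp_continuous_on) (simp add: cont)
  note [measurable] = L2_D(1)[OF F] L2_D(1)[OF G] L2_D(1)[OF v] L2_D(1)[OF d]
    smooth_with_deriv_bounded(1,2)[OF s]
  note GL2 = L2_diff[OF smooth_with_deriv_L2(2)[OF s] G]
  have L: "(\<lambda>n. expectation (\<lambda>\<omega>. \<Phi> j (Fn n \<omega>) * X \<omega>)) \<longlonglongrightarrow> expectation (\<lambda>\<omega>. \<Phi> j (F \<omega>) * X \<omega>)"
    if X: "integrable M X" for j X
  proof (rule integral_dominated_convergence[where w = "\<lambda>\<omega>. B j * \<bar>X \<omega>\<bar>"])
    note [measurable] = borel_measurable_integrable[OF X]
    show "(\<lambda>\<omega>. \<Phi> j (F \<omega>) * X \<omega>) \<in> borel_measurable M"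
      "\<And>n. (\<lambda>\<omega>. \<Phi> j (Fn n \<omega>) * X \<omega>) \<in> borel_measurable M" by measurable
    show "AE \<omega> in M. (\<lambda>n. \<Phi> j (Fn n \<omega>) * X \<omega>) \<longlonglongrightarrow> \<Phi> j (F \<omega>) * X \<omega>"
      using lim_F by eventually_elim (intro tendsto_intros isCont_tendsto_compose[OF cont])
    show "AE \<omega> in M. norm (\<Phi> j (Fn n \<omega>) * X \<omega>) \<le> B j * \<bar>X \<omega>\<bar>" for n
      using B by (auto simp: abs_mult intro!: mult_right_mono)
    show "integrable M (\<lambda>\<omega>. B j * \<bar>X \<omega>\<bar>)" using X by simp
  qed
  have int_Gv: "integrable M (\<lambda>\<omega>. inner (G \<omega>) (v \<omega>))"
    by (rule L2_integrable_inner[OF G v])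
  have int_Gn: "integrable M (\<lambda>\<omega>. inner (Gn n \<omega> - G \<omega>) (v \<omega>))" for n
    by (rule L2_integrable_inner[OF GL2 v])
  have mult_int: "integrable M (\<lambda>\<omega>. \<Phi> j (H \<omega>) * X \<omega>)"
    if "integrable M X" "H \<in> borel_measurable M" for j X H
    using that B by (intro Bochner_Integration.integrable_bound[OF integrable_mult_right[OF
          integrable_abs[OF that(1)], of "B j"]])
      (auto simp: abs_mult intro!: always_eventually mult_right_mono order_trans[OF B abs_ge_self])
  (* The derivatives converge only in L2, so Gn is replaced by G before the limit in \<Phi> 1 (Fn n). *)
  have "(\<lambda>n. expectation (\<lambda>\<omega>. \<Phi> 1 (Fn n \<omega>) * inner (Gn n \<omega> - G \<omega>) (v \<omega>))) \<longlonglongrightarrow> 0"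
  proof (rule Lim_null_comparison)
    let ?b = "\<lambda>n. B 1 * (sqrt (expectation (\<lambda>\<omega>. (norm (Gn n \<omega> - G \<omega>))\<^sup>2)) * sqrt (expectation (\<lambda>\<omega>. (norm (v \<omega>))\<^sup>2)))"
    show "\<forall>\<^sub>F n in sequentially. norm (expectation (\<lambda>\<omega>. \<Phi> 1 (Fn n \<omega>) * inner (Gn n \<omega> - G \<omega>) (v \<omega>))) \<le> ?b n"
    proof (intro always_eventually allI)
      fix n
      have "norm (expectation (\<lambda>\<omega>. \<Phi> 1 (Fn n \<omega>) * inner (Gn n \<omega> - G \<omega>) (v \<omega>)))
          \<le> expectation (\<lambda>\<omega>. B 1 * \<bar>norm (Gn n \<omega> - G \<omega>) * norm (v \<omega>)\<bar>)"
      proof (unfold real_norm_def, rule abs_integral_le)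
        show "integrable M (\<lambda>\<omega>. \<Phi> 1 (Fn n \<omega>) * inner (Gn n \<omega> - G \<omega>) (v \<omega>))"
          by (intro mult_int int_Gn) measurable
        show "integrable M (\<lambda>\<omega>. B 1 * \<bar>norm (Gn n \<omega> - G \<omega>) * norm (v \<omega>)\<bar>)"
          by (intro integrable_mult_right integrable_abs L2_integrable_mult L2_norm GL2 v)
        show "\<bar>\<Phi> 1 (Fn n \<omega>) * inner (Gn n \<omega> - G \<omega>) (v \<omega>)\<bar>
            \<le> B 1 * \<bar>norm (Gn n \<omega> - G \<omega>) * norm (v \<omega>)\<bar>" for \<omega>
          using order_trans[OF abs_ge_zero B]
          by (auto simp: abs_mult intro!: mult_mono B Cauchy_Schwarz_ineq2)
      qed
      also have "\<dots> \<le> ?b n"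
        using L2_Cauchy_Schwarz(2)[OF L2_norm[OF GL2[of n]] L2_norm[OF v]] B[of 1 0]
        by (simp add: mult_left_mono)
      finally show "norm (expectation (\<lambda>\<omega>. \<Phi> 1 (Fn n \<omega>) * inner (Gn n \<omega> - G \<omega>) (v \<omega>))) \<le> ?b n" .
    qed
    have "?b \<longlonglongrightarrow> B 1 * (sqrt 0 * sqrt (expectation (\<lambda>\<omega>. (norm (v \<omega>))\<^sup>2)))"
      by (intro tendsto_intros lim_G)
    then show "?b \<longlonglongrightarrow> 0" by simp
  qed
  from tendsto_add[OF this L[OF int_Gv, of 1]]
  have "(\<lambda>n. expectation (\<lambda>\<omega>. \<Phi> 1 (Fn n \<omega>) * inner (Gn n \<omega>) (v \<omega>)))
      \<longlonglongrightarrow> expectation (\<lambda>\<omega>. \<Phi> 1 (F \<omega>) * inner (G \<omega>) (v \<omega>))"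
    by (simp add: mult_int int_Gn int_Gv flip: Bochner_Integration.integral_add)
       (simp add: inner_diff_left algebra_simps)
  moreover have "expectation (\<lambda>\<omega>. \<Phi> 1 (Fn n \<omega>) * inner (Gn n \<omega>) (v \<omega>))
      = expectation (\<lambda>\<omega>. \<Phi> 0 (Fn n \<omega>) * d \<omega>)" for n
    using dual[OF smooth_with_deriv_compose[where \<Phi> = \<Phi> and j = 0, OF s \<Phi>]] by simp
  ultimately show ?thesis
    using L[OF L2_integrable[OF d], of 0] by (simp add: LIMSEQ_unique)
qed

text \<open>
The central identity: the duality tested with the non-smooth function
\<open>x \<mapsto> \<bar>x - a\<bar> - \<bar>x - b\<bar>\<close>. The convention \<open>sgn 0 = 0\<close> is the one that \<open>tanh\<close> produces in the limit, so
the identity is exact also at the atoms of \<open>F\<close> and can be used to exclude them.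
\<close>
lemma malliavin_sgn_duality:
  assumes FG: "has_malliavin_deriv M W F G"
    and v: "v \<in> L2 M" and d: "d \<in> L2 M"
    and dual: "\<And>H K. smooth_with_deriv W H K \<Longrightarrow>
      expectation (\<lambda>\<omega>. inner (K \<omega>) (v \<omega>)) = expectation (\<lambda>\<omega>. H \<omega> * d \<omega>)"
  shows "expectation (\<lambda>\<omega>. (sgn (F \<omega> - a) - sgn (F \<omega> - b)) * inner (G \<omega>) (v \<omega>))
    = expectation (\<lambda>\<omega>. (\<bar>F \<omega> - a\<bar> - \<bar>F \<omega> - b\<bar>) * d \<omega>)"
proof -
  have F: "F \<in> L2 M" and G: "G \<in> L2 M"
    using FG by (auto simp: has_malliavin_deriv_def)
  note [measurable] = L2_D(1)[OF F] L2_D(1)[OF G] L2_D(1)[OF v] L2_D(1)[OF d]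
  let ?k = "\<lambda>n. real (Suc n)"
  let ?T = "\<lambda>n x. tanh (?k n * (x - a)) - tanh (?k n * (x - b))"
  have eq: "expectation (\<lambda>\<omega>. ?T n (F \<omega>) * inner (G \<omega>) (v \<omega>))
      = expectation (\<lambda>\<omega>. smooth_ramp (?k n) a b (F \<omega>) * d \<omega>)" for n
  proof -
    obtain \<Phi> where "\<Phi> 0 = smooth_ramp (?k n) a b" "\<Phi> 1 = ?T n"
      "\<And>j x. (\<Phi> j has_real_derivative \<Phi> (Suc j) x) (at x)" "\<And>j. bounded (range (\<Phi> j))"
      using smooth_ramp_deriv_sequence[of "?k n" a b] by auto
    with malliavin_chain_duality[OF FG v d dual, of \<Phi>] show ?thesis by simp
  qed
  have int_Gv: "integrable M (\<lambda>\<omega>. inner (G \<omega>) (v \<omega>))"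
    by (rule L2_integrable_inner[OF G v])
  have [measurable]: "smooth_ramp k a b \<in> borel_measurable borel" for k
    unfolding smooth_ramp_def cosh_def by measurable
  have tanh_meas [measurable]: "(tanh :: real \<Rightarrow> real) \<in> borel_measurable borel"
    by (intro borel_measurable_continuous_onI continuous_intros) auto
  have "(\<lambda>n. expectation (\<lambda>\<omega>. ?T n (F \<omega>) * inner (G \<omega>) (v \<omega>)))
      \<longlonglongrightarrow> expectation (\<lambda>\<omega>. (sgn (F \<omega> - a) - sgn (F \<omega> - b)) * inner (G \<omega>) (v \<omega>))"
  proof (rule integral_dominated_convergence[where w = "\<lambda>\<omega>. 2 * \<bar>inner (G \<omega>) (v \<omega>)\<bar>"])
    show "AE \<omega> in M. (\<lambda>n. ?T n (F \<omega>) * inner (G \<omega>) (v \<omega>))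
        \<longlonglongrightarrow> (sgn (F \<omega> - a) - sgn (F \<omega> - b)) * inner (G \<omega>) (v \<omega>)"
      by (intro always_eventually allI tendsto_intros tanh_tendsto_sgn)
    have "\<bar>tanh x - tanh y\<bar> \<le> 2" for x y :: real
      using tanh_real_lt_1[of x] tanh_real_gt_neg1[of x] tanh_real_lt_1[of y] tanh_real_gt_neg1[of y]
      by linarith
    then show "AE \<omega> in M. norm (?T n (F \<omega>) * inner (G \<omega>) (v \<omega>)) \<le> 2 * \<bar>inner (G \<omega>) (v \<omega>)\<bar>" for n
      by (auto simp: abs_mult intro!: mult_right_mono)
  qed (use int_Gv in \<open>auto\<close>)
  moreover have "(\<lambda>n. expectation (\<lambda>\<omega>. smooth_ramp (?k n) a b (F \<omega>) * d \<omega>))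
      \<longlonglongrightarrow> expectation (\<lambda>\<omega>. (\<bar>F \<omega> - a\<bar> - \<bar>F \<omega> - b\<bar>) * d \<omega>)"
  proof (rule integral_dominated_convergence[where w = "\<lambda>\<omega>. (1 + \<bar>a - b\<bar>) * \<bar>d \<omega>\<bar>"])
    have "(\<lambda>n. smooth_ramp (?k n) a b x) \<longlonglongrightarrow> \<bar>x - a\<bar> - \<bar>x - b\<bar>" for x
    proof (rule LIM_zero_cancel, rule Lim_null_comparison)
      show "\<forall>\<^sub>F n in sequentially. norm (smooth_ramp (?k n) a b x - (\<bar>x - a\<bar> - \<bar>x - b\<bar>)) \<le> inverse (?k n)"
        using smooth_ramp_close[of "?k _" a b x] by (auto simp: inverse_eq_divide)
    qed (rule LIMSEQ_inverse_real_of_nat)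
    then show "AE \<omega> in M. (\<lambda>n. smooth_ramp (?k n) a b (F \<omega>) * d \<omega>)
        \<longlonglongrightarrow> (\<bar>F \<omega> - a\<bar> - \<bar>F \<omega> - b\<bar>) * d \<omega>"
      by (intro always_eventually allI tendsto_intros)
    have "\<bar>smooth_ramp (?k n) a b x\<bar> \<le> 1 + \<bar>a - b\<bar>" for x n
    proof -
      have "1 / ?k n \<le> 1" by simp
      then show ?thesis using smooth_ramp_close[of "?k n" a b x] by linarith
    qed
    then show "AE \<omega> in M. norm (smooth_ramp (?k n) a b (F \<omega>) * d \<omega>) \<le> (1 + \<bar>a - b\<bar>) * \<bar>d \<omega>\<bar>" for n
      by (auto simp: abs_mult intro!: mult_right_mono)
  qed (use L2_integrable[OF d] in \<open>auto\<close>)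
  ultimately show ?thesis
    unfolding eq by (rule LIMSEQ_unique)
qed

end

context isonormal_gaussian_process
begin

text \<open>
The defining property of the divergence, obtained from the Riesz representation theorem: the
bound in the definition of the domain says that \<open>H \<mapsto> E[\<langle>DH, v\<rangle>]\<close> is a bounded linear relation.
\<close>
lemma divergence_duality:
  assumes "v \<in> dom_divergence M W"
  shows "divergence M W v \<in> L2 M"
    and "smooth_with_deriv W H K \<Longrightarrow>
      expectation (\<lambda>\<omega>. inner (K \<omega>) (v \<omega>)) = expectation (\<lambda>\<omega>. H \<omega> * divergence M W v \<omega>)"
proof -
  obtain C where v: "v \<in> L2 M" and C: "\<And>F G. smooth_with_deriv W F G \<Longrightarrow>
     \<bar>\<integral>\<omega>. inner (G \<omega>) (v \<omega>) \<partial>M\<bar> \<le> C * sqrt (\<integral>\<omega>. (F \<omega>)\<^sup>2 \<partial>M)"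
    using assms unfolding dom_divergence_def by blast
  define S where "S = {(F, expectation (\<lambda>\<omega>. inner (G \<omega>) (v \<omega>))) | F G. smooth_with_deriv W F G}"
  have "\<exists>d. d \<in> L2 M \<and> (\<forall>X p. (X, p) \<in> S \<longrightarrow> p = expectation (\<lambda>\<omega>. X \<omega> * d \<omega>))"
  proof (rule L2_riesz[of S C])
    (* The constant zero, as a function of no variables, shows that S is nonempty. *)
    have "smooth_with_deriv W (\<lambda>\<omega>. 0) (\<lambda>\<omega>. \<Sum>k<0. partial_deriv k (\<lambda>x. 0) (\<lambda>i. W 0 \<omega>) *\<^sub>R 0)"
      unfolding smooth_with_deriv_def
      by (intro exI[of _ "0::nat"] exI[of _ "\<lambda>x. 0"] exI[of _ "\<lambda>_. 0"] conjI Cb_smooth_const refl)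
    then show "S \<noteq> {}" unfolding S_def by blast
    show "(\<lambda>\<omega>. a * X \<omega> + b * Y \<omega>, a * p + b * q) \<in> S" if "(X, p) \<in> S" "(Y, q) \<in> S" for X p Y q a b
    proof -
      obtain G where G: "smooth_with_deriv W X G" "p = expectation (\<lambda>\<omega>. inner (G \<omega>) (v \<omega>))"
        using \<open>(X, p) \<in> S\<close> by (auto simp: S_def)
      obtain G' where G': "smooth_with_deriv W Y G'" "q = expectation (\<lambda>\<omega>. inner (G' \<omega>) (v \<omega>))"
        using \<open>(Y, q) \<in> S\<close> by (auto simp: S_def)
      note [simp] = L2_integrable_inner[OF smooth_with_deriv_L2(2)[OF G(1)] v]
        L2_integrable_inner[OF smooth_with_deriv_L2(2)[OF G'(1)] v]
      have "a * p + b * q = expectation (\<lambda>\<omega>. inner (a *\<^sub>R G \<omega> + b *\<^sub>R G' \<omega>) (v \<omega>))"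
        unfolding G G' by (simp add: inner_add_left)
      with smooth_with_deriv_lincomb[OF G(1) G'(1), of a b] show ?thesis
        unfolding S_def by (intro CollectI exI conjI) auto
    qed
    show "X \<in> L2 M" "\<bar>p\<bar> \<le> C * sqrt (expectation (\<lambda>\<omega>. (X \<omega>)\<^sup>2))" if "(X, p) \<in> S" for X p
      using that C by (auto simp: S_def smooth_with_deriv_L2)
  qed blast
  then have "\<exists>d. d \<in> L2 M \<and> (\<forall>F G. smooth_with_deriv W F G \<longrightarrow>
     (\<integral>\<omega>. inner (G \<omega>) (v \<omega>) \<partial>M) = (\<integral>\<omega>. F \<omega> * d \<omega> \<partial>M))"
    unfolding S_def by blast
  from someI_ex[OF this, folded divergence_def]
  show "divergence M W v \<in> L2 M" "smooth_with_deriv W H K \<Longrightarrow>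
      expectation (\<lambda>\<omega>. inner (K \<omega>) (v \<omega>)) = expectation (\<lambda>\<omega>. H \<omega> * divergence M W v \<omega>)"
    by blast+
qed

end

section \<open>Orthogonality to trigonometric functions\<close>

context prob_space
begin

text \<open>
Uniqueness of characteristic functions for a signed measure: the measures with densities the
positive and the negative part of \<open>Y\<close>, transported by \<open>X\<close>, have the same mass (take \<open>t = 0\<close>) and,
after normalization, the same characteristic function.
\<close>
lemma trig_integrals_zero_imp_zero:
  fixes X Y :: "'a \<Rightarrow> real"
  assumes X [measurable]: "X \<in> borel_measurable M" and Y: "integrable M Y"
    and trig: "\<And>t. expectation (\<lambda>\<omega>. Y \<omega> * cos (t * X \<omega>)) = 0"
      "\<And>t. expectation (\<lambda>\<omega>. Y \<omega> * sin (t * X \<omega>)) = 0"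
    and B [measurable]: "B \<in> sets borel"
  shows "expectation (\<lambda>\<omega>. Y \<omega> * indicator B (X \<omega>)) = 0"
proof -
  note [measurable] = borel_measurable_integrable[OF Y]
  define P where "P \<omega> = max 0 (Y \<omega>)" for \<omega>
  define Q where "Q \<omega> = max 0 (- Y \<omega>)" for \<omega>
  have [measurable]: "P \<in> borel_measurable M" "Q \<in> borel_measurable M"
    unfolding P_def Q_def by measurable
  have [simp]: "integrable M P" "integrable M Q"
    using Y unfolding P_def Q_def by auto
  have YPQ: "Y \<omega> = P \<omega> - Q \<omega>" for \<omega> by (simp add: P_def Q_def)
  have nn: "P \<omega> \<ge> 0" "Q \<omega> \<ge> 0" for \<omega> by (simp_all add: P_def Q_def)
  have int: "integrable M (\<lambda>\<omega>. R \<omega> *\<^sub>R f (X \<omega>))"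
    if "integrable M R" "f \<in> borel_measurable borel" "\<And>x. norm (f x) \<le> 1"
    for R and f :: "real \<Rightarrow> 'b::{banach, second_countable_topology}"
  proof (rule Bochner_Integration.integrable_bound[OF that(1)])
    have [measurable]: "R \<in> borel_measurable M" "f \<in> borel_measurable borel" using that by auto
    show "(\<lambda>\<omega>. R \<omega> *\<^sub>R f (X \<omega>)) \<in> borel_measurable M" by measurable
    show "AE \<omega> in M. norm (R \<omega> *\<^sub>R f (X \<omega>)) \<le> norm (R \<omega>)"
      using that(3) by (auto intro!: mult_left_le)
  qed
  define c where "c = expectation P"
  have "expectation P - expectation Q = expectation (\<lambda>\<omega>. P \<omega> - Q \<omega>)"
    by simp
  also have "\<dots> = expectation Y"
    by (simp add: YPQ[symmetric])
  also have "\<dots> = 0" using trig(1)[of 0] by simp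
  finally have cQ: "c = expectation Q" by (simp add: c_def)
  show ?thesis
  proof (cases "c = 0")
    case True
    then have "AE \<omega> in M. P \<omega> = 0" "AE \<omega> in M. Q \<omega> = 0"
      using cQ nn integral_nonneg_eq_0_iff_AE[of M P] integral_nonneg_eq_0_iff_AE[of M Q]
      by (simp_all add: c_def)
    then have "AE \<omega> in M. Y \<omega> * indicator B (X \<omega>) = 0"
      by eventually_elim (simp add: YPQ)
    then show ?thesis by (rule integral_eq_zero_AE)
  next
    case False
    then have c: "c > 0" using nn by (simp add: c_def less_le integral_nonneg_AE)
    define D where "D R = distr (density M (\<lambda>\<omega>. ennreal (R \<omega> / c))) borel X" for R
    have D: "real_distribution (D R)" "integral\<^sup>L (D R) f = expectation (\<lambda>\<omega>. (R \<omega> / c) *\<^sub>R f (X \<omega>))"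
      if [measurable]: "R \<in> borel_measurable M" "f \<in> borel_measurable borel"
        and R: "integrable M R" "\<And>\<omega>. R \<omega> \<ge> 0" "expectation R = c"
      for R and f :: "real \<Rightarrow> 'b::{banach, second_countable_topology}"
    proof -
      have "prob_space (density M (\<lambda>\<omega>. ennreal (R \<omega> / c)))"
      proof
        have "emeasure (density M (\<lambda>\<omega>. ennreal (R \<omega> / c))) (space M) = (\<integral>\<^sup>+\<omega>. ennreal (R \<omega> / c) \<partial>M)"
          by (subst emeasure_density) (auto intro!: nn_integral_cong)
        also have "\<dots> = ennreal (expectation (\<lambda>\<omega>. R \<omega> / c))"
          using R c by (intro nn_integral_eq_integral) auto
        also have "\<dots> = 1" using R c by simp
        finally show "emeasure (density M (\<lambda>\<omega>. ennreal (R \<omega> / c)))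
          (space (density M (\<lambda>\<omega>. ennreal (R \<omega> / c)))) = 1" by simp
      qed
      then show "real_distribution (D R)"
        unfolding D_def by (intro prob_space.real_distribution_distr) auto
      show "integral\<^sup>L (D R) f = expectation (\<lambda>\<omega>. (R \<omega> / c) *\<^sub>R f (X \<omega>))"
        unfolding D_def using R c
        by (subst integral_distr) (auto simp: integral_density)
    qed
    note DP = D[OF _ _ _ nn(1) c_def[symmetric]] and DQ = D[OF _ _ _ nn(2) cQ[symmetric]]
    have diff: "integral\<^sup>L (D P) f - integral\<^sup>L (D Q) f = expectation (\<lambda>\<omega>. (Y \<omega> / c) *\<^sub>R f (X \<omega>))"
      if [measurable]: "f \<in> borel_measurable borel" and "\<And>x. norm (f x) \<le> 1"
      for f :: "real \<Rightarrow> 'b::{banach, second_countable_topology}"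
    proof -
      have "integrable M (\<lambda>\<omega>. (P \<omega> / c) *\<^sub>R f (X \<omega>))" "integrable M (\<lambda>\<omega>. (Q \<omega> / c) *\<^sub>R f (X \<omega>))"
        using that by (auto intro!: int)
      then show ?thesis
        by (simp add: DP DQ YPQ diff_divide_distrib scaleR_diff_left)
    qed
    have "char (D P) t = char (D Q) t" for t
    proof -
      have "char (D P) t - char (D Q) t = expectation (\<lambda>\<omega>. (Y \<omega> / c) *\<^sub>R iexp (t * X \<omega>))"
        unfolding char_def by (rule diff) auto
      also have "\<dots> = expectation (\<lambda>\<omega>. complex_of_real (Y \<omega> * cos (t * X \<omega>)) / c
          + \<i> * (complex_of_real (Y \<omega> * sin (t * X \<omega>)) / c))"
        by (intro Bochner_Integration.integral_cong refl)
           (simp add: exp_Euler scaleR_conv_of_real cos_of_real sin_of_real field_simps c less_imp_neq[OF c, symmetric]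
             del: of_real_mult, simp add: algebra_simps)
      also have "\<dots> = complex_of_real (expectation (\<lambda>\<omega>. Y \<omega> * cos (t * X \<omega>))) / c
          + \<i> * (complex_of_real (expectation (\<lambda>\<omega>. Y \<omega> * sin (t * X \<omega>))) / c)"
        using int[OF Y, of "\<lambda>x. cos (t * x)"] int[OF Y, of "\<lambda>x. sin (t * x)"]
        by (subst Bochner_Integration.integral_add) (simp_all del: of_real_mult)
      finally show ?thesis by (simp add: trig)
    qed
    then have "D P = D Q"
      by (intro Levy_uniqueness DP(1)[of "\<lambda>x. 0 :: real"] DQ(1)[of "\<lambda>x. 0 :: real"]) auto
    then have "expectation (\<lambda>\<omega>. (Y \<omega> / c) *\<^sub>R (indicator B (X \<omega>) :: real)) = 0"
      by (subst diff[symmetric]) auto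
    then show ?thesis using c by simp
  qed
qed

end

text \<open>
Orthogonality of \<open>Z\<close> to all characters \<open>exp (i X)\<close> with \<open>X\<close> in \<open>V\<close>, in real form.
\<close>
definition trig_orthogonal :: "'a measure \<Rightarrow> ('a \<Rightarrow> real) set \<Rightarrow> ('a \<Rightarrow> real) \<Rightarrow> bool" where
  "trig_orthogonal M V Z \<longleftrightarrow> integrable M Z \<and>
    (\<forall>X\<in>V. (\<integral>\<omega>. Z \<omega> * cos (X \<omega>) \<partial>M) = 0 \<and> (\<integral>\<omega>. Z \<omega> * sin (X \<omega>) \<partial>M) = 0)"

text \<open>
By the addition formulas the functions \<open>cos (X + t Y)\<close> and \<open>sin (X + t Y)\<close> control the products of
the trigonometric functions of \<open>X\<close> and of \<open>t Y\<close>, so the one-dimensional uniqueness theorem applies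
to the variable \<open>Y\<close> with \<open>Z cos X\<close> and \<open>Z sin X\<close> as weights.
\<close>
lemma (in prob_space) trig_orthogonal_restrict_vimage:
  assumes Z: "trig_orthogonal M V Z"
    and V: "V \<subseteq> borel_measurable M" "\<And>X Y c. X \<in> V \<Longrightarrow> Y \<in> V \<Longrightarrow> (\<lambda>\<omega>. X \<omega> + c * Y \<omega>) \<in> V"
    and Y: "Y \<in> V" and B [measurable]: "B \<in> sets borel"
  shows "trig_orthogonal M V (\<lambda>\<omega>. Z \<omega> * indicator B (Y \<omega>))"
proof -
  have iZ: "integrable M Z" using Z by (simp add: trig_orthogonal_def)
  have [measurable]: "Y \<in> borel_measurable M" "Z \<in> borel_measurable M" using Y V iZ by auto
  have int: "integrable M (\<lambda>\<omega>. Z \<omega> * g \<omega>)" if "g \<in> borel_measurable M" "\<And>\<omega>. \<bar>g \<omega>\<bar> \<le> 1" for g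
    using that by (intro Bochner_Integration.integrable_bound[OF iZ])
      (auto simp: abs_mult intro!: mult_left_le always_eventually)
  have "expectation (\<lambda>\<omega>. (Z \<omega> * cos (X \<omega>)) * indicator B (Y \<omega>)) = 0
      \<and> expectation (\<lambda>\<omega>. (Z \<omega> * sin (X \<omega>)) * indicator B (Y \<omega>)) = 0" if X: "X \<in> V" for X
  proof -
    have [measurable]: "X \<in> borel_measurable M" using X V by auto
    have zero: "expectation (\<lambda>\<omega>. Z \<omega> * cos (X \<omega> + t * Y \<omega>)) = 0"
      "expectation (\<lambda>\<omega>. Z \<omega> * sin (X \<omega> + t * Y \<omega>)) = 0" for t
      using Z V(2)[OF X Y, of t] unfolding trig_orthogonal_def by auto
    have [simp]: "integrable M (\<lambda>\<omega>. Z \<omega> * cos (X \<omega> + t * Y \<omega>))"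
      "integrable M (\<lambda>\<omega>. Z \<omega> * sin (X \<omega> + t * Y \<omega>))" for t
      by (auto intro!: int)
    have minus: "expectation (\<lambda>\<omega>. Z \<omega> * cos (X \<omega> - t * Y \<omega>)) = 0"
      "expectation (\<lambda>\<omega>. Z \<omega> * sin (X \<omega> - t * Y \<omega>)) = 0"
      "integrable M (\<lambda>\<omega>. Z \<omega> * cos (X \<omega> - t * Y \<omega>))"
      "integrable M (\<lambda>\<omega>. Z \<omega> * sin (X \<omega> - t * Y \<omega>))" for t
      using zero[of "- t"] by (auto intro!: int)
    have eqs: "Z \<omega> * cos (X \<omega>) * cos (t * Y \<omega>)
        = (1/2) * (Z \<omega> * cos (X \<omega> + t * Y \<omega>) + Z \<omega> * cos (X \<omega> - t * Y \<omega>))"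
      "Z \<omega> * cos (X \<omega>) * sin (t * Y \<omega>)
        = (1/2) * (Z \<omega> * sin (X \<omega> + t * Y \<omega>) - Z \<omega> * sin (X \<omega> - t * Y \<omega>))"
      "Z \<omega> * sin (X \<omega>) * cos (t * Y \<omega>)
        = (1/2) * (Z \<omega> * sin (X \<omega> + t * Y \<omega>) + Z \<omega> * sin (X \<omega> - t * Y \<omega>))"
      "Z \<omega> * sin (X \<omega>) * sin (t * Y \<omega>)
        = (1/2) * (Z \<omega> * cos (X \<omega> - t * Y \<omega>) - Z \<omega> * cos (X \<omega> + t * Y \<omega>))" for \<omega> t
      by (simp_all add: cos_add sin_add cos_diff sin_diff algebra_simps)
    show ?thesis
    proof (intro conjI; rule trig_integrals_zero_imp_zero)
      show "integrable M (\<lambda>\<omega>. Z \<omega> * cos (X \<omega>))" "integrable M (\<lambda>\<omega>. Z \<omega> * sin (X \<omega>))"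
        by (auto intro!: int)
    qed (simp_all only: eqs, simp_all add: zero minus)
  qed
  then show ?thesis
    unfolding trig_orthogonal_def by (auto simp: mult_ac intro!: int)
qed

context prob_space
begin

lemma trig_orthogonalI:
  assumes "integrable M Z"
    and "\<And>X. X \<in> V \<Longrightarrow> expectation (\<lambda>\<omega>. Z \<omega> * cos (X \<omega>)) = 0"
    and "\<And>X. X \<in> V \<Longrightarrow> expectation (\<lambda>\<omega>. Z \<omega> * sin (X \<omega>)) = 0"
  shows "trig_orthogonal M V Z"
  using assms by (simp add: trig_orthogonal_def)

lemma integrable_mult_bounded:
  fixes Z g :: "'a \<Rightarrow> real"
  assumes "integrable M Z" "g \<in> borel_measurable M" "\<And>\<omega>. \<bar>g \<omega>\<bar> \<le> 1"
  shows "integrable M (\<lambda>\<omega>. Z \<omega> * g \<omega>)"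
  using assms by (intro Bochner_Integration.integrable_bound[OF assms(1)])
    (auto simp: abs_mult intro!: mult_left_le always_eventually)

lemma trig_orthogonal_cong:
  assumes Z: "trig_orthogonal M V Z" and eq: "AE \<omega> in M. Z \<omega> = Z' \<omega>"
    and [measurable]: "Z' \<in> borel_measurable M" and V: "V \<subseteq> borel_measurable M"
  shows "trig_orthogonal M V Z'"
proof -
  have [measurable]: "Z \<in> borel_measurable M" using Z by (auto simp: trig_orthogonal_def)
  have "expectation (\<lambda>\<omega>. Z' \<omega> * g \<omega>) = expectation (\<lambda>\<omega>. Z \<omega> * g \<omega>)"
    if [measurable]: "g \<in> borel_measurable M" for g
    by (rule integral_cong_AE) (use eq in \<open>auto\<close>)
  moreover have "integrable M Z'"
    using Z eq by (auto simp: trig_orthogonal_def intro: integrable_cong_AE_imp)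
  moreover have "(\<lambda>\<omega>. cos (X \<omega>)) \<in> borel_measurable M" "(\<lambda>\<omega>. sin (X \<omega>)) \<in> borel_measurable M"
    if "X \<in> V" for X
    using V that by (auto intro: measurable_compose)
  ultimately show ?thesis using Z unfolding trig_orthogonal_def by simp
qed

lemma trig_orthogonal_limit:
  assumes R: "\<And>n. trig_orthogonal M V (R n)" and Z: "integrable M Z"
    and bound: "\<And>n \<omega>. \<bar>R n \<omega>\<bar> \<le> \<bar>Z \<omega>\<bar>" and lim: "\<And>\<omega>. (\<lambda>n. R n \<omega>) \<longlonglongrightarrow> Y \<omega>"
    and V: "V \<subseteq> borel_measurable M"
  shows "trig_orthogonal M V Y"
proof -
  have [measurable]: "R n \<in> borel_measurable M" for n using R by (auto simp: trig_orthogonal_def)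
  have [measurable]: "Y \<in> borel_measurable M"
    by (rule borel_measurable_LIMSEQ_real[OF lim]) measurable
  have Yb: "\<bar>Y \<omega>\<bar> \<le> \<bar>Z \<omega>\<bar>" for \<omega>
    by (rule LIMSEQ_le_const2[OF tendsto_rabs[OF lim]]) (use bound in auto)
  have "integrable M Y"
    using Yb by (intro Bochner_Integration.integrable_bound[OF Z]) auto
  moreover have "expectation (\<lambda>\<omega>. Y \<omega> * g \<omega>) = 0"
    if [measurable]: "g \<in> borel_measurable M" and g: "\<And>\<omega>. \<bar>g \<omega>\<bar> \<le> 1"
      "\<And>n. expectation (\<lambda>\<omega>. R n \<omega> * g \<omega>) = 0" for g
  proof -
    have "(\<lambda>n. expectation (\<lambda>\<omega>. R n \<omega> * g \<omega>)) \<longlonglongrightarrow> expectation (\<lambda>\<omega>. Y \<omega> * g \<omega>)"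
    proof (rule integral_dominated_convergence[where w = "\<lambda>\<omega>. \<bar>Z \<omega>\<bar>"])
      show "AE \<omega> in M. (\<lambda>n. R n \<omega> * g \<omega>) \<longlonglongrightarrow> Y \<omega> * g \<omega>"
        by (intro always_eventually allI tendsto_intros lim)
      have "\<bar>R n \<omega>\<bar> * \<bar>g \<omega>\<bar> \<le> \<bar>Z \<omega>\<bar> * 1" for n \<omega>
        by (intro mult_mono bound g) auto
      then show "AE \<omega> in M. norm (R n \<omega> * g \<omega>) \<le> \<bar>Z \<omega>\<bar>" for n
        by (simp add: abs_mult)
    qed (use Z in auto)
    then show ?thesis by (simp add: g(2) LIMSEQ_const_iff)
  qed
  moreover have "(\<lambda>\<omega>. cos (X \<omega>)) \<in> borel_measurable M" "(\<lambda>\<omega>. sin (X \<omega>)) \<in> borel_measurable M"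
    if "X \<in> V" for X
    using V that by (auto intro: measurable_compose)
  ultimately show ?thesis using R unfolding trig_orthogonal_def by simp
qed

lemma trig_orthogonal_diff:
  assumes Z: "trig_orthogonal M V Z" "trig_orthogonal M V Z'" and V: "V \<subseteq> borel_measurable M"
  shows "trig_orthogonal M V (\<lambda>\<omega>. Z \<omega> - Z' \<omega>)"
proof -
  have [simp]: "integrable M Z" "integrable M Z'"
    using Z by (auto simp: trig_orthogonal_def)
  have "(\<lambda>\<omega>. cos (X \<omega>)) \<in> borel_measurable M" "(\<lambda>\<omega>. sin (X \<omega>)) \<in> borel_measurable M"
    if "X \<in> V" for X
    using V that by (auto intro: measurable_compose)
  then show ?thesis
    using Z unfolding trig_orthogonal_def
    by (auto simp: left_diff_distrib integrable_mult_bounded)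
qed

text \<open>
The events \<open>A\<close> for which multiplication by the indicator of \<open>A\<close> preserves orthogonality, for all
\<open>Z\<close> at once, form a sigma-algebra: closure under intersections is built in because the two
multiplications can be performed one after the other. In this way one-dimensional uniqueness is
carried over to the sigma-algebra generated by the whole family.
\<close>
lemma trig_orthogonal_restrict:
  assumes Z: "trig_orthogonal M V Z"
    and V: "V \<subseteq> borel_measurable M" "\<And>X Y c. X \<in> V \<Longrightarrow> Y \<in> V \<Longrightarrow> (\<lambda>\<omega>. X \<omega> + c * Y \<omega>) \<in> V"
    and A: "A \<in> sigma_sets (space M) ((\<Union>X\<in>V. {X -` B \<inter> space M | B. B \<in> sets borel}) \<union> null_sets M)"
  shows "trig_orthogonal M V (\<lambda>\<omega>. Z \<omega> * indicator A \<omega>)"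
proof -
  have "A \<in> sets M \<and> (\<forall>Z. trig_orthogonal M V Z \<longrightarrow> trig_orthogonal M V (\<lambda>\<omega>. Z \<omega> * indicator A \<omega>))"
    using A
  proof induction
    case (Basic A)
    then consider X B where "X \<in> V" "B \<in> sets borel" "A = X -` B \<inter> space M" | "A \<in> null_sets M" by blast
    then show ?case
    proof cases
      case 1
      have [measurable]: "X \<in> borel_measurable M" "B \<in> sets borel" using 1 V by auto
      have "trig_orthogonal M V (\<lambda>\<omega>. Z \<omega> * indicator A \<omega>)" if "trig_orthogonal M V Z" for Z
      proof (rule trig_orthogonal_cong[OF trig_orthogonal_restrict_vimage[OF that V 1(1,2)] _ _ V(1)])
        have [measurable]: "Z \<in> borel_measurable M" using that by (auto simp: trig_orthogonal_def)
        show "(\<lambda>\<omega>. Z \<omega> * indicator A \<omega>) \<in> borel_measurable M" unfolding 1 by measurable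
        show "AE \<omega> in M. Z \<omega> * indicator B (X \<omega>) = Z \<omega> * indicator A \<omega>"
          by (rule AE_I2) (simp add: 1 indicator_def)
      qed
      then show ?thesis by (simp add: 1)
    next
      case 2
      have "trig_orthogonal M V (\<lambda>\<omega>. Z \<omega> * indicator A \<omega>)" if "trig_orthogonal M V Z" for Z
      proof (rule trig_orthogonal_cong[where Z = "\<lambda>\<omega>. 0", OF _ _ _ V(1)])
        have [measurable]: "Z \<in> borel_measurable M" "A \<in> sets M"
          using that 2 by (auto simp: trig_orthogonal_def)
        show "(\<lambda>\<omega>. Z \<omega> * indicator A \<omega>) \<in> borel_measurable M" by measurable
        show "AE \<omega> in M. 0 = Z \<omega> * indicator A \<omega>"
          using AE_not_in[OF 2] by eventually_elim simp
      qed (simp add: trig_orthogonal_def)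
      then show ?thesis using 2 by auto
    qed
  next
    case Empty
    show ?case by (simp add: trig_orthogonal_def)
  next
    case (Compl A)
    have [measurable]: "A \<in> sets M" using Compl.IH by blast
    have "trig_orthogonal M V (\<lambda>\<omega>. Z \<omega> * indicator (space M - A) \<omega>)" if Z: "trig_orthogonal M V Z" for Z
    proof (rule trig_orthogonal_cong[OF trig_orthogonal_diff[OF Z _ V(1)] _ _ V(1)])
      show "trig_orthogonal M V (\<lambda>\<omega>. Z \<omega> * indicator A \<omega>)" using Compl.IH Z by blast
      have [measurable]: "Z \<in> borel_measurable M" using Z by (auto simp: trig_orthogonal_def)
      show "(\<lambda>\<omega>. Z \<omega> * indicator (space M - A) \<omega>) \<in> borel_measurable M" by measurable
      show "AE \<omega> in M. Z \<omega> - Z \<omega> * indicator A \<omega> = Z \<omega> * indicator (space M - A) \<omega>"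
        by (rule AE_I2) (simp add: indicator_def)
    qed
    then show ?case by simp
  next
    case (Union A)
    have "trig_orthogonal M V (\<lambda>\<omega>. Z \<omega> * indicator (\<Union>i. A i) \<omega>)" if Z: "trig_orthogonal M V Z" for Z
    proof -
      (* R n restricts Z to the complement of the union of the first n events. *)
      define R where "R n \<omega> = Z \<omega> * (\<Prod>i<n. 1 - indicator (A i) \<omega>)" for n \<omega>
      have R: "trig_orthogonal M V (R n)" for n
      proof (induction n)
        case 0
        then show ?case using Z by (simp add: R_def)
      next
        case (Suc n)
        have "trig_orthogonal M V (\<lambda>\<omega>. R n \<omega> * indicator (A n) \<omega>)"
          using Union.IH Suc.IH by blast
        from trig_orthogonal_diff[OF Suc.IH this V(1)] show ?case
          by (simp add: R_def right_diff_distrib mult.assoc)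
      qed
      have bound: "\<bar>R n \<omega>\<bar> \<le> \<bar>Z \<omega>\<bar>" for n \<omega>
      proof -
        have "\<bar>\<Prod>i<n. 1 - indicator (A i) \<omega> :: real\<bar> \<le> 1"
          unfolding abs_prod by (intro prod_le_1) (auto simp: indicator_def)
        then show ?thesis by (simp add: R_def abs_mult mult_left_le)
      qed
      have lim: "(\<lambda>n. R n \<omega>) \<longlonglongrightarrow> Z \<omega> - Z \<omega> * indicator (\<Union>i. A i) \<omega>" for \<omega>
      proof (cases "\<omega> \<in> (\<Union>i. A i)")
        case True
        then obtain i where i: "\<omega> \<in> A i" by blast
        have "R n \<omega> = 0" if "n > i" for n
          using that i by (auto simp: R_def indicator_def intro!: bexI[of _ i])
        then have "\<forall>\<^sub>F n in sequentially. R n \<omega> = 0"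
          by (intro eventually_mono[OF eventually_gt_at_top[of i]])
        then show ?thesis using True by (simp add: tendsto_eventually)
      next
        case False
        then have "R n \<omega> = Z \<omega>" for n by (simp add: R_def)
        then show ?thesis using False by simp
      qed
      have iZ: "integrable M Z" using Z by (simp add: trig_orthogonal_def)
      have "trig_orthogonal M V (\<lambda>\<omega>. Z \<omega> - Z \<omega> * indicator (\<Union>i. A i) \<omega>)"
        by (rule trig_orthogonal_limit[OF R iZ bound lim V(1)])
      from trig_orthogonal_diff[OF Z this V(1)] show ?thesis by simp
    qed
    moreover have "(\<Union>i. A i) \<in> sets M" using Union.IH by blast
    ultimately show ?case by blast
  qed
  with Z show ?thesis by blast
qed

lemma trig_orthogonal_integral_zero:
  assumes Z: "trig_orthogonal M V Z"
    and V: "V \<subseteq> borel_measurable M" "\<And>X Y c. X \<in> V \<Longrightarrow> Y \<in> V \<Longrightarrow> (\<lambda>\<omega>. X \<omega> + c * Y \<omega>) \<in> V" "V \<noteq> {}"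
    and A: "A \<in> sigma_sets (space M) ((\<Union>X\<in>V. {X -` B \<inter> space M | B. B \<in> sets borel}) \<union> null_sets M)"
  shows "expectation (\<lambda>\<omega>. Z \<omega> * indicator A \<omega>) = 0"
proof -
  obtain X where "X \<in> V" using V(3) by blast
  from V(2)[OF this this, of "-1"] have "(\<lambda>\<omega>. 0) \<in> V" by simp
  with trig_orthogonal_restrict[OF Z V(1,2) A] show ?thesis
    unfolding trig_orthogonal_def by fastforce
qed

end

section \<open>Gaussian families and independence\<close>

text \<open>
Variables are kept together with the vectors that they represent, and as actual finite linear
combinations: these are Gaussian by the definition of an isonormal process, whereas
\<open>W (h + k) = W h + W k\<close> holds only almost surely.
\<close>
definition gaussian_span :: "('h::real_vector \<Rightarrow> 'a \<Rightarrow> real) \<Rightarrow> (('a \<Rightarrow> real) \<times> 'h) set" where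
  "gaussian_span W = {(\<lambda>\<omega>. \<Sum>g\<in>A. c g * W g \<omega>, \<Sum>g\<in>A. c g *\<^sub>R g) | A c. finite A}"

lemma gaussian_span_base: "(W h, h) \<in> gaussian_span W"
  unfolding gaussian_span_def by (intro CollectI exI[of _ "{h}"] exI[of _ "\<lambda>_. 1"]) simp

lemma gaussian_span_add:
  fixes W :: "'h::real_vector \<Rightarrow> 'a \<Rightarrow> real"
  assumes "(X, h) \<in> gaussian_span W" "(Y, k) \<in> gaussian_span W"
  shows "(\<lambda>\<omega>. X \<omega> + t * Y \<omega>, h + t *\<^sub>R k) \<in> gaussian_span W"
proof -
  obtain A c where A: "finite A" "X = (\<lambda>\<omega>. \<Sum>g\<in>A. c g * W g \<omega>)" "h = (\<Sum>g\<in>A. c g *\<^sub>R g)"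
    using assms(1) unfolding gaussian_span_def by blast
  obtain B d where B: "finite B" "Y = (\<lambda>\<omega>. \<Sum>g\<in>B. d g * W g \<omega>)" "k = (\<Sum>g\<in>B. d g *\<^sub>R g)"
    using assms(2) unfolding gaussian_span_def by blast
  (* Both combinations are rewritten over the common index set A \<union> B with zero coefficients added. *)
  define e where "e g = (if g \<in> A then c g else 0) + t * (if g \<in> B then d g else 0)" for g
  have 1: "(\<Sum>g\<in>A \<union> B. (if g \<in> A then c g else 0) *\<^sub>R q g) = (\<Sum>g\<in>A. c g *\<^sub>R q g)"
    for q :: "'h \<Rightarrow> 'z::real_vector"
    using A(1) B(1) by (intro sum.mono_neutral_cong_right) auto
  have 2: "(\<Sum>g\<in>A \<union> B. (if g \<in> B then d g else 0) *\<^sub>R q g) = (\<Sum>g\<in>B. d g *\<^sub>R q g)"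
    for q :: "'h \<Rightarrow> 'z::real_vector"
    using A(1) B(1) by (intro sum.mono_neutral_cong_right) auto
  have *: "(\<Sum>g\<in>A \<union> B. e g *\<^sub>R q g) = (\<Sum>g\<in>A. c g *\<^sub>R q g) + t *\<^sub>R (\<Sum>g\<in>B. d g *\<^sub>R q g)"
    for q :: "'h \<Rightarrow> 'z::real_vector"
    unfolding e_def scaleR_add_left sum.distrib 1 scaleR_scaleR[symmetric] scaleR_sum_right[symmetric] 2 ..
  have "(\<lambda>\<omega>. X \<omega> + t * Y \<omega>) = (\<lambda>\<omega>. \<Sum>g\<in>A \<union> B. e g * W g \<omega>)"
    using *[of "\<lambda>g. W g _"] by (simp add: A B)
  moreover have "h + t *\<^sub>R k = (\<Sum>g\<in>A \<union> B. e g *\<^sub>R g)"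
    using *[of "\<lambda>g. g"] by (simp add: A B)
  ultimately show ?thesis
    unfolding gaussian_span_def using A(1) B(1) by blast
qed

lemma gaussian_span_scale:
  assumes "(X, h) \<in> gaussian_span W" shows "(\<lambda>\<omega>. t * X \<omega>, t *\<^sub>R h) \<in> gaussian_span W"
  using gaussian_span_add[OF gaussian_span_add[OF assms assms, of "-1"] assms, of t] by simp

text \<open>
The characteristic function of a centred Gaussian variable in terms of its variance; a point
mass at \<open>0\<close> is the case of variance zero.
\<close>
lemma (in prob_space) centered_gaussian_moments:
  assumes "centered_gaussian M X"
  shows "X \<in> L2 M"
    and "expectation (\<lambda>\<omega>. cos (X \<omega>)) = exp (- expectation (\<lambda>\<omega>. (X \<omega>)\<^sup>2) / 2)"
    and "expectation (\<lambda>\<omega>. sin (X \<omega>)) = 0"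
proof -
  have [measurable]: "X \<in> borel_measurable M" using assms by (simp add: centered_gaussian_def)
  have "X \<in> L2 M \<and> expectation (\<lambda>\<omega>. cos (X \<omega>)) = exp (- expectation (\<lambda>\<omega>. (X \<omega>)\<^sup>2) / 2)
    \<and> expectation (\<lambda>\<omega>. sin (X \<omega>)) = 0"
    using assms unfolding centered_gaussian_def
  proof (elim conjE disjE exE)
    assume ae: "AE \<omega> in M. X \<omega> = 0"
    have E: "expectation (\<lambda>\<omega>. f (X \<omega>)) = f 0" if [measurable]: "f \<in> borel_measurable borel" for f :: "real \<Rightarrow> real"
    proof -
      have "expectation (\<lambda>\<omega>. f (X \<omega>)) = expectation (\<lambda>\<omega>. f 0)"
        by (rule integral_cong_AE) (use ae in \<open>auto\<close>)
      then show ?thesis by (simp add: prob_space)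
    qed
    have "integrable M (\<lambda>\<omega>. (norm (X \<omega>))\<^sup>2)"
      by (rule integrable_cong_AE_imp[of M "\<lambda>_. 0"]) (use ae in \<open>auto\<close>)
    then show ?thesis
      using E[of cos] E[of sin] E[of "\<lambda>x. x\<^sup>2"] by (simp add: L2_def)
  next
    fix \<sigma> :: real assume \<sigma>: "\<sigma> > 0" and D: "distributed M lborel X (\<lambda>x. ennreal (normal_density 0 \<sigma> x))"
    have sq: "integrable M (\<lambda>\<omega>. (X \<omega>)\<^sup>2)" "expectation (\<lambda>\<omega>. (X \<omega>)\<^sup>2) = \<sigma>\<^sup>2"
      using distributed_integrable[OF D, of "\<lambda>x. x\<^sup>2"] distributed_integral[OF D, of "\<lambda>x. x\<^sup>2"]
        normal_moment_even[OF \<sigma>, of 0 1]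
      by (auto simp: has_bochner_integral_iff)
    have D1: "distributed M lborel (\<lambda>\<omega>. X \<omega> / \<sigma>) std_normal_density"
      using D unfolding normal_standard_normal_convert[OF \<sigma>] by simp
    have "distr M lborel (\<lambda>\<omega>. X \<omega> / \<sigma>) = std_normal_distribution"
      using D1 by (simp add: distributed_def)
    then have d: "distr M borel (\<lambda>\<omega>. X \<omega> / \<sigma>) = std_normal_distribution"
      by (simp cong: distr_cong)
    have "complex_of_real (exp (- \<sigma>\<^sup>2 / 2)) = char (distr M borel (\<lambda>\<omega>. X \<omega> / \<sigma>)) \<sigma>"
      by (simp add: d char_std_normal_distribution)
    also have "\<dots> = expectation (\<lambda>\<omega>. iexp (X \<omega>))"
      unfolding char_def using \<sigma> by (subst integral_distr) auto
    finally have *: "expectation (\<lambda>\<omega>. iexp (X \<omega>)) = complex_of_real (exp (- \<sigma>\<^sup>2 / 2))" ..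
    have int: "integrable M (\<lambda>\<omega>. iexp (X \<omega>))"
      by (intro integrable_const_bound[of _ 1]) auto
    have "expectation (\<lambda>\<omega>. cos (X \<omega>)) = Re (expectation (\<lambda>\<omega>. iexp (X \<omega>)))"
      using int by (simp add: Re_exp flip: integral_Re)
    moreover have "expectation (\<lambda>\<omega>. sin (X \<omega>)) = Im (expectation (\<lambda>\<omega>. iexp (X \<omega>)))"
      using int by (simp add: Im_exp flip: integral_Im)
    ultimately show ?thesis
      using sq unfolding * by (simp add: L2_def)
  qed
  then show "X \<in> L2 M" "expectation (\<lambda>\<omega>. cos (X \<omega>)) = exp (- expectation (\<lambda>\<omega>. (X \<omega>)\<^sup>2) / 2)"
    "expectation (\<lambda>\<omega>. sin (X \<omega>)) = 0" by blast+
qed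

context isonormal_gaussian_process
begin

lemma gaussian_span_L2:
  assumes "(X, h) \<in> gaussian_span W" shows "X \<in> L2 M"
  using assms gaussian_family unfolding gaussian_span_def by (auto intro: centered_gaussian_moments)

lemma gaussian_span_measurable: "(X, h) \<in> gaussian_span W \<Longrightarrow> X \<in> borel_measurable M"
  using gaussian_span_L2 L2_D(1) by blast

lemma gaussian_span_covariance:
  assumes "(X, h) \<in> gaussian_span W" "(Y, k) \<in> gaussian_span W"
  shows "expectation (\<lambda>\<omega>. X \<omega> * Y \<omega>) = inner h k"
proof -
  obtain A c where A: "finite A" "X = (\<lambda>\<omega>. \<Sum>g\<in>A. c g * W g \<omega>)" "h = (\<Sum>g\<in>A. c g *\<^sub>R g)"
    using assms(1) unfolding gaussian_span_def by blast
  obtain B d where B: "finite B" "Y = (\<lambda>\<omega>. \<Sum>g\<in>B. d g * W g \<omega>)" "k = (\<Sum>g\<in>B. d g *\<^sub>R g)"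
    using assms(2) unfolding gaussian_span_def by blast
  have [simp]: "integrable M (\<lambda>\<omega>. W g \<omega> * W g' \<omega>)" for g g'
    by (intro L2_integrable_mult gaussian_span_L2[OF gaussian_span_base])
  have "expectation (\<lambda>\<omega>. X \<omega> * Y \<omega>)
      = expectation (\<lambda>\<omega>. \<Sum>g\<in>A. \<Sum>g'\<in>B. c g * d g' * (W g \<omega> * W g' \<omega>))"
    by (simp add: A(2) B(2) sum_product mult_ac)
  also have "\<dots> = (\<Sum>g\<in>A. \<Sum>g'\<in>B. c g * d g' * inner g g')"
    by (simp add: covariance)
  also have "\<dots> = inner h k"
    unfolding A(3) B(3) inner_sum_left inner_sum_right inner_scaleR_left inner_scaleR_right
    by (simp add: sum_distrib_left mult_ac sum.swap[of _ A B])
  finally show ?thesis .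
qed

lemma gaussian_span_trig:
  assumes "(X, h) \<in> gaussian_span W"
  shows "expectation (\<lambda>\<omega>. cos (X \<omega>)) = exp (- (norm h)\<^sup>2 / 2)" "expectation (\<lambda>\<omega>. sin (X \<omega>)) = 0"
proof -
  have "centered_gaussian M X"
    using assms gaussian_family unfolding gaussian_span_def by auto
  from centered_gaussian_moments(2,3)[OF this] gaussian_span_covariance[OF assms assms]
  show "expectation (\<lambda>\<omega>. cos (X \<omega>)) = exp (- (norm h)\<^sup>2 / 2)" "expectation (\<lambda>\<omega>. sin (X \<omega>)) = 0"
    by (simp_all add: power2_eq_square dot_square_norm)
qed

definition perp_gaussians :: "'h \<Rightarrow> ('a \<Rightarrow> real) set" where
  "perp_gaussians h = {Y. \<exists>k. (Y, k) \<in> gaussian_span W \<and> inner h k = 0}"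

lemma perp_gaussians_linear:
  "X \<in> perp_gaussians h \<Longrightarrow> Y \<in> perp_gaussians h \<Longrightarrow> (\<lambda>\<omega>. X \<omega> + c * Y \<omega>) \<in> perp_gaussians h"
  unfolding perp_gaussians_def
  using gaussian_span_add[of X _ W Y _ c] by (fastforce simp: inner_add_right)

lemma perp_gaussians_measurable: "perp_gaussians h \<subseteq> borel_measurable M"
  unfolding perp_gaussians_def using gaussian_span_measurable by blast

text \<open>
Orthogonal jointly Gaussian variables are independent: the characteristic functions factorize,
so \<open>1\<^sub>C(\<xi>) - P(\<xi> \<in> C)\<close> is orthogonal to all trigonometric functions of variables represented by vectors
perpendicular to \<open>h\<close>, hence to all events generated by these variables.
\<close>
lemma perp_gaussians_independent:
  assumes \<xi>: "(\<xi>, h) \<in> gaussian_span W" and C [measurable]: "C \<in> sets borel"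
    and A: "A \<in> sigma_sets (space M)
      ((\<Union>X\<in>perp_gaussians h. {X -` B \<inter> space M | B. B \<in> sets borel}) \<union> null_sets M)"
  shows "prob (\<xi> -` C \<inter> space M \<inter> A) = prob (\<xi> -` C \<inter> space M) * prob A"
proof -
  have [measurable]: "\<xi> \<in> borel_measurable M" by (rule gaussian_span_measurable[OF \<xi>])
  define p where "p = prob (\<xi> -` C \<inter> space M)"
  have p: "expectation (\<lambda>\<omega>. indicator C (\<xi> \<omega>) :: real) = p"
  proof -
    have "expectation (\<lambda>\<omega>. indicator C (\<xi> \<omega>) :: real) = expectation (indicator (\<xi> -` C \<inter> space M))"
      by (intro Bochner_Integration.integral_cong) (auto simp: indicator_def)
    then show ?thesis by (simp add: p_def)
  qed
  have trig: "expectation (\<lambda>\<omega>. cos (Y \<omega>) * indicator C (\<xi> \<omega>)) = expectation (\<lambda>\<omega>. cos (Y \<omega>)) * p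
      \<and> expectation (\<lambda>\<omega>. sin (Y \<omega>) * indicator C (\<xi> \<omega>)) = expectation (\<lambda>\<omega>. sin (Y \<omega>)) * p"
    if Y: "Y \<in> perp_gaussians h" for Y
  proof -
    obtain k where k: "(Y, k) \<in> gaussian_span W" "inner h k = 0"
      using Y by (auto simp: perp_gaussians_def)
    have [measurable]: "Y \<in> borel_measurable M" by (rule gaussian_span_measurable[OF k(1)])
    have int: "integrable M (\<lambda>\<omega>. cos (f \<omega>))" "integrable M (\<lambda>\<omega>. sin (f \<omega>))"
      if "f \<in> borel_measurable M" for f :: "'a \<Rightarrow> real"
      using that by (auto intro!: integrable_const_bound[of _ 1])
    have [simp]: "integrable M (\<lambda>\<omega>. cos (Y \<omega>))" "integrable M (\<lambda>\<omega>. sin (Y \<omega>))"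
      "integrable M (\<lambda>\<omega>. cos (t * \<xi> \<omega>))" "integrable M (\<lambda>\<omega>. sin (t * \<xi> \<omega>))"
      "integrable M (\<lambda>\<omega>. cos (Y \<omega> + t * \<xi> \<omega>))" "integrable M (\<lambda>\<omega>. sin (Y \<omega> + t * \<xi> \<omega>))"
      "integrable M (\<lambda>\<omega>. cos (Y \<omega> - t * \<xi> \<omega>))" "integrable M (\<lambda>\<omega>. sin (Y \<omega> - t * \<xi> \<omega>))" for t
      by (auto intro!: int)
    then have [simp]: "integrable M (\<lambda>\<omega>. cos (Y \<omega>) * cos (t * \<xi> \<omega>))" "integrable M (\<lambda>\<omega>. cos (Y \<omega>) * sin (t * \<xi> \<omega>))"
      "integrable M (\<lambda>\<omega>. cos (Y \<omega>) * indicator C (\<xi> \<omega>))" for t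
      by (auto intro!: integrable_mult_bounded simp: indicator_def)
    have nrm: "(norm (k + t *\<^sub>R h))\<^sup>2 = (norm k)\<^sup>2 + t\<^sup>2 * (norm h)\<^sup>2" for t
      using k(2) unfolding power2_norm_eq_inner
      by (simp add: inner_add_left inner_add_right inner_commute[of k h] power2_eq_square)
    have E: "expectation (\<lambda>\<omega>. cos (Y \<omega> + t * \<xi> \<omega>)) = exp (- ((norm k)\<^sup>2 + t\<^sup>2 * (norm h)\<^sup>2) / 2)"
      "expectation (\<lambda>\<omega>. sin (Y \<omega> + t * \<xi> \<omega>)) = 0" for t
      using gaussian_span_trig[OF gaussian_span_add[OF k(1) \<xi>, of t]] by (simp_all add: nrm)
    have E': "expectation (\<lambda>\<omega>. cos (Y \<omega> - t * \<xi> \<omega>)) = exp (- ((norm k)\<^sup>2 + t\<^sup>2 * (norm h)\<^sup>2) / 2)"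
      "expectation (\<lambda>\<omega>. sin (Y \<omega> - t * \<xi> \<omega>)) = 0" for t
      using E[of "- t"] by simp_all
    have EY: "expectation (\<lambda>\<omega>. cos (Y \<omega>)) = exp (- (norm k)\<^sup>2 / 2)" "expectation (\<lambda>\<omega>. sin (Y \<omega>)) = 0"
      by (rule gaussian_span_trig[OF k(1)])+
    have Ex: "expectation (\<lambda>\<omega>. cos (t * \<xi> \<omega>)) = exp (- (t\<^sup>2 * (norm h)\<^sup>2) / 2)"
      "expectation (\<lambda>\<omega>. sin (t * \<xi> \<omega>)) = 0" for t
      using gaussian_span_trig[OF gaussian_span_scale[OF \<xi>, of t]] by (simp_all add: power_mult_distrib)
    have eqs: "cos (Y \<omega>) * cos (t * \<xi> \<omega>) = (1/2) * (cos (Y \<omega> + t * \<xi> \<omega>) + cos (Y \<omega> - t * \<xi> \<omega>))"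
      "cos (Y \<omega>) * sin (t * \<xi> \<omega>) = (1/2) * (sin (Y \<omega> + t * \<xi> \<omega>) - sin (Y \<omega> - t * \<xi> \<omega>))"
      "sin (Y \<omega>) * cos (t * \<xi> \<omega>) = (1/2) * (sin (Y \<omega> + t * \<xi> \<omega>) + sin (Y \<omega> - t * \<xi> \<omega>))"
      "sin (Y \<omega>) * sin (t * \<xi> \<omega>) = (1/2) * (cos (Y \<omega> - t * \<xi> \<omega>) - cos (Y \<omega> + t * \<xi> \<omega>))" for \<omega> t
      by (simp_all add: cos_add sin_add cos_diff sin_diff algebra_simps)
    have prods: "expectation (\<lambda>\<omega>. cos (Y \<omega>) * cos (t * \<xi> \<omega>)) = exp (- (norm k)\<^sup>2 / 2) * exp (- (t\<^sup>2 * (norm h)\<^sup>2) / 2)"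
      "expectation (\<lambda>\<omega>. cos (Y \<omega>) * sin (t * \<xi> \<omega>)) = 0"
      "expectation (\<lambda>\<omega>. sin (Y \<omega>) * cos (t * \<xi> \<omega>)) = 0"
      "expectation (\<lambda>\<omega>. sin (Y \<omega>) * sin (t * \<xi> \<omega>)) = 0" for t
      by (simp_all only: eqs) (simp_all add: E E' exp_add[symmetric] add_divide_distrib)
    define m where "m = expectation (\<lambda>\<omega>. cos (Y \<omega>))"
    have "expectation (\<lambda>\<omega>. (cos (Y \<omega>) - m) * indicator C (\<xi> \<omega>)) = 0"
      by (rule trig_integrals_zero_imp_zero) (simp_all add: left_diff_distrib prods Ex m_def EY)
    moreover have "expectation (\<lambda>\<omega>. sin (Y \<omega>) * indicator C (\<xi> \<omega>)) = 0"
      by (rule trig_integrals_zero_imp_zero) (simp_all add: prods)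
    moreover have "integrable M (\<lambda>\<omega>. indicator C (\<xi> \<omega>) :: real)"
      by (intro integrable_const_bound[of _ 1]) auto
    ultimately show ?thesis
      by (simp add: left_diff_distrib p EY m_def)
  qed
  have orth: "trig_orthogonal M (perp_gaussians h) (\<lambda>\<omega>. indicator C (\<xi> \<omega>) - p)"
  proof (rule trig_orthogonalI)
    show "integrable M (\<lambda>\<omega>. indicator C (\<xi> \<omega>) - p)"
      by (rule integrable_const_bound[of _ "1 + \<bar>p\<bar>"]) (auto simp: indicator_def)
    fix Y assume Y: "Y \<in> perp_gaussians h"
    then have [measurable]: "Y \<in> borel_measurable M" using perp_gaussians_measurable by blast
    have [simp]: "integrable M (\<lambda>\<omega>. cos (Y \<omega>) * indicator C (\<xi> \<omega>))" "integrable M (\<lambda>\<omega>. sin (Y \<omega>) * indicator C (\<xi> \<omega>))"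
      "integrable M (\<lambda>\<omega>. cos (Y \<omega>))" "integrable M (\<lambda>\<omega>. sin (Y \<omega>))"
      by (auto intro!: integrable_mult_bounded integrable_const_bound[of _ 1] simp: indicator_def)
    show "expectation (\<lambda>\<omega>. (indicator C (\<xi> \<omega>) - p) * cos (Y \<omega>)) = 0"
      "expectation (\<lambda>\<omega>. (indicator C (\<xi> \<omega>) - p) * sin (Y \<omega>)) = 0"
      using trig[OF Y] by (simp_all add: algebra_simps)
  qed
  have "(\<lambda>\<omega>. 0) \<in> perp_gaussians h"
    using gaussian_span_scale[OF \<xi>, of 0] unfolding perp_gaussians_def
    by (intro CollectI exI[of _ 0]) simp
  then have ne: "perp_gaussians h \<noteq> {}" by blast
  have 0: "expectation (\<lambda>\<omega>. (indicator C (\<xi> \<omega>) - p) * indicator A \<omega>) = 0"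
    by (rule trig_orthogonal_integral_zero[OF orth perp_gaussians_measurable _ ne A])
      (rule perp_gaussians_linear)
  have "sigma_sets (space M) ((\<Union>X\<in>perp_gaussians h. {X -` B \<inter> space M | B. B \<in> sets borel}) \<union> null_sets M) \<subseteq> sets M"
    using perp_gaussians_measurable[of h]
    by (intro sets.sigma_sets_subset) (auto intro: measurable_sets)
  with A have [measurable]: "A \<in> sets M" by blast
  have "expectation (\<lambda>\<omega>. (indicator C (\<xi> \<omega>) - p) * indicator A \<omega>)
      = expectation (\<lambda>\<omega>. indicator (\<xi> -` C \<inter> space M \<inter> A) \<omega> - p * indicator A \<omega>)"
    by (intro Bochner_Integration.integral_cong) (auto simp: indicator_def)
  also have "\<dots> = prob (\<xi> -` C \<inter> space M \<inter> A) - p * prob A"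
    by (subst Bochner_Integration.integral_diff) (auto simp: less_top[symmetric])
  finally show ?thesis using 0 by (simp add: p_def)
qed

end

section \<open>Stein's equation and Gaussian integration by parts\<close>

text \<open>
The standard normal density \<open>\<phi>\<close> satisfies \<open>\<phi>'(x) = - x \<phi>(x)\<close>, so the difference of the two
integrands is the derivative of \<open>\<phi> k\<close>, which vanishes at infinity.
\<close>
lemma std_normal_integral_by_parts:
  fixes k :: "real \<Rightarrow> real"
  assumes k: "\<And>x. (k has_real_derivative k' x) (at x)" and k': "continuous_on UNIV k'"
    and B: "\<And>x. \<bar>k x\<bar> \<le> B" and B': "\<And>x. \<bar>k' x\<bar> \<le> B'"
  shows "(\<integral>x. k' x \<partial>std_normal_distribution) = (\<integral>x. x * k x \<partial>std_normal_distribution)"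
proof -
  let ?\<phi> = std_normal_density
  have cont_k: "continuous_on UNIV k"
    using k DERIV_isCont continuous_at_imp_continuous_on by blast
  have [measurable]: "k \<in> borel_measurable borel" "k' \<in> borel_measurable borel"
    using cont_k k' by (auto intro: borel_measurable_continuous_onI)
  have \<phi>': "(?\<phi> has_real_derivative - x * ?\<phi> x) (at x)" for x
    unfolding std_normal_density_def[abs_def]
    by (rule derivative_eq_intros refl | simp)+
  have i1: "integrable lborel (\<lambda>x. ?\<phi> x * k' x)"
  proof (rule Bochner_Integration.integrable_bound)
    show "integrable lborel (\<lambda>x. B' * ?\<phi> x)"
      by (intro integrable_mult_right integrable_normal_density) simp
    have "?\<phi> x * \<bar>k' x\<bar> \<le> \<bar>B'\<bar> * ?\<phi> x" for x
      using mult_left_mono[OF order_trans[OF B'[of x] abs_ge_self], of "?\<phi> x"] by (simp add: mult.commute)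
    then show "AE x in lborel. norm (?\<phi> x * k' x) \<le> norm (B' * ?\<phi> x)"
      by (simp add: abs_mult)
  qed measurable
  have i2: "integrable lborel (\<lambda>x. ?\<phi> x * (x * k x))"
  proof (rule Bochner_Integration.integrable_bound)
    show "integrable lborel (\<lambda>x. B * (?\<phi> x * \<bar>x\<bar>))"
      using integrable_std_normal_moment_abs[of 1] by (intro integrable_mult_right) simp
    have "(?\<phi> x * \<bar>x\<bar>) * \<bar>k x\<bar> \<le> (?\<phi> x * \<bar>x\<bar>) * \<bar>B\<bar>" for x
      by (intro mult_left_mono order_trans[OF B abs_ge_self]) auto
    then show "AE x in lborel. norm (?\<phi> x * (x * k x)) \<le> norm (B * (?\<phi> x * \<bar>x\<bar>))"
      by (simp add: abs_mult mult_ac)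
  qed measurable
  define F where "F x = ?\<phi> x * k x" for x
  define f where "f x = ?\<phi> x * k' x - ?\<phi> x * (x * k x)" for x
  have F: "(F has_real_derivative f x) (at x)" for x
  proof -
    have "(F has_real_derivative (- x * ?\<phi> x) * k x + k' x * ?\<phi> x) (at x)"
      unfolding F_def by (rule DERIV_mult[OF \<phi>' k])
    then show ?thesis by (simp add: f_def algebra_simps)
  qed
  have bound: "\<bar>F x\<bar> \<le> B * exp (1/2) * exp (- \<bar>x\<bar>)" for x
  proof -
    have "?\<phi> x \<le> exp (- x\<^sup>2 / 2)"
    proof -
      have "1 \<le> sqrt (2 * pi)" using pi_gt3 by simp
      then have "1 / sqrt (2 * pi) * exp (- x\<^sup>2 / 2) \<le> 1 * exp (- x\<^sup>2 / 2)"
        by (intro mult_right_mono) (simp_all add: divide_le_eq_1)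
      then show ?thesis by (simp add: std_normal_density_def)
    qed
    also have "\<dots> \<le> exp (1/2 + (- \<bar>x\<bar>))"
    proof -
      (* Comparison of the Gaussian with an exponential tail. *)
      have "0 \<le> (\<bar>x\<bar> - 1)\<^sup>2" by simp
      then have "- x\<^sup>2 / 2 \<le> 1/2 + (- \<bar>x\<bar>)" by (simp add: power2_diff)
      then show ?thesis by (simp only: exp_le_cancel_iff)
    qed
    finally have "?\<phi> x \<le> exp (1/2) * exp (- \<bar>x\<bar>)" by (simp only: exp_add)
    then have "?\<phi> x * \<bar>k x\<bar> \<le> (exp (1/2) * exp (- \<bar>x\<bar>)) * B"
      using B by (intro mult_mono) auto
    then show ?thesis by (simp add: F_def abs_mult mult_ac)
  qed
  have top: "(F \<longlongrightarrow> 0) at_top"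
  proof (rule Lim_null_comparison)
    show "\<forall>\<^sub>F x in at_top. norm (F x) \<le> B * exp (1/2) * exp (- x)"
      using eventually_ge_at_top[of 0]
    proof eventually_elim
      case (elim x) then show ?case using bound[of x] by simp
    qed
    have "((\<lambda>x::real. exp (- x)) \<longlongrightarrow> 0) at_top"
      by (rule filterlim_compose[OF exp_at_bot filterlim_uminus_at_bot_at_top])
    from tendsto_mult_right_zero[OF this]
    show "((\<lambda>x. B * exp (1/2) * exp (- x)) \<longlongrightarrow> 0) at_top" .
  qed
  have bot: "(F \<longlongrightarrow> 0) at_bot"
  proof (rule Lim_null_comparison)
    show "\<forall>\<^sub>F x in at_bot. norm (F x) \<le> B * exp (1/2) * exp x"
      using eventually_le_at_bot[of 0]
    proof eventually_elim
      case (elim x) then show ?case using bound[of x] by simp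
    qed
    from tendsto_mult_right_zero[OF exp_at_bot]
    show "((\<lambda>x. B * exp (1/2) * exp x) \<longlongrightarrow> 0) at_bot" .
  qed
  have "(LBINT x=-\<infinity>..\<infinity>. f x) = 0 - 0"
  proof (rule interval_integral_FTC_integrable[where F = F])
    show "(F has_vector_derivative f x) (at x)" for x
      using F by (simp add: has_real_derivative_iff_has_vector_derivative)
    have "continuous_on UNIV f"
      unfolding f_def std_normal_density_def by (auto intro!: continuous_intros k' cont_k)
    then show "isCont f x" for x by (simp add: continuous_on_eq_continuous_at)
    show "set_integrable lborel (einterval (-\<infinity>) \<infinity>) f"
      using i1 i2 by (simp add: set_integrable_def f_def[abs_def])
  qed (use top bot in \<open>simp_all add: ereal_tendsto_simps1\<close>)
  then have "(\<integral>x. f x \<partial>lborel) = 0"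
    by (simp add: interval_lebesgue_integral_def set_lebesgue_integral_def)
  then have "(\<integral>x. ?\<phi> x * k' x \<partial>lborel) = (\<integral>x. ?\<phi> x * (x * k x) \<partial>lborel)"
    using i1 i2 by (simp add: f_def[abs_def])
  then show ?thesis by (simp add: integral_density)
qed

text \<open>
The function \<open>s(x) = \<integral> exp (t\<^sup>2 / 2) sin (t x + \<theta>) dt\<close> over \<open>{0..T}\<close> solves Stein's equation for a
cosine, because \<open>s'(x) - x s(x)\<close> is the integral of the \<open>t\<close>-derivative of
\<open>exp (t\<^sup>2 / 2) cos (t x + \<theta>)\<close>.
\<close>
lemma stein_function:
  assumes "T \<ge> 0"
  obtains s s' :: "real \<Rightarrow> real"
  where "\<And>x. (s has_real_derivative s' x) (at x)" "continuous_on UNIV s'"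
    "\<And>x. \<bar>s x\<bar> \<le> T * exp (T\<^sup>2 / 2)" "\<And>x. \<bar>s' x\<bar> \<le> T\<^sup>2 * exp (T\<^sup>2 / 2)"
    "\<And>x. s' x - x * s x = exp (T\<^sup>2 / 2) * cos (T * x + \<theta>) - cos \<theta>"
proof -
  define f where "f x t = exp (t\<^sup>2 / 2) * sin (t * x + \<theta>)" for x t :: real
  define g where "g x t = exp (t\<^sup>2 / 2) * (t * cos (t * x + \<theta>))" for x t :: real
  define s where "s x = integral (cbox 0 T) (f x)" for x
  define s' where "s' x = integral (cbox 0 T) (g x)" for x
  have int: "f x integrable_on cbox 0 T" "g x integrable_on cbox 0 T" for x
    unfolding f_def g_def by (auto intro!: integrable_continuous_real continuous_intros)
  have contg: "continuous_on (UNIV \<times> cbox 0 T) (\<lambda>(x, t). g x t)"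
    unfolding g_def split_beta by (intro continuous_intros) auto
  have "(s has_real_derivative s' x) (at x)" for x
    unfolding s_def s'_def
  proof (rule leibniz_rule_field_derivative[where U = UNIV])
    show "((\<lambda>x. f x t) has_real_derivative g x t) (at x within UNIV)" for x t
      unfolding f_def g_def by (rule derivative_eq_intros refl | simp)+
  qed (use int contg in auto)
  moreover have "continuous_on UNIV s'"
    unfolding s'_def by (rule integral_continuous_on_param[OF contg])
  moreover have "\<bar>s x\<bar> \<le> T * exp (T\<^sup>2 / 2)" for x
  proof -
    have "norm (s x) \<le> exp (T\<^sup>2 / 2) * measure lborel (cbox 0 T)"
      unfolding s_def
    proof (rule integrable_bound[OF _ int(1)])
      fix t assume t: "t \<in> cbox 0 T"
      have "exp (t\<^sup>2 / 2) * \<bar>sin (t * x + \<theta>)\<bar> \<le> exp (T\<^sup>2 / 2) * 1"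
        using t by (intro mult_mono) (auto intro!: divide_right_mono power_mono)
      then show "norm (f x t) \<le> exp (T\<^sup>2 / 2)" by (simp add: f_def abs_mult)
    qed simp
    then show ?thesis using assms by (simp add: mult.commute)
  qed
  moreover have "\<bar>s' x\<bar> \<le> T\<^sup>2 * exp (T\<^sup>2 / 2)" for x
  proof -
    have "norm (s' x) \<le> (exp (T\<^sup>2 / 2) * T) * measure lborel (cbox 0 T)"
      unfolding s'_def
    proof (rule integrable_bound[OF _ int(2)])
      fix t assume t: "t \<in> cbox 0 T"
      have "exp (t\<^sup>2 / 2) * (\<bar>t\<bar> * \<bar>cos (t * x + \<theta>)\<bar>) \<le> exp (T\<^sup>2 / 2) * (T * 1)"
        using t by (intro mult_mono) (auto intro!: divide_right_mono power_mono)
      then show "norm (g x t) \<le> exp (T\<^sup>2 / 2) * T" by (simp add: g_def abs_mult)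
    qed (use assms in simp)
    then show ?thesis using assms by (simp add: power2_eq_square mult_ac)
  qed
  moreover have "s' x - x * s x = exp (T\<^sup>2 / 2) * cos (T * x + \<theta>) - cos \<theta>" for x
  proof -
    let ?p = "\<lambda>t. exp (t\<^sup>2 / 2) * cos (t * x + \<theta>)"
    have "((\<lambda>t. g x t - x * f x t) has_integral (?p T - ?p 0)) {0..T}"
    proof (rule fundamental_theorem_of_calculus[OF assms])
      fix t
      have "(?p has_real_derivative g x t - x * f x t) (at t)"
        unfolding f_def g_def by (rule derivative_eq_intros refl | simp add: algebra_simps)+
      then show "(?p has_vector_derivative g x t - x * f x t) (at t within {0..T})"
        by (simp add: has_real_derivative_iff_has_vector_derivative has_vector_derivative_at_within)
    qed
    moreover have "((\<lambda>t. g x t - x * f x t) has_integral (s' x - x * s x)) {0..T}"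
      using int[of x] unfolding s_def s'_def
      by (intro has_integral_diff has_integral_mult_right) (auto intro: integrable_integral)
    ultimately show ?thesis by (auto dest: has_integral_unique)
  qed
  ultimately show thesis using that by blast
qed

context isonormal_gaussian_process
begin

lemma gaussian_span_std_normal:
  assumes \<xi>: "(\<xi>, h) \<in> gaussian_span W" and h: "norm h = 1"
  shows "distr M borel \<xi> = std_normal_distribution"
proof (rule Levy_uniqueness)
  have [measurable]: "\<xi> \<in> borel_measurable M" by (rule gaussian_span_measurable[OF \<xi>])
  show "real_distribution (distr M borel \<xi>)" by (rule real_distribution_distr) simp
  show "real_distribution std_normal_distribution" by (rule real_dist_normal_dist)
  show "char (distr M borel \<xi>) = char std_normal_distribution"
  proof
    fix t
    note E = gaussian_span_trig[OF gaussian_span_scale[OF \<xi>, of t]]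
    have [simp]: "integrable M (\<lambda>\<omega>. cos (t * \<xi> \<omega>))" "integrable M (\<lambda>\<omega>. sin (t * \<xi> \<omega>))"
      by (auto intro!: integrable_const_bound[of _ 1])
    have "char (distr M borel \<xi>) t = expectation (\<lambda>\<omega>. iexp (t * \<xi> \<omega>))"
      unfolding char_def by (subst integral_distr) auto
    also have "\<dots> = expectation (\<lambda>\<omega>. complex_of_real (cos (t * \<xi> \<omega>)) + \<i> * complex_of_real (sin (t * \<xi> \<omega>)))"
      by (simp add: exp_Euler cos_of_real sin_of_real del: of_real_mult)
    also have "\<dots> = complex_of_real (expectation (\<lambda>\<omega>. cos (t * \<xi> \<omega>))) + \<i> * complex_of_real (expectation (\<lambda>\<omega>. sin (t * \<xi> \<omega>)))"
      by simp
    finally show "char (distr M borel \<xi>) t = char std_normal_distribution t"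
      by (simp add: E h char_std_normal_distribution)
  qed
qed

lemma gaussian_splitting_law:
  assumes \<xi>: "(\<xi>, h) \<in> gaussian_span W" and h: "norm h = 1"
    and \<eta>: "\<And>i :: nat. \<eta> i \<in> perp_gaussians h"
  shows "distr M borel (\<lambda>\<omega> i. \<eta> i \<omega>) \<Otimes>\<^sub>M std_normal_distribution
    = distr M (borel \<Otimes>\<^sub>M borel) (\<lambda>\<omega>. (\<lambda>i. \<eta> i \<omega>, \<xi> \<omega>))"
proof (rule pair_measure_eqI)
  have [measurable]: "\<xi> \<in> borel_measurable M" by (rule gaussian_span_measurable[OF \<xi>])
  have "\<eta> i \<in> borel_measurable M" for i using \<eta> perp_gaussians_measurable by blast
  then have \<eta>m [measurable]: "(\<lambda>\<omega> i. \<eta> i \<omega>) \<in> borel_measurable M"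
    by (intro measurable_coordinatewise_then_product) simp
  note std = gaussian_span_std_normal[OF \<xi> h]
  have "prob_space (distr M borel (\<lambda>\<omega> i. \<eta> i \<omega>))" by (rule prob_space_distr) simp
  then show "sigma_finite_measure (distr M borel (\<lambda>\<omega> i. \<eta> i \<omega>))"
    by (rule prob_space_imp_sigma_finite)
  show "sigma_finite_measure std_normal_distribution"
    using real_dist_normal_dist by (simp add: prob_space_imp_sigma_finite real_distribution_def)
  show "sets (distr M borel (\<lambda>\<omega> i. \<eta> i \<omega>) \<Otimes>\<^sub>M std_normal_distribution)
    = sets (distr M (borel \<Otimes>\<^sub>M borel) (\<lambda>\<omega>. (\<lambda>i. \<eta> i \<omega>, \<xi> \<omega>)))"
    by (simp cong: sets_pair_measure_cong)
  fix A :: "(nat \<Rightarrow> real) set" and C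
  assume "A \<in> sets (distr M borel (\<lambda>\<omega> i. \<eta> i \<omega>))" "C \<in> sets std_normal_distribution"
  then have [measurable]: "A \<in> sets borel" "C \<in> sets borel" by auto
  define G where "G = (\<Union>X\<in>perp_gaussians h. {X -` B \<inter> space M | B. B \<in> sets borel}) \<union> null_sets M"
  have G: "G \<subseteq> Pow (space M)"
    unfolding G_def using sets.sets_into_space by (auto simp: null_sets_def)
  have "\<eta> i \<in> borel_measurable (sigma (space M) G)" for i
  proof (rule measurableI)
    fix B :: "real set" assume "B \<in> sets borel"
    then have "\<eta> i -` B \<inter> space M \<in> G" unfolding G_def using \<eta>[of i] by blast
    then show "\<eta> i -` B \<inter> space (sigma (space M) G) \<in> sets (sigma (space M) G)"
      using G by (simp add: sets_measure_of space_measure_of_conv sigma_sets.Basic)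
  qed simp
  then have "(\<lambda>\<omega> i. \<eta> i \<omega>) \<in> borel_measurable (sigma (space M) G)"
    by (intro measurable_coordinatewise_then_product) simp
  from measurable_sets[OF this, of A]
  have "(\<lambda>\<omega> i. \<eta> i \<omega>) -` A \<inter> space M \<in> sigma_sets (space M) G"
    using G by (simp add: sets_measure_of space_measure_of_conv)
  from perp_gaussians_independent[OF \<xi> \<open>C \<in> sets borel\<close> this[unfolded G_def]]
  have "prob (\<xi> -` C \<inter> space M \<inter> ((\<lambda>\<omega> i. \<eta> i \<omega>) -` A \<inter> space M))
      = prob (\<xi> -` C \<inter> space M) * prob ((\<lambda>\<omega> i. \<eta> i \<omega>) -` A \<inter> space M)" .
  moreover have "(\<lambda>\<omega>. (\<lambda>i. \<eta> i \<omega>, \<xi> \<omega>)) -` (A \<times> C) \<inter> space M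
      = \<xi> -` C \<inter> space M \<inter> ((\<lambda>\<omega> i. \<eta> i \<omega>) -` A \<inter> space M)" by auto
  ultimately show "emeasure (distr M borel (\<lambda>\<omega> i. \<eta> i \<omega>)) A * emeasure std_normal_distribution C
    = emeasure (distr M (borel \<Otimes>\<^sub>M borel) (\<lambda>\<omega>. (\<lambda>i. \<eta> i \<omega>, \<xi> \<omega>))) (A \<times> C)"
    unfolding std[symmetric]
    by (simp add: emeasure_distr emeasure_eq_measure ennreal_mult[symmetric] mult.commute)
qed

text \<open>
The vector field \<open>s(\<xi>) h\<close> has divergence \<open>\<xi> s(\<xi>) - s'(\<xi>)\<close>. Each Gaussian variable in the smooth
random variable is split into a multiple of \<open>\<xi>\<close> and a part independent of \<open>\<xi>\<close>; with the independent
parts fixed, the claim is integration by parts in the single variable \<open>\<xi>\<close>.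
\<close>
lemma gaussian_integration_by_parts:
  assumes \<xi>: "(\<xi>, h) \<in> gaussian_span W" and h: "norm h = 1"
    and s: "\<And>x. (s has_real_derivative s' x) (at x)" and s': "continuous_on UNIV s'"
    and S: "\<And>x. \<bar>s x\<bar> \<le> S" and S': "\<And>x. \<bar>s' x\<bar> \<le> S'"
    and HK: "smooth_with_deriv W H K"
  shows "expectation (\<lambda>\<omega>. inner (K \<omega>) (s (\<xi> \<omega>) *\<^sub>R h)) = expectation (\<lambda>\<omega>. H \<omega> * (\<xi> \<omega> * s (\<xi> \<omega>) - s' (\<xi> \<omega>)))"
proof -
  obtain n f l where f: "f \<in> Cb_smooth n" and H: "H = (\<lambda>\<omega>. f (\<lambda>i. W (l i) \<omega>))"
    and K: "K = (\<lambda>\<omega>. \<Sum>k<n. partial_deriv k f (\<lambda>i. W (l i) \<omega>) *\<^sub>R l k)"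
    using HK unfolding smooth_with_deriv_def by blast
  (* a i is the covariance of W (l i) and \<xi>, so \<eta> i is uncorrelated with \<xi>. *)
  define a where "a i = inner (l i) h" for i
  define \<eta> where "\<eta> i \<omega> = W (l i) \<omega> + (- a i) * \<xi> \<omega>" for i \<omega>
  have W_eq: "W (l i) \<omega> = a i * \<xi> \<omega> + \<eta> i \<omega>" for i \<omega> by (simp add: \<eta>_def)
  have \<eta>: "\<eta> i \<in> perp_gaussians h" for i
  proof -
    have "inner h (l i + (- a i) *\<^sub>R h) = 0"
      using h by (simp add: a_def inner_diff_right inner_commute dot_square_norm)
    then show ?thesis
      unfolding perp_gaussians_def \<eta>_def[abs_def]
      using gaussian_span_add[OF gaussian_span_base[of W "l i"] \<xi>, of "- a i"] by blast
  qed
  have [measurable]: "\<xi> \<in> borel_measurable M" by (rule gaussian_span_measurable[OF \<xi>])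
  have "\<eta> i \<in> borel_measurable M" for i using \<eta> perp_gaussians_measurable by blast
  then have \<eta>m [measurable]: "(\<lambda>\<omega> i. \<eta> i \<omega>) \<in> borel_measurable M"
    by (intro measurable_coordinatewise_then_product) simp
  define N where "N = distr M borel (\<lambda>\<omega> i. \<eta> i \<omega>)"
  have law: "N \<Otimes>\<^sub>M std_normal_distribution
      = distr M (borel \<Otimes>\<^sub>M borel) (\<lambda>\<omega>. (\<lambda>i. \<eta> i \<omega>, \<xi> \<omega>))"
    unfolding N_def by (rule gaussian_splitting_law[OF \<xi> h \<eta>])
  define D where "D x = (\<Sum>k<n. a k * partial_deriv k f x)" for x
  have contD: "continuous_on UNIV D"
    unfolding D_def by (intro continuous_intros Cb_smooth_continuous[OF Cb_smooth_partial[OF f]]) auto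
  have cont_s: "continuous_on UNIV s"
    using s DERIV_isCont continuous_at_imp_continuous_on by blast
  obtain Bf where Bf: "\<And>x. \<bar>f x\<bar> \<le> Bf"
    using Cb_smooth_bounded[OF f] by (auto simp: bounded_iff)
  have "\<exists>B. \<forall>x. \<bar>partial_deriv k f x\<bar> \<le> B" if "k < n" for k
    using Cb_smooth_bounded[OF Cb_smooth_partial[OF f that]] unfolding bounded_iff by auto
  then obtain B where B: "\<And>k x. k < n \<Longrightarrow> \<bar>partial_deriv k f x\<bar> \<le> B k" by metis
  define BD where "BD = (\<Sum>k<n. \<bar>a k\<bar> * B k)"
  have BD: "\<bar>D x\<bar> \<le> BD" for x
    unfolding D_def BD_def by (rule order_trans[OF sum_abs]) (auto intro!: sum_mono mult_left_mono B simp: abs_mult)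
  have [measurable]: "s \<in> borel_measurable borel" "s' \<in> borel_measurable borel"
    "f \<in> borel_measurable borel" "D \<in> borel_measurable borel"
    using cont_s s' contD Cb_smooth_continuous[OF f] by (auto intro: borel_measurable_continuous_onI)
  define p where "p u = (\<lambda>i. a i * snd u + fst u i)" for u :: "(nat \<Rightarrow> real) \<times> real"
  have [measurable]: "p \<in> borel_measurable (borel \<Otimes>\<^sub>M borel)"
  proof (rule measurable_coordinatewise_then_product)
    fix i
    have [measurable]: "(\<lambda>y :: nat \<Rightarrow> real. y i) \<in> borel_measurable borel"
      by (rule borel_measurable_continuous_onI[OF continuous_on_product_coordinates])
    show "(\<lambda>u. p u i) \<in> borel_measurable (borel \<Otimes>\<^sub>M borel)"
      unfolding p_def by measurable
  qed
  have p_path: "p (\<lambda>i. \<eta> i \<omega>, \<xi> \<omega>) = (\<lambda>i. W (l i) \<omega>)" for \<omega>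
    by (simp add: p_def W_eq)
  define J1 where "J1 u = D (p u) * s (snd u)" for u
  define J2 where "J2 u = f (p u) * (snd u * s (snd u) - s' (snd u))" for u
  have [measurable]: "J1 \<in> borel_measurable (borel \<Otimes>\<^sub>M borel)" "J2 \<in> borel_measurable (borel \<Otimes>\<^sub>M borel)"
    unfolding J1_def J2_def by measurable
  have int1: "integrable M (\<lambda>\<omega>. J1 (\<lambda>i. \<eta> i \<omega>, \<xi> \<omega>))"
  proof (rule integrable_const_bound[of _ "BD * S"])
    show "AE \<omega> in M. norm (J1 (\<lambda>i. \<eta> i \<omega>, \<xi> \<omega>)) \<le> BD * S"
      using order_trans[OF abs_ge_zero BD]
      by (auto simp: J1_def abs_mult intro!: mult_mono BD S)
  qed measurable
  have int2: "integrable M (\<lambda>\<omega>. J2 (\<lambda>i. \<eta> i \<omega>, \<xi> \<omega>))"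
  proof (rule Bochner_Integration.integrable_bound)
    show "integrable M (\<lambda>\<omega>. Bf * (\<bar>\<xi> \<omega>\<bar> * S + S'))"
      using L2_integrable[OF gaussian_span_L2[OF \<xi>]] by simp
    have "\<bar>f x\<bar> * \<bar>y * s y - s' y\<bar> \<le> \<bar>Bf * (\<bar>y\<bar> * S + S')\<bar>" for x y
    proof -
      have "\<bar>y * s y - s' y\<bar> \<le> \<bar>y\<bar> * \<bar>s y\<bar> + \<bar>s' y\<bar>"
        using abs_triangle_ineq4[of "y * s y" "s' y"] by (simp add: abs_mult)
      also have "\<dots> \<le> \<bar>y\<bar> * S + S'"
        by (intro add_mono mult_left_mono S S') simp
      finally have "\<bar>f x\<bar> * \<bar>y * s y - s' y\<bar> \<le> Bf * (\<bar>y\<bar> * S + S')"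
        using order_trans[OF abs_ge_zero Bf] by (intro mult_mono Bf) auto
      then show ?thesis by linarith
    qed
    then show "AE \<omega> in M. norm (J2 (\<lambda>i. \<eta> i \<omega>, \<xi> \<omega>)) \<le> norm (Bf * (\<bar>\<xi> \<omega>\<bar> * S + S'))"
      by (simp add: J2_def abs_mult)
  qed measurable
  interpret N: prob_space N unfolding N_def by (rule prob_space_distr) simp
  interpret G: prob_space std_normal_distribution
    using real_dist_normal_dist by (simp add: real_distribution_def)
  interpret pair_sigma_finite N std_normal_distribution ..
  have disintegrate: "expectation (\<lambda>\<omega>. J (\<lambda>i. \<eta> i \<omega>, \<xi> \<omega>))
      = (\<integral>y. \<integral>x. J (y, x) \<partial>std_normal_distribution \<partial>N)"
    if [measurable]: "J \<in> borel_measurable (borel \<Otimes>\<^sub>M borel)" and J: "integrable M (\<lambda>\<omega>. J (\<lambda>i. \<eta> i \<omega>, \<xi> \<omega>))"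
    for J :: "(nat \<Rightarrow> real) \<times> real \<Rightarrow> real"
  proof -
    have "integrable (N \<Otimes>\<^sub>M std_normal_distribution) J"
      unfolding law using J by (subst integrable_distr_eq) auto
    from integral_fst'[OF this] show ?thesis
      unfolding law by (subst (asm) integral_distr) auto
  qed
  have inner: "(\<integral>x. J1 (y, x) \<partial>std_normal_distribution) = (\<integral>x. J2 (y, x) \<partial>std_normal_distribution)" for y
  proof -
    let ?k = "\<lambda>x. f (p (y, x)) * s x" and ?k' = "\<lambda>x. D (p (y, x)) * s x + f (p (y, x)) * s' x"
    have k: "(?k has_real_derivative ?k' x) (at x)" for x
    proof -
      have "((\<lambda>x. f (p (y, x))) has_real_derivative D (p (y, x))) (at x)"
        unfolding D_def p_def fst_conv snd_conv by (rule Cb_smooth_line_deriv[OF f])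
      from DERIV_mult[OF this s] show ?thesis by (simp add: algebra_simps)
    qed
    have pc: "continuous_on UNIV (\<lambda>x. p (y, x))"
      unfolding p_def fst_conv snd_conv
      by (intro continuous_on_coordinatewise_then_product continuous_intros)
    have fD: "continuous_on UNIV (\<lambda>x. f (p (y, x)))" "continuous_on UNIV (\<lambda>x. D (p (y, x)))"
      using continuous_on_compose2[OF Cb_smooth_continuous[OF f] pc] continuous_on_compose2[OF contD pc] by simp_all
    have bounds: "\<bar>?k x\<bar> \<le> Bf * S" "\<bar>?k' x\<bar> \<le> BD * S + Bf * S'"
      "\<bar>D (p (y, x)) * s x\<bar> \<le> BD * S" "\<bar>f (p (y, x)) * s' x\<bar> \<le> Bf * S'" for x
    proof -
      have nn: "0 \<le> Bf" "0 \<le> BD"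
        using order_trans[OF abs_ge_zero Bf] order_trans[OF abs_ge_zero BD] by blast+
      show 1: "\<bar>?k x\<bar> \<le> Bf * S" "\<bar>D (p (y, x)) * s x\<bar> \<le> BD * S" "\<bar>f (p (y, x)) * s' x\<bar> \<le> Bf * S'"
        using nn by (auto simp: abs_mult intro!: mult_mono Bf BD S S')
      show "\<bar>?k' x\<bar> \<le> BD * S + Bf * S'"
        using 1 by linarith
    qed
    have parts: "(\<integral>x. ?k' x \<partial>std_normal_distribution) = (\<integral>x. x * ?k x \<partial>std_normal_distribution)"
    proof (rule std_normal_integral_by_parts[OF k _ bounds(1,2)])
      show "continuous_on UNIV ?k'" by (intro continuous_intros fD cont_s s')
    qed
    have [measurable]: "(\<lambda>x. f (p (y, x))) \<in> borel_measurable borel" "(\<lambda>x. D (p (y, x))) \<in> borel_measurable borel"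
      using fD by (auto intro: borel_measurable_continuous_onI)
    have [simp]: "integrable std_normal_distribution (\<lambda>x. D (p (y, x)) * s x)"
      "integrable std_normal_distribution (\<lambda>x. f (p (y, x)) * s' x)"
      by (rule G.integrable_const_bound[of _ "BD * S"], simp add: bounds(3), measurable)
         (rule G.integrable_const_bound[of _ "Bf * S'"], simp add: bounds(4), measurable)
    have [simp]: "integrable std_normal_distribution (\<lambda>x. x * ?k x)"
    proof (rule Bochner_Integration.integrable_bound)
      show "integrable std_normal_distribution (\<lambda>x. (Bf * S) * x)"
        using integrable_std_normal_distribution_moment[of 1] by simp
      have "\<bar>x\<bar> * \<bar>?k x\<bar> \<le> \<bar>x\<bar> * \<bar>Bf * S\<bar>" for x
        by (intro mult_left_mono order_trans[OF bounds(1) abs_ge_self]) simp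
      then show "AE x in std_normal_distribution. norm (x * ?k x) \<le> norm ((Bf * S) * x)"
        by (simp add: abs_mult mult_ac)
    qed measurable
    have "(\<integral>x. J2 (y, x) \<partial>std_normal_distribution)
        = (\<integral>x. x * ?k x - f (p (y, x)) * s' x \<partial>std_normal_distribution)"
      by (simp add: J2_def algebra_simps)
    also have "\<dots> = (\<integral>x. ?k' x \<partial>std_normal_distribution) - (\<integral>x. f (p (y, x)) * s' x \<partial>std_normal_distribution)"
      unfolding parts by (rule Bochner_Integration.integral_diff) simp_all
    also have "\<dots> = (\<integral>x. J1 (y, x) \<partial>std_normal_distribution)"
      by (simp add: J1_def)
    finally show ?thesis ..
  qed
  have "expectation (\<lambda>\<omega>. inner (K \<omega>) (s (\<xi> \<omega>) *\<^sub>R h)) = expectation (\<lambda>\<omega>. J1 (\<lambda>i. \<eta> i \<omega>, \<xi> \<omega>))"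
    unfolding J1_def p_path K D_def snd_conv
    by (simp add: inner_sum_left a_def mult_ac sum_distrib_left)
  also have "\<dots> = expectation (\<lambda>\<omega>. J2 (\<lambda>i. \<eta> i \<omega>, \<xi> \<omega>))"
    using int1 int2 by (simp add: disintegrate inner)
  also have "\<dots> = expectation (\<lambda>\<omega>. H \<omega> * (\<xi> \<omega> * s (\<xi> \<omega>) - s' (\<xi> \<omega>)))"
    unfolding J2_def p_path H snd_conv ..
  finally show ?thesis .
qed

text \<open>
The hypothesis says that \<open>E[Z cos (X + \<theta>)] = E[Z] E[cos (X + \<theta>)]\<close> for every \<open>X\<close> in the Gaussian
span: such an \<open>X\<close> is \<open>T \<xi>\<close> with \<open>\<xi>\<close> standard Gaussian and \<open>T\<close> the norm of the vector representing \<open>X\<close>,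
unless this norm is zero and \<open>X = 0\<close> almost surely.
Since \<open>W\<close> generates the sigma-algebra up to null sets, \<open>Z - E[Z]\<close> is orthogonal to every event.
\<close>
lemma stein_characterization_imp_constant:
  assumes Z: "integrable M Z"
    and stein: "\<And>\<xi> h T \<theta>. (\<xi>, h) \<in> gaussian_span W \<Longrightarrow> norm h = 1 \<Longrightarrow> T \<ge> 0 \<Longrightarrow>
      expectation (\<lambda>\<omega>. Z \<omega> * (exp (T\<^sup>2 / 2) * cos (T * \<xi> \<omega> + \<theta>) - cos \<theta>)) = 0"
  shows "AE \<omega> in M. Z \<omega> = expectation Z"
proof -
  define V where "V = {X. \<exists>h. (X, h) \<in> gaussian_span W}"
  have base: "W h \<in> V" for h
    unfolding V_def using gaussian_span_base[of W] by blast
  have meas: "V \<subseteq> borel_measurable M"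
    unfolding V_def using gaussian_span_measurable by blast
  have lin: "(\<lambda>\<omega>. X \<omega> + c * Y \<omega>) \<in> V" if XY: "X \<in> V" "Y \<in> V" for X Y c
  proof -
    obtain h k where "(X, h) \<in> gaussian_span W" "(Y, k) \<in> gaussian_span W"
      using XY unfolding V_def by blast
    from gaussian_span_add[OF this, of c] show ?thesis unfolding V_def by blast
  qed
  have [measurable]: "Z \<in> borel_measurable M" using Z by simp
  have shifted: "expectation (\<lambda>\<omega>. Z \<omega> * cos (X \<omega> + \<theta>)) = expectation Z * (exp (- (norm h)\<^sup>2 / 2) * cos \<theta>)"
    if X: "(X, h) \<in> gaussian_span W" for X h \<theta>
  proof (cases "h = 0")
    case True
    have [measurable]: "X \<in> borel_measurable M" by (rule gaussian_span_measurable[OF X])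
    have "expectation (\<lambda>\<omega>. (X \<omega>)\<^sup>2) = 0"
      using gaussian_span_covariance[OF X X] True by (simp add: power2_eq_square)
    then have "AE \<omega> in M. X \<omega> = 0"
      using L2_real_square[OF gaussian_span_L2[OF X]] by (simp add: integral_nonneg_eq_0_iff_AE)
    then have "expectation (\<lambda>\<omega>. Z \<omega> * cos (X \<omega> + \<theta>)) = expectation (\<lambda>\<omega>. Z \<omega> * cos \<theta>)"
      by (intro integral_cong_AE) auto
    then show ?thesis using True by simp
  next
    case False
    let ?T = "norm h"
    define \<xi> where "\<xi> \<omega> = (1 / ?T) * X \<omega>" for \<omega>
    have \<xi>: "(\<xi>, (1 / ?T) *\<^sub>R h) \<in> gaussian_span W"
      unfolding \<xi>_def[abs_def] by (rule gaussian_span_scale[OF X])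
    have [measurable]: "X \<in> borel_measurable M" by (rule gaussian_span_measurable[OF X])
    have int: "integrable M (\<lambda>\<omega>. Z \<omega> * cos (X \<omega> + \<theta>))"
      by (intro integrable_mult_bounded Z) auto
    have "0 = expectation (\<lambda>\<omega>. Z \<omega> * (exp (?T\<^sup>2 / 2) * cos (?T * \<xi> \<omega> + \<theta>) - cos \<theta>))"
      using False by (intro stein[OF \<xi>, symmetric]) auto
    also have "\<dots> = expectation (\<lambda>\<omega>. exp (?T\<^sup>2 / 2) * (Z \<omega> * cos (X \<omega> + \<theta>)) - cos \<theta> * Z \<omega>)"
      using False by (simp add: \<xi>_def algebra_simps)
    also have "\<dots> = exp (?T\<^sup>2 / 2) * expectation (\<lambda>\<omega>. Z \<omega> * cos (X \<omega> + \<theta>)) - cos \<theta> * expectation Z"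
      using Z int by simp
    finally show ?thesis by (simp add: exp_minus field_simps)
  qed
  define Z' where "Z' \<omega> = Z \<omega> - expectation Z" for \<omega>
  have iZ': "integrable M Z'" using Z by (simp add: Z'_def[abs_def])
  have [measurable]: "Z' \<in> borel_measurable M" using iZ' by simp
  have orth: "trig_orthogonal M V Z'"
  proof (rule trig_orthogonalI[OF iZ'])
    fix X assume "X \<in> V"
    then obtain h where X: "(X, h) \<in> gaussian_span W" by (auto simp: V_def)
    have [measurable]: "X \<in> borel_measurable M" by (rule gaussian_span_measurable[OF X])
    have [simp]: "integrable M (\<lambda>\<omega>. Z \<omega> * cos (X \<omega>))" "integrable M (\<lambda>\<omega>. Z \<omega> * sin (X \<omega>))"
      by (auto intro!: integrable_mult_bounded Z)
    have [simp]: "integrable M (\<lambda>\<omega>. cos (X \<omega>))" "integrable M (\<lambda>\<omega>. sin (X \<omega>))"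
      by (auto intro!: integrable_const_bound[of _ 1])
    (* The phase - \<pi> / 2 turns the statement about cosines into the one about sines. *)
    have "cos (x - pi / 2) = sin x" for x :: real by (simp add: cos_diff)
    then have "expectation (\<lambda>\<omega>. Z \<omega> * sin (X \<omega>)) = 0"
      using shifted[OF X, of "- (pi / 2)"] by simp
    then show "expectation (\<lambda>\<omega>. Z' \<omega> * cos (X \<omega>)) = 0" "expectation (\<lambda>\<omega>. Z' \<omega> * sin (X \<omega>)) = 0"
      using shifted[OF X, of 0] gaussian_span_trig[OF X] by (simp_all add: Z'_def left_diff_distrib)
  qed
  have zero: "expectation (\<lambda>\<omega>. Z' \<omega> * indicator A \<omega>) = 0" if A: "A \<in> sets M" for A
  proof (rule trig_orthogonal_integral_zero[OF orth meas lin])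
    show "V \<noteq> {}" using base by blast
    have "(\<Union>h. {W h -` B \<inter> space M | B. B \<in> sets borel}) \<union> null_sets M
      \<subseteq> (\<Union>X\<in>V. {X -` B \<inter> space M | B. B \<in> sets borel}) \<union> null_sets M"
      using base by blast
    from sigma_sets_mono'[OF this] A generated
    show "A \<in> sigma_sets (space M) ((\<Union>X\<in>V. {X -` B \<inter> space M | B. B \<in> sets borel}) \<union> null_sets M)"
      by blast
  qed
  have "AE \<omega> in M. Z' \<omega> = 0"
  proof (rule density_zero)
    show "integrable M Z'" by (rule iZ')
    show "set_lebesgue_integral M A Z' = 0" if "A \<in> sets M" for A
      using zero[OF that] by (simp add: set_lebesgue_integral_def mult.commute)
  qed
  then show ?thesis by (simp add: Z'_def)
qed

end

section \<open>Small balls and constancy\<close>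

context isonormal_gaussian_process
begin

text \<open>
The duality is applied to the vector field \<open>s(\<xi>) h\<close> on the interval \<open>{a - \<epsilon>..a + \<epsilon>}\<close> and divided by
\<open>2 \<epsilon>\<close>. The right-hand side tends to \<open>E[sgn (F - a) d]\<close>, where \<open>d\<close> is the divergence of the field. The left-hand side is at most a multiple of
\<open>P(\<bar>F - a\<bar> \<le> \<epsilon>)\<^sup>1\<^sup>/\<^sup>2 / \<epsilon>\<close>, which is bounded by hypothesis, times the \<open>L\<^sup>2\<close> norm of \<open>DF\<close> on a set shrinking to
the null set \<open>{F = a}\<close>, which tends to zero.
\<close>
lemma small_ball_imp_sgn_constant:
  assumes FG: "has_malliavin_deriv M W F G"
    and ball: "\<And>\<epsilon>. \<epsilon> > 0 \<Longrightarrow> prob {\<omega> \<in> space M. \<bar>F \<omega> - a\<bar> \<le> \<epsilon>} \<le> C * \<epsilon>\<^sup>2"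
  shows "AE \<omega> in M. sgn (F \<omega> - a) = expectation (\<lambda>\<omega>. sgn (F \<omega> - a))"
proof (rule stein_characterization_imp_constant)
  have F: "F \<in> L2 M" and G: "G \<in> L2 M"
    using FG by (auto simp: has_malliavin_deriv_def)
  note [measurable] = L2_D(1)[OF F] L2_D(1)[OF G]
  show "integrable M (\<lambda>\<omega>. sgn (F \<omega> - a))"
    by (rule integrable_const_bound[of _ 1]) (auto simp: sgn_if)
  define \<epsilon> where "\<epsilon> n = inverse (real (Suc n))" for n
  have \<epsilon>: "\<epsilon> n > 0" for n by (simp add: \<epsilon>_def)
  have \<epsilon>_lim: "\<epsilon> \<longlonglongrightarrow> 0" unfolding \<epsilon>_def by (rule LIMSEQ_inverse_real_of_nat)
  define A where "A n = {\<omega> \<in> space M. \<bar>F \<omega> - a\<bar> \<le> \<epsilon> n}" for n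
  have [measurable]: "A n \<in> sets M" for n unfolding A_def by measurable
  have prob_A: "prob (A n) \<le> C * (\<epsilon> n)\<^sup>2" for n unfolding A_def by (rule ball[OF \<epsilon>])
  have C: "C \<ge> 0"
    using order_trans[OF measure_nonneg prob_A[of 0]] \<epsilon>[of 0] by (simp add: zero_le_mult_iff)
  have no_atom: "AE \<omega> in M. F \<omega> \<noteq> a"
  proof -
    have "prob {\<omega> \<in> space M. F \<omega> = a} \<le> prob (A n)" for n
      using \<epsilon>[of n] by (intro finite_measure_mono) (auto simp: A_def)
    then have "prob {\<omega> \<in> space M. F \<omega> = a} \<le> C * (\<epsilon> n)\<^sup>2" for n
      using prob_A order_trans by blast
    moreover have "(\<lambda>n. C * (\<epsilon> n)\<^sup>2) \<longlonglongrightarrow> C * 0\<^sup>2"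
      by (intro tendsto_intros \<epsilon>_lim)
    ultimately have "prob {\<omega> \<in> space M. F \<omega> = a} \<le> C * 0\<^sup>2"
      by (intro LIMSEQ_le_const) auto
    then have "prob {\<omega> \<in> space M. F \<omega> = a} = 0" by (simp add: measure_le_0_iff)
    then show ?thesis
      by (subst (asm) prob_eq_0) auto
  qed
  define g where "g n = expectation (\<lambda>\<omega>. (norm (G \<omega>))\<^sup>2 * indicator (A n) \<omega>)" for n
  have g_lim: "g \<longlonglongrightarrow> 0"
  proof -
    have "g \<longlonglongrightarrow> expectation (\<lambda>\<omega>. 0)"
      unfolding g_def
    proof (rule integral_dominated_convergence[where w = "\<lambda>\<omega>. (norm (G \<omega>))\<^sup>2"])
      show "AE \<omega> in M. (\<lambda>n. (norm (G \<omega>))\<^sup>2 * indicator (A n) \<omega>) \<longlonglongrightarrow> 0"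
        using no_atom
      proof eventually_elim
        case (elim \<omega>)
        then have "\<forall>\<^sub>F n in sequentially. \<epsilon> n < \<bar>F \<omega> - a\<bar>"
          by (intro order_tendstoD(2)[OF \<epsilon>_lim]) simp
        then have "\<forall>\<^sub>F n in sequentially. (norm (G \<omega>))\<^sup>2 * indicator (A n) \<omega> = 0"
          by eventually_elim (simp add: A_def)
        then show ?case by (rule tendsto_eventually)
      qed
      show "AE \<omega> in M. norm ((norm (G \<omega>))\<^sup>2 * indicator (A n) \<omega>) \<le> (norm (G \<omega>))\<^sup>2" for n
        by (auto simp: indicator_def)
    qed (use L2_D(2)[OF G] in auto)
    then show ?thesis by simp
  qed
  fix \<xi> h T \<theta>
  assume \<xi>: "(\<xi>, h) \<in> gaussian_span W" and h: "norm h = 1" and T: "(T :: real) \<ge> 0"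
  have [measurable]: "\<xi> \<in> borel_measurable M" by (rule gaussian_span_measurable[OF \<xi>])
  obtain s s' where s: "\<And>x. (s has_real_derivative s' x) (at x)" "continuous_on UNIV s'"
    and bnd: "\<And>x. \<bar>s x\<bar> \<le> T * exp (T\<^sup>2 / 2)" "\<And>x. \<bar>s' x\<bar> \<le> T\<^sup>2 * exp (T\<^sup>2 / 2)"
    and stein: "\<And>x. s' x - x * s x = exp (T\<^sup>2 / 2) * cos (T * x + \<theta>) - cos \<theta>"
    using stein_function[OF T, of \<theta>] by metis
  define S where "S = T * exp (T\<^sup>2 / 2)"
  have S: "S \<ge> 0" using T by (simp add: S_def)
  have "continuous_on UNIV s"
    using s(1) DERIV_isCont continuous_at_imp_continuous_on by blast
  then have [measurable]: "s \<in> borel_measurable borel" "s' \<in> borel_measurable borel"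
    using s(2) by (auto intro: borel_measurable_continuous_onI)
  define v where "v \<omega> = s (\<xi> \<omega>) *\<^sub>R h" for \<omega>
  define d where "d \<omega> = \<xi> \<omega> * s (\<xi> \<omega>) - s' (\<xi> \<omega>)" for \<omega>
  have v_norm: "norm (v \<omega>) \<le> S" for \<omega>
    using bnd(1) h by (simp add: v_def S_def)
  have [measurable]: "v \<in> borel_measurable M" "d \<in> borel_measurable M"
    unfolding v_def d_def by measurable
  have v: "v \<in> L2 M" by (rule L2_bounded[OF _ v_norm]) measurable
  have d: "d \<in> L2 M"
    unfolding d_def
  proof (rule L2_diff)
    show "(\<lambda>\<omega>. \<xi> \<omega> * s (\<xi> \<omega>)) \<in> L2 M"
      by (rule L2_mult_bound[OF gaussian_span_L2[OF \<xi>], where c = S])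
         (auto simp: abs_mult S_def mult.commute intro!: mult_left_mono bnd)
    show "(\<lambda>\<omega>. s' (\<xi> \<omega>)) \<in> L2 M"
      by (rule L2_bounded[of _ "T\<^sup>2 * exp (T\<^sup>2 / 2)"]) (simp_all add: bnd)
  qed
  have "expectation (\<lambda>\<omega>. inner (K \<omega>) (v \<omega>)) = expectation (\<lambda>\<omega>. H \<omega> * d \<omega>)"
    if "smooth_with_deriv W H K" for H K
    unfolding v_def d_def by (rule gaussian_integration_by_parts[OF \<xi> h s bnd that])
  from malliavin_sgn_duality[OF FG v d this]
  have dual: "expectation (\<lambda>\<omega>. (sgn (F \<omega> - (a - \<epsilon> n)) - sgn (F \<omega> - (a + \<epsilon> n))) * inner (G \<omega>) (v \<omega>))
    = expectation (\<lambda>\<omega>. (\<bar>F \<omega> - (a - \<epsilon> n)\<bar> - \<bar>F \<omega> - (a + \<epsilon> n)\<bar>) * d \<omega>)" (is "?L n = ?R n") for n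
    by blast
  have int_d: "integrable M d" by (rule L2_integrable[OF d])
  have R_lim: "(\<lambda>n. ?R n / (2 * \<epsilon> n)) \<longlonglongrightarrow> expectation (\<lambda>\<omega>. sgn (F \<omega> - a) * d \<omega>)"
  proof -
    let ?q = "\<lambda>n x. (\<bar>x - (a - \<epsilon> n)\<bar> - \<bar>x - (a + \<epsilon> n)\<bar>) / (2 * \<epsilon> n)"
    have "(\<lambda>n. expectation (\<lambda>\<omega>. ?q n (F \<omega>) * d \<omega>)) \<longlonglongrightarrow> expectation (\<lambda>\<omega>. sgn (F \<omega> - a) * d \<omega>)"
    proof (rule integral_dominated_convergence[where w = "\<lambda>\<omega>. \<bar>d \<omega>\<bar>"])
      have lim: "(\<lambda>n. ?q n x) \<longlonglongrightarrow> sgn (x - a)" if "x \<noteq> a" for x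
      proof -
        have "\<forall>\<^sub>F n in sequentially. \<epsilon> n < \<bar>x - a\<bar>"
          using that by (intro order_tendstoD(2)[OF \<epsilon>_lim]) simp
        then have "\<forall>\<^sub>F n in sequentially. ?q n x = sgn (x - a)"
        proof eventually_elim
          case (elim n)
          show ?case
          proof (cases "x > a")
            case True
            then have "\<bar>x - (a - \<epsilon> n)\<bar> - \<bar>x - (a + \<epsilon> n)\<bar> = 2 * \<epsilon> n" using elim \<epsilon>[of n] by linarith
            then show ?thesis using True \<epsilon>[of n] by simp
          next
            case False
            then have "\<bar>x - (a - \<epsilon> n)\<bar> - \<bar>x - (a + \<epsilon> n)\<bar> = - (2 * \<epsilon> n)" using elim \<epsilon>[of n] by linarith
            then show ?thesis using False that \<epsilon>[of n] by simp
          qed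
        qed
        then show ?thesis by (rule tendsto_eventually)
      qed
      show "AE \<omega> in M. (\<lambda>n. ?q n (F \<omega>) * d \<omega>) \<longlonglongrightarrow> sgn (F \<omega> - a) * d \<omega>"
        using no_atom by eventually_elim (intro tendsto_mult tendsto_const lim)
      have bd: "\<bar>?q n x\<bar> \<le> 1" for n x
      proof -
        have "\<bar>\<bar>x - (a - \<epsilon> n)\<bar> - \<bar>x - (a + \<epsilon> n)\<bar>\<bar> \<le> 2 * \<epsilon> n" using \<epsilon>[of n] by linarith
        then show ?thesis using \<epsilon>[of n] by (simp add: abs_divide)
      qed
      show "AE \<omega> in M. norm (?q n (F \<omega>) * d \<omega>) \<le> \<bar>d \<omega>\<bar>" for n
        unfolding real_norm_def abs_mult
        by (intro AE_I2 mult_left_le_one_le[OF abs_ge_zero abs_ge_zero bd])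
    qed (use int_d in auto)
    then show ?thesis by simp
  qed
  have "(\<lambda>n. ?L n / (2 * \<epsilon> n)) \<longlonglongrightarrow> 0"
  proof (rule Lim_null_comparison)
    show "\<forall>\<^sub>F n in sequentially. norm (?L n / (2 * \<epsilon> n)) \<le> S * (sqrt C * sqrt (g n))"
    proof (intro always_eventually allI)
      fix n
      have ind: "(\<lambda>\<omega>. indicator (A n) \<omega> :: real) \<in> L2 M"
        by (rule L2_bounded[of _ 1]) (auto simp: indicator_def)
      have GI: "(\<lambda>\<omega>. norm (G \<omega>) * indicator (A n) \<omega>) \<in> L2 M"
        by (rule L2_mult_bound[OF G, where c = 1]) (auto simp: indicator_def)
      have int_prod: "integrable M (\<lambda>\<omega>. indicator (A n) \<omega> * (norm (G \<omega>) * indicator (A n) \<omega>))"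
        by (rule L2_integrable_mult[OF ind GI])
      have pt: "\<bar>(sgn (F \<omega> - (a - \<epsilon> n)) - sgn (F \<omega> - (a + \<epsilon> n))) * inner (G \<omega>) (v \<omega>)\<bar>
          \<le> 2 * S * \<bar>indicator (A n) \<omega> * (norm (G \<omega>) * indicator (A n) \<omega>)\<bar>" if "\<omega> \<in> space M" for \<omega>
      proof (cases "\<omega> \<in> A n")
        case True
        have "\<bar>sgn (F \<omega> - (a - \<epsilon> n)) - sgn (F \<omega> - (a + \<epsilon> n))\<bar> \<le> 2" by (auto simp: sgn_if)
        moreover have "\<bar>inner (G \<omega>) (v \<omega>)\<bar> \<le> norm (G \<omega>) * S"
          by (rule order_trans[OF Cauchy_Schwarz_ineq2 mult_left_mono[OF v_norm]]) simp
        ultimately have "\<bar>sgn (F \<omega> - (a - \<epsilon> n)) - sgn (F \<omega> - (a + \<epsilon> n))\<bar> * \<bar>inner (G \<omega>) (v \<omega>)\<bar> \<le> 2 * (norm (G \<omega>) * S)"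
          by (intro mult_mono) auto
        then show ?thesis using True by (simp add: abs_mult mult_ac)
      next
        case False
        then have "sgn (F \<omega> - (a - \<epsilon> n)) = sgn (F \<omega> - (a + \<epsilon> n))"
          using that \<epsilon>[of n] by (auto simp: A_def sgn_if)
        then show ?thesis using False by simp
      qed
      have "\<bar>?L n\<bar> \<le> expectation (\<lambda>\<omega>. \<bar>(sgn (F \<omega> - (a - \<epsilon> n)) - sgn (F \<omega> - (a + \<epsilon> n))) * inner (G \<omega>) (v \<omega>)\<bar>)"
        by (rule integral_abs_bound)
      also have "\<dots> \<le> expectation (\<lambda>\<omega>. 2 * S * \<bar>indicator (A n) \<omega> * (norm (G \<omega>) * indicator (A n) \<omega>)\<bar>)"
      proof (rule integral_mono[OF integrable_abs _ pt])
        have int2: "integrable M (\<lambda>\<omega>. 2 * S * \<bar>indicator (A n) \<omega> * (norm (G \<omega>) * indicator (A n) \<omega>)\<bar>)"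
          by (intro integrable_mult_right integrable_abs int_prod)
        then show "integrable M (\<lambda>\<omega>. 2 * S * \<bar>indicator (A n) \<omega> * (norm (G \<omega>) * indicator (A n) \<omega>)\<bar>)" .
        show "integrable M (\<lambda>\<omega>. (sgn (F \<omega> - (a - \<epsilon> n)) - sgn (F \<omega> - (a + \<epsilon> n))) * inner (G \<omega>) (v \<omega>))"
        proof (rule Bochner_Integration.integrable_bound[OF int2])
          show "AE \<omega> in M. norm ((sgn (F \<omega> - (a - \<epsilon> n)) - sgn (F \<omega> - (a + \<epsilon> n))) * inner (G \<omega>) (v \<omega>))
              \<le> norm (2 * S * \<bar>indicator (A n) \<omega> * (norm (G \<omega>) * indicator (A n) \<omega>)\<bar>)"
            unfolding real_norm_def by (intro AE_I2 order_trans[OF pt abs_ge_self])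
        qed measurable
      qed
      also have "\<dots> = 2 * S * expectation (\<lambda>\<omega>. \<bar>indicator (A n) \<omega> * (norm (G \<omega>) * indicator (A n) \<omega>)\<bar>)"
        by simp
      also have "\<dots> \<le> 2 * S * (sqrt (expectation (\<lambda>\<omega>. (indicator (A n) \<omega>)\<^sup>2))
          * sqrt (expectation (\<lambda>\<omega>. (norm (G \<omega>) * indicator (A n) \<omega>)\<^sup>2)))"
        using S by (intro mult_left_mono L2_Cauchy_Schwarz(2)[OF ind GI]) auto
      also have "expectation (\<lambda>\<omega>. (indicator (A n) \<omega> :: real)\<^sup>2) = prob (A n)"
      proof -
        have "expectation (\<lambda>\<omega>. (indicator (A n) \<omega> :: real)\<^sup>2) = expectation (indicator (A n))"
          by (intro Bochner_Integration.integral_cong) (auto simp: indicator_def)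
        then show ?thesis by simp
      qed
      also have "expectation (\<lambda>\<omega>. (norm (G \<omega>) * indicator (A n) \<omega>)\<^sup>2) = g n"
        unfolding g_def by (intro Bochner_Integration.integral_cong) (auto simp: indicator_def)
      also have "2 * S * (sqrt (prob (A n)) * sqrt (g n)) \<le> 2 * S * (sqrt (C * (\<epsilon> n)\<^sup>2) * sqrt (g n))"
        using S prob_A[of n] by (intro mult_left_mono mult_right_mono real_sqrt_le_mono) (auto simp: g_def)
      also have "sqrt (C * (\<epsilon> n)\<^sup>2) = sqrt C * \<epsilon> n"
        using \<epsilon>[of n] by (simp add: real_sqrt_mult)
      finally show "norm (?L n / (2 * \<epsilon> n)) \<le> S * (sqrt C * sqrt (g n))"
        using \<epsilon>[of n] by (simp add: abs_divide divide_le_eq mult_ac)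
    qed
    have "(\<lambda>n. S * (sqrt C * sqrt (g n))) \<longlonglongrightarrow> S * (sqrt C * sqrt 0)"
      by (intro tendsto_intros g_lim)
    then show "(\<lambda>n. S * (sqrt C * sqrt (g n))) \<longlonglongrightarrow> 0" by simp
  qed
  with R_lim have "expectation (\<lambda>\<omega>. sgn (F \<omega> - a) * d \<omega>) = 0"
    unfolding dual by (rule LIMSEQ_unique)
  moreover have "exp (T\<^sup>2 / 2) * cos (T * \<xi> \<omega> + \<theta>) - cos \<theta> = - d \<omega>" for \<omega>
    using stein[of "\<xi> \<omega>"] by (simp add: d_def)
  ultimately show "expectation (\<lambda>\<omega>. sgn (F \<omega> - a) * (exp (T\<^sup>2 / 2) * cos (T * \<xi> \<omega> + \<theta>) - cos \<theta>)) = 0"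
    by simp
qed

end

section \<open>The density\<close>

context prob_space
begin

text \<open>
On the left-hand side of \<open>dual\<close> stands, apart from atoms, twice the probability of \<open>{a<..b}\<close>; the
right-hand side is Lipschitz in \<open>b\<close> and differentiable, with derivative \<open>E[sgn (F - b) d]\<close>.
\<close>
lemma sgn_duality_density:
  fixes F d :: "'a \<Rightarrow> real"
  assumes F: "F \<in> L2 M" and d: "d \<in> L2 M"
    and dual: "\<And>a b. expectation (\<lambda>\<omega>. sgn (F \<omega> - a) - sgn (F \<omega> - b))
      = expectation (\<lambda>\<omega>. (\<bar>F \<omega> - a\<bar> - \<bar>F \<omega> - b\<bar>) * d \<omega>)"
  obtains \<rho> where "continuous_on UNIV \<rho>" "\<And>x. \<rho> x \<ge> 0"
    "distributed M lborel F (\<lambda>x. ennreal (\<rho> x))"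
    "\<And>x y. x \<le> y \<Longrightarrow> \<rho> x - \<rho> y = expectation (\<lambda>\<omega>. d \<omega> * indicator {x<..y} (F \<omega>))"
proof -
  note [measurable] = L2_D(1)[OF F] L2_D(1)[OF d]
  have int_d: "integrable M d" by (rule L2_integrable[OF d])
  have sgn_int: "integrable M (\<lambda>\<omega>. sgn (F \<omega> - a))" for a
    by (rule integrable_const_bound[of _ 1]) (auto simp: sgn_if)
  have sgn_d: "integrable M (\<lambda>\<omega>. sgn (F \<omega> - a) * d \<omega>)" for a
    by (rule Bochner_Integration.integrable_bound[OF int_d]) (auto simp: sgn_if abs_mult)
  have "(\<lambda>\<omega>. F \<omega> - a) \<in> L2 M" for a
    by (intro L2_diff F L2_bounded[of _ "\<bar>a\<bar>"]) auto
  then have abs_d: "integrable M (\<lambda>\<omega>. \<bar>F \<omega> - a\<bar> * d \<omega>)" for a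
    using L2_integrable_mult[OF L2_norm d] by fastforce
  define \<rho> where "\<rho> x = expectation (\<lambda>\<omega>. sgn (F \<omega> - x) * d \<omega>) / 2" for x
  define \<Gamma> where "\<Gamma> x = - expectation (\<lambda>\<omega>. \<bar>F \<omega> - x\<bar> * d \<omega>) / 2" for x
  have no_atom: "AE \<omega> in M. F \<omega> \<noteq> a" for a
  proof -
    have "prob {\<omega> \<in> space M. F \<omega> = a} \<le> \<epsilon> * expectation (\<lambda>\<omega>. \<bar>d \<omega>\<bar>)" if \<epsilon>: "\<epsilon> > 0" for \<epsilon>
    proof -
      have "prob {\<omega> \<in> space M. F \<omega> = a} = expectation (indicator {\<omega> \<in> space M. F \<omega> = a})" by simp
      also have "\<dots> \<le> expectation (\<lambda>\<omega>. sgn (F \<omega> - a) - sgn (F \<omega> - (a + \<epsilon>)))"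
        using \<epsilon> by (intro integral_mono Bochner_Integration.integrable_diff sgn_int)
          (auto simp: indicator_def sgn_if less_top[symmetric])
      also have "\<dots> = expectation (\<lambda>\<omega>. (\<bar>F \<omega> - a\<bar> - \<bar>F \<omega> - (a + \<epsilon>)\<bar>) * d \<omega>)" by (rule dual)
      also have "\<dots> \<le> expectation (\<lambda>\<omega>. \<epsilon> * \<bar>d \<omega>\<bar>)"
      proof (rule integral_mono)
        show "integrable M (\<lambda>\<omega>. (\<bar>F \<omega> - a\<bar> - \<bar>F \<omega> - (a + \<epsilon>)\<bar>) * d \<omega>)"
          using abs_d[of a] abs_d[of "a + \<epsilon>"] by (simp add: left_diff_distrib)
        show "integrable M (\<lambda>\<omega>. \<epsilon> * \<bar>d \<omega>\<bar>)" using int_d by simp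
        fix \<omega>
        have "\<bar>\<bar>F \<omega> - a\<bar> - \<bar>F \<omega> - (a + \<epsilon>)\<bar>\<bar> * \<bar>d \<omega>\<bar> \<le> \<epsilon> * \<bar>d \<omega>\<bar>"
          using \<epsilon> by (intro mult_right_mono) auto
        then show "(\<bar>F \<omega> - a\<bar> - \<bar>F \<omega> - (a + \<epsilon>)\<bar>) * d \<omega> \<le> \<epsilon> * \<bar>d \<omega>\<bar>"
          unfolding abs_mult[symmetric] by linarith
      qed
      finally show ?thesis by simp
    qed
    then have le: "prob {\<omega> \<in> space M. F \<omega> = a} \<le> inverse (real (Suc n)) * expectation (\<lambda>\<omega>. \<bar>d \<omega>\<bar>)" for n
      by simp
    have "(\<lambda>n. inverse (real (Suc n)) * expectation (\<lambda>\<omega>. \<bar>d \<omega>\<bar>)) \<longlonglongrightarrow> 0 * expectation (\<lambda>\<omega>. \<bar>d \<omega>\<bar>)"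
      by (intro tendsto_intros LIMSEQ_inverse_real_of_nat)
    from LIMSEQ_le_const[OF this] le have "prob {\<omega> \<in> space M. F \<omega> = a} \<le> 0" by auto
    then have "prob {\<omega> \<in> space M. F \<omega> = a} = 0" by (simp add: measure_le_0_iff)
    then show ?thesis by (subst (asm) prob_eq_0) auto
  qed
  have sgn_diff: "AE \<omega> in M. sgn (F \<omega> - a) - sgn (F \<omega> - b) = 2 * indicator {a<..b} (F \<omega>)"
    if "a \<le> b" for a b
    using no_atom[of a] no_atom[of b] by eventually_elim (use that in \<open>auto simp: sgn_if indicator_def\<close>)
  have cdf: "prob (F -` {a<..b} \<inter> space M) = \<Gamma> b - \<Gamma> a" if "a \<le> b" for a b
  proof -
    have "expectation (\<lambda>\<omega>. sgn (F \<omega> - a) - sgn (F \<omega> - b)) = expectation (\<lambda>\<omega>. 2 * indicator (F -` {a<..b} \<inter> space M) \<omega>)"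
    proof (rule integral_cong_AE)
      show "AE \<omega> in M. sgn (F \<omega> - a) - sgn (F \<omega> - b) = 2 * indicator (F -` {a<..b} \<inter> space M) \<omega>"
        using sgn_diff[OF that] AE_space by eventually_elim (simp add: indicator_def)
    qed measurable
    then have "2 * prob (F -` {a<..b} \<inter> space M) = expectation (\<lambda>\<omega>. (\<bar>F \<omega> - a\<bar> - \<bar>F \<omega> - b\<bar>) * d \<omega>)"
      by (simp add: dual)
    also have "\<dots> = 2 * (\<Gamma> b - \<Gamma> a)"
      using abs_d by (simp add: \<Gamma>_def left_diff_distrib)
    finally show ?thesis by simp
  qed
  have sgn_cont: "((\<lambda>y. sgn (x - y)) \<longlongrightarrow> sgn (x - a)) (at a)" if "x \<noteq> a" for x a :: real
    by (intro tendsto_sgn tendsto_intros) (use that in auto)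
  have "isCont \<rho> a" for a
    unfolding isCont_def tendsto_at_iff_sequentially comp_def
  proof (intro allI impI)
    fix X :: "nat \<Rightarrow> real" assume X: "\<forall>i. X i \<in> UNIV - {a}" "X \<longlonglongrightarrow> a"
    have "(\<lambda>n. expectation (\<lambda>\<omega>. sgn (F \<omega> - X n) * d \<omega>)) \<longlonglongrightarrow> expectation (\<lambda>\<omega>. sgn (F \<omega> - a) * d \<omega>)"
    proof (rule integral_dominated_convergence[where w = "\<lambda>\<omega>. \<bar>d \<omega>\<bar>"])
      have "(\<lambda>n. sgn (x - X n)) \<longlonglongrightarrow> sgn (x - a)" if "x \<noteq> a" for x
        by (intro tendsto_sgn tendsto_intros X) (use that in auto)
      then show "AE \<omega> in M. (\<lambda>n. sgn (F \<omega> - X n) * d \<omega>) \<longlonglongrightarrow> sgn (F \<omega> - a) * d \<omega>"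
        using no_atom[of a] by (auto elim!: eventually_mono intro!: tendsto_mult)
      show "AE \<omega> in M. norm (sgn (F \<omega> - X n) * d \<omega>) \<le> \<bar>d \<omega>\<bar>" for n
        by (auto simp: abs_mult sgn_if)
    qed (use int_d in auto)
    then show "(\<lambda>n. \<rho> (X n)) \<longlonglongrightarrow> \<rho> a"
      unfolding \<rho>_def by (intro tendsto_intros) auto
  qed
  then have cont: "continuous_on UNIV \<rho>"
    by (simp add: continuous_on_eq_continuous_at)
  have deriv: "(\<Gamma> has_real_derivative \<rho> a) (at a)" for a
    unfolding has_field_derivative_iff tendsto_at_iff_sequentially comp_def
  proof (intro allI impI)
    fix X :: "nat \<Rightarrow> real" assume X: "\<forall>i. X i \<in> UNIV - {a}" "X \<longlonglongrightarrow> a"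
    let ?q = "\<lambda>n x. (\<bar>x - a\<bar> - \<bar>x - X n\<bar>) / (X n - a)"
    have "(\<lambda>n. expectation (\<lambda>\<omega>. ?q n (F \<omega>) * d \<omega>)) \<longlonglongrightarrow> expectation (\<lambda>\<omega>. sgn (F \<omega> - a) * d \<omega>)"
    proof (rule integral_dominated_convergence[where w = "\<lambda>\<omega>. \<bar>d \<omega>\<bar>"])
      have lim: "(\<lambda>n. ?q n x) \<longlonglongrightarrow> sgn (x - a)" if "x \<noteq> a" for x
      proof -
        have "(\<lambda>n. \<bar>X n - a\<bar>) \<longlonglongrightarrow> \<bar>a - a\<bar>" by (intro tendsto_intros X)
        then have "\<forall>\<^sub>F n in sequentially. \<bar>X n - a\<bar> < \<bar>x - a\<bar>"
          using that by (intro order_tendstoD(2)) auto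
        then have "\<forall>\<^sub>F n in sequentially. ?q n x = sgn (x - a)"
        proof eventually_elim
          case (elim n)
          have ne: "X n - a \<noteq> 0" using X(1) by auto
          show ?case
          proof (cases "x > a")
            case True
            then have "\<bar>x - a\<bar> - \<bar>x - X n\<bar> = X n - a" using elim by linarith
            then show ?thesis using True ne by simp
          next
            case False
            then have "\<bar>x - a\<bar> - \<bar>x - X n\<bar> = - (X n - a)" using elim that by linarith
            then have "?q n x = - 1" using ne by (simp only: minus_divide_left[symmetric] divide_self if_True simp_thms)
            then show ?thesis using False that by simp
          qed
        qed
        then show ?thesis by (rule tendsto_eventually)
      qed
      show "AE \<omega> in M. (\<lambda>n. ?q n (F \<omega>) * d \<omega>) \<longlonglongrightarrow> sgn (F \<omega> - a) * d \<omega>"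
        using no_atom[of a] by eventually_elim (intro tendsto_mult tendsto_const lim)
      have bd: "\<bar>?q n x\<bar> \<le> 1" for n x
        using X(1) by (simp add: abs_divide divide_le_eq_1)
      show "AE \<omega> in M. norm (?q n (F \<omega>) * d \<omega>) \<le> \<bar>d \<omega>\<bar>" for n
        unfolding real_norm_def abs_mult
        by (intro AE_I2 mult_left_le_one_le[OF abs_ge_zero abs_ge_zero bd])
    qed (use int_d in auto)
    then have "(\<lambda>n. expectation (\<lambda>\<omega>. ?q n (F \<omega>) * d \<omega>) / 2) \<longlonglongrightarrow> \<rho> a"
      unfolding \<rho>_def by (intro tendsto_intros) auto
    moreover have "(\<Gamma> (X n) - \<Gamma> a) / (X n - a) = expectation (\<lambda>\<omega>. ?q n (F \<omega>) * d \<omega>) / 2" for n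
    proof -
      have "expectation (\<lambda>\<omega>. ?q n (F \<omega>) * d \<omega>)
          = expectation (\<lambda>\<omega>. (\<bar>F \<omega> - a\<bar> * d \<omega> - \<bar>F \<omega> - X n\<bar> * d \<omega>) / (X n - a))"
        by (intro Bochner_Integration.integral_cong refl) (simp add: left_diff_distrib)
      also have "\<dots> = (expectation (\<lambda>\<omega>. \<bar>F \<omega> - a\<bar> * d \<omega>) - expectation (\<lambda>\<omega>. \<bar>F \<omega> - X n\<bar> * d \<omega>)) / (X n - a)"
        using abs_d by simp
      also have "expectation (\<lambda>\<omega>. \<bar>F \<omega> - a\<bar> * d \<omega>) - expectation (\<lambda>\<omega>. \<bar>F \<omega> - X n\<bar> * d \<omega>)
          = 2 * (\<Gamma> (X n) - \<Gamma> a)"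
        by (simp add: \<Gamma>_def)
      finally have E: "expectation (\<lambda>\<omega>. ?q n (F \<omega>) * d \<omega>) = 2 * (\<Gamma> (X n) - \<Gamma> a) / (X n - a)" .
      have half: "2 * y / c / 2 = y / c" for y c :: real by simp
      show ?thesis unfolding E by (rule half[symmetric])
    qed
    ultimately show "(\<lambda>n. (\<Gamma> (X n) - \<Gamma> a) / (X n - a)) \<longlonglongrightarrow> \<rho> a" by simp
  qed
  have mono: "\<Gamma> a \<le> \<Gamma> b" if "a \<le> b" for a b
    using cdf[OF that] measure_nonneg[of M "F -` {a<..b} \<inter> space M"] by linarith
  have nonneg: "\<rho> x \<ge> 0" for x
    using mono by (intro mono_on_imp_deriv_nonneg[where A = UNIV, OF _ deriv]) (auto simp: mono_on_def)
  have [measurable]: "\<rho> \<in> borel_measurable borel"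
    using cont by (rule borel_measurable_continuous_onI)
  have Ioc: "emeasure (distr M borel F) {a<..b} = emeasure (density lborel (\<lambda>x. ennreal (\<rho> x))) {a<..b}"
    if "a \<le> b" for a b
  proof -
    have "emeasure (density lborel (\<lambda>x. ennreal (\<rho> x))) {a<..b} = (\<integral>\<^sup>+x. ennreal (\<rho> x) * indicator {a<..b} x \<partial>lborel)"
      by (rule emeasure_density) auto
    also have "\<dots> = (\<integral>\<^sup>+x. ennreal (\<rho> x) * indicator {a..b} x \<partial>lborel)"
      by (rule nn_integral_cong_AE) (use AE_lborel_singleton[of a] in \<open>eventually_elim, auto simp: indicator_def\<close>)
    also have "\<dots> = ennreal (\<Gamma> b - \<Gamma> a)"
      using that by (intro nn_integral_FTC_Icc) (auto intro: deriv nonneg has_field_derivative_at_within)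
    also have "\<dots> = emeasure (distr M borel F) {a<..b}"
      by (simp add: emeasure_distr emeasure_eq_measure cdf[OF that])
    finally show ?thesis ..
  qed
  have "distr M borel F = density lborel (\<lambda>x. ennreal (\<rho> x))"
  proof (rule measure_eqI_lessThan)
    interpret D: prob_space "distr M borel F" by (rule prob_space_distr) simp
    show "emeasure (distr M borel F) {x<..} < \<infinity>" for x
      by (simp add: D.emeasure_eq_measure)
    fix x :: real
    have U: "{x<..} = (\<Union>n. {x<..x + real n})"
    proof (intro equalityI subsetI)
      fix y assume "y \<in> {x<..}"
      moreover obtain n where "y - x \<le> real n" using real_arch_simple by blast
      ultimately show "y \<in> (\<Union>n. {x<..x + real n})" by (auto intro!: exI[of _ n])
    qed auto
    have inc: "incseq (\<lambda>n. {x<..x + real n})" by (auto simp: incseq_def)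
    have sup: "emeasure N {x<..} = (SUP n. emeasure N {x<..x + real n})" if N: "sets N = sets borel" for N
    proof -
      have "range (\<lambda>n. {x<..x + real n}) \<subseteq> sets N" unfolding N by auto
      from SUP_emeasure_incseq[OF this inc] show ?thesis unfolding U by (rule sym)
    qed
    have "(\<lambda>n. emeasure (distr M borel F) {x<..x + real n})
        = (\<lambda>n. emeasure (density lborel (\<lambda>x. ennreal (\<rho> x))) {x<..x + real n})"
      by (intro ext Ioc) simp
    then show "emeasure (distr M borel F) {x<..} = emeasure (density lborel (\<lambda>x. ennreal (\<rho> x))) {x<..}"
      by (simp only: sup[of "distr M borel F"] sup[of "density lborel (\<lambda>x. ennreal (\<rho> x))"] sets_distr sets_density sets_lborel)
  qed simp_all
  then have "distributed M lborel F (\<lambda>x. ennreal (\<rho> x))"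
    unfolding distributed_def by (simp cong: distr_cong)
  moreover have "\<rho> x - \<rho> y = expectation (\<lambda>\<omega>. d \<omega> * indicator {x<..y} (F \<omega>))" if "x \<le> y" for x y
  proof -
    have "\<rho> x - \<rho> y = expectation (\<lambda>\<omega>. (sgn (F \<omega> - x) - sgn (F \<omega> - y)) * d \<omega>) / 2"
      using sgn_d by (simp add: \<rho>_def left_diff_distrib diff_divide_distrib)
    also have "expectation (\<lambda>\<omega>. (sgn (F \<omega> - x) - sgn (F \<omega> - y)) * d \<omega>)
        = expectation (\<lambda>\<omega>. 2 * (d \<omega> * indicator {x<..y} (F \<omega>)))"
      by (rule integral_cong_AE) (use sgn_diff[OF that] in auto)
    finally show ?thesis by simp
  qed
  ultimately show thesis using cont nonneg that by blast
qed

end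

section \<open>Integrating the logarithmic derivative\<close>

text \<open>
The mean value theorem for the logarithm, for two points in either order.
\<close>
lemma ln_diff_eq_divide:
  fixes u v :: real
  assumes "u > 0" "v > 0"
  obtains c where "c \<in> closed_segment u v" "ln u - ln v = (u - v) / c"
proof -
  have *: "\<exists>c. u < c \<and> c < v \<and> ln v - ln u = (v - u) / c" if "0 < u" "u < v" for u v :: real
  proof -
    have "\<exists>c>u. c < v \<and> ln v - ln u = (v - u) * inverse c"
      using that by (intro MVT2) (auto intro!: DERIV_ln)
    then show ?thesis by (auto simp: divide_inverse)
  qed
  consider "u < v" | "u = v" | "v < u" by linarith
  then show thesis
  proof cases
    case 1
    then obtain c where "u < c" "c < v" "ln v - ln u = (v - u) / c" using * assms by blast
    moreover from this have "ln u - ln v = (u - v) / c" by (simp add: diff_divide_distrib)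
    ultimately show thesis by (intro that[of c]) (auto simp: closed_segment_eq_real_ivl)
  next
    case 2
    then show thesis by (intro that[of u]) auto
  next
    case 3
    then obtain c where "v < c" "c < u" "ln u - ln v = (u - v) / c" using * assms by blast
    then show thesis by (intro that[of c]) (auto simp: closed_segment_eq_real_ivl)
  qed
qed

text \<open>
Here \<open>\<rho>\<close> is only absolutely continuous and \<open>w\<close> only measurable, so the fundamental theorem of
calculus for the logarithm of \<open>\<rho>\<close> is not available pointwise. On a short interval \<open>1 / \<rho>\<close> is nearly
constant, so by the mean value theorem the increment of \<open>ln \<rho>\<close> differs from the integral of \<open>w\<close> by at
most \<open>\<epsilon> \<integral> \<bar>w \<rho>\<bar>\<close>. Both sides of this estimate are additive over adjacent intervals, and Bolzano's
bisection principle extends it to the whole interval.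
\<close>
lemma ln_integral_of_log_derivative:
  fixes \<rho> w :: "real \<Rightarrow> real"
  assumes ab: "a \<le> b" and cont: "continuous_on {a..b} \<rho>" and pos: "\<And>x. x \<in> {a..b} \<Longrightarrow> \<rho> x > 0"
    and [measurable]: "w \<in> borel_measurable borel" "\<rho> \<in> borel_measurable borel"
    and g: "integrable lborel (\<lambda>z. w z * \<rho> z)"
    and diff: "\<And>x y. x \<le> y \<Longrightarrow> \<rho> x - \<rho> y = (LBINT z:{x<..y}. w z * \<rho> z)"
  shows "set_integrable lborel {a..b} w" "(LBINT z:{a<..b}. w z) = ln (\<rho> a) - ln (\<rho> b)"
proof -
  define g where "g z = w z * \<rho> z" for z
  have [measurable]: "g \<in> borel_measurable borel" unfolding g_def by measurable
  have int_g: "set_integrable lborel A g" if "A \<in> sets borel" for A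
    using integrable_mult_indicator[of A lborel g] g that by (simp add: set_integrable_def g_def[abs_def])
  obtain m where m: "m > 0" "\<And>x. x \<in> {a..b} \<Longrightarrow> m \<le> \<rho> x"
  proof -
    obtain x where "x \<in> {a..b}" "\<forall>y\<in>{a..b}. \<rho> x \<le> \<rho> y"
      using continuous_attains_inf[OF compact_Icc _ cont] ab by auto
    then show thesis using that pos by blast
  qed
  show int_w: "set_integrable lborel {a..b} w"
    unfolding set_integrable_def
  proof (rule Bochner_Integration.integrable_bound)
    show "integrable lborel (\<lambda>x. (1 / m) * (indicator {a..b} x *\<^sub>R g x))"
      using int_g[of "{a..b}"] by (intro integrable_mult_right) (simp add: set_integrable_def)
    show "AE x in lborel. norm (indicator {a..b} x *\<^sub>R w x) \<le> norm ((1 / m) * (indicator {a..b} x *\<^sub>R g x))"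
    proof (intro AE_I2)
      fix x :: real
      show "norm (indicator {a..b} x *\<^sub>R w x) \<le> norm ((1 / m) * (indicator {a..b} x *\<^sub>R g x))"
      proof (cases "x \<in> {a..b}")
        case True
        have "\<bar>w x\<bar> * m \<le> \<bar>w x\<bar> * \<bar>\<rho> x\<bar>"
          using m(2)[OF True] by (intro mult_left_mono) auto
        then show ?thesis using True m(1) by (simp add: g_def abs_mult pos_le_divide_eq)
      qed simp
    qed
  qed measurable
  define I where "I f x y = (LBINT z:{x<..y}. f z)" for f :: "real \<Rightarrow> real" and x y
  have split: "I f x z = I f x y + I f y z"
    if "x \<le> y" "y \<le> z" "set_integrable lborel {x<..z} f" for f x y z
  proof -
    have "{x<..z} = {x<..y} \<union> {y<..z}" using that by auto
    moreover have "set_integrable lborel {x<..y} f" "set_integrable lborel {y<..z} f"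
      using that by (auto intro: set_integrable_subset)
    ultimately show ?thesis
      unfolding I_def by (simp add: set_integral_Un)
  qed
  have wsub: "set_integrable lborel {x<..y} w" if "a \<le> x" "y \<le> b" for x y
    using that by (intro set_integrable_subset[OF int_w]) auto
  have gabs: "set_integrable lborel A (\<lambda>z. \<bar>g z\<bar>)" if "A \<in> sets borel" for A
    using set_integrable_abs[OF int_g[OF that]] .
  have approx: "\<bar>ln (\<rho> a) - ln (\<rho> b) - I w a b\<bar> \<le> \<epsilon> * I (\<lambda>z. \<bar>g z\<bar>) a b" if \<epsilon>: "\<epsilon> > 0" for \<epsilon>
  proof -
    let ?P = "\<lambda>x y. a \<le> x \<longrightarrow> y \<le> b \<longrightarrow> \<bar>ln (\<rho> x) - ln (\<rho> y) - I w x y\<bar> \<le> \<epsilon> * I (\<lambda>z. \<bar>g z\<bar>) x y"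
    have "?P a b"
    proof (rule Bolzano[OF ab, of ?P])
      fix x y z assume trans: "?P x y" "?P y z" "x \<le> y" "y \<le> z"
      show "?P x z"
      proof (intro impI)
        assume xz: "a \<le> x" "z \<le> b"
        have "I w x z = I w x y + I w y z"
          by (rule split) (use trans xz wsub in auto)
        moreover have "I (\<lambda>z. \<bar>g z\<bar>) x z = I (\<lambda>z. \<bar>g z\<bar>) x y + I (\<lambda>z. \<bar>g z\<bar>) y z"
          by (rule split) (use trans gabs in auto)
        ultimately show "\<bar>ln (\<rho> x) - ln (\<rho> z) - I w x z\<bar> \<le> \<epsilon> * I (\<lambda>z. \<bar>g z\<bar>) x z"
          using trans xz by (simp add: distrib_left)
      qed
    next
      fix x0 assume local: "a \<le> x0" "x0 \<le> b"
      have "continuous_on {a..b} (\<lambda>x. 1 / \<rho> x)"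
        using pos by (intro continuous_intros cont) force
      then obtain \<delta> where \<delta>: "\<delta> > 0"
        "\<And>z. z \<in> {a..b} \<Longrightarrow> \<bar>z - x0\<bar> < \<delta> \<Longrightarrow> \<bar>1 / \<rho> z - 1 / \<rho> x0\<bar> < \<epsilon> / 2"
        using local \<epsilon> unfolding continuous_on_iff dist_real_def
        by (metis atLeastAtMost_iff half_gt_zero)
      show "\<exists>d>0. \<forall>x y. x \<le> x0 \<and> x0 \<le> y \<and> y - x < d \<longrightarrow> ?P x y"
      proof (intro exI[of _ \<delta>] conjI allI impI)
        show "\<delta> > 0" by fact
        fix x y assume xy: "x \<le> x0 \<and> x0 \<le> y \<and> y - x < \<delta>" and ax: "a \<le> x" and yb: "y \<le> b"
        then have le: "x \<le> y" by linarith
        have sub: "{x..y} \<subseteq> {a..b}" using ax yb by auto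
        have close: "\<bar>1 / \<rho> z - 1 / \<rho> z'\<bar> \<le> \<epsilon>" if "z \<in> {x..y}" "z' \<in> {x..y}" for z z'
        proof -
          have "z \<in> {a..b}" "z' \<in> {a..b}" "\<bar>z - x0\<bar> < \<delta>" "\<bar>z' - x0\<bar> < \<delta>"
            using that xy sub by auto
          with \<delta>(2)[of z] \<delta>(2)[of z'] show ?thesis by linarith
        qed
        have "x \<in> {a..b}" "y \<in> {a..b}" using ax yb le by auto
        then obtain u where u: "u \<in> closed_segment (\<rho> x) (\<rho> y)" "ln (\<rho> x) - ln (\<rho> y) = (\<rho> x - \<rho> y) / u"
          using ln_diff_eq_divide[OF pos pos] by blast
        have "connected (\<rho> ` {x..y})"
          by (intro connected_continuous_image continuous_on_subset[OF cont sub]) simp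
        then have "closed_segment (\<rho> x) (\<rho> y) \<subseteq> \<rho> ` {x..y}"
          using le by (intro closed_segment_subset) (auto simp: connected_convex_1)
        with u(1) have "u \<in> \<rho> ` {x..y}" by blast
        then obtain c where c: "c \<in> {x..y}" "u = \<rho> c" by blast
        show "\<bar>ln (\<rho> x) - ln (\<rho> y) - I w x y\<bar> \<le> \<epsilon> * I (\<lambda>z. \<bar>g z\<bar>) x y"
        proof -
          have "ln (\<rho> x) - ln (\<rho> y) - I w x y = (LBINT z:{x<..y}. (1 / \<rho> c) * g z) - (LBINT z:{x<..y}. w z)"
            using diff[OF le] by (simp add: u(2) c(2) I_def g_def[abs_def])
          also have "\<dots> = (LBINT z:{x<..y}. (1 / \<rho> c) * g z - w z)"
            using int_g wsub[OF ax yb] by (intro set_integral_diff(2)[symmetric]) auto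
          also have "\<bar>\<dots>\<bar> \<le> (LBINT z:{x<..y}. \<epsilon> * \<bar>g z\<bar>)"
            unfolding set_lebesgue_integral_def
          proof (rule order_trans[OF integral_abs_bound integral_mono])
            show "integrable lborel (\<lambda>z. \<bar>indicator {x<..y} z *\<^sub>R (1 / \<rho> c * g z - w z)\<bar>)"
              using set_integral_diff(1)[of lborel "{x<..y}" "\<lambda>z. 1 / \<rho> c * g z" w] int_g wsub[OF ax yb]
              by (intro integrable_abs) (simp add: set_integrable_def)
            show "integrable lborel (\<lambda>z. indicator {x<..y} z *\<^sub>R (\<epsilon> * \<bar>g z\<bar>))"
              using gabs[of "{x<..y}"] by (simp add: set_integrable_def mult.left_commute)
            fix z :: real
            show "\<bar>indicator {x<..y} z *\<^sub>R (1 / \<rho> c * g z - w z)\<bar> \<le> indicator {x<..y} z *\<^sub>R (\<epsilon> * \<bar>g z\<bar>)"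
            proof (cases "z \<in> {x<..y}")
              case True
              then have z: "z \<in> {x..y}" by auto
              have "\<rho> z > 0" using pos z sub by blast
              then have "1 / \<rho> c * g z - w z = (1 / \<rho> c - 1 / \<rho> z) * g z"
                by (simp add: g_def field_simps)
              then have "\<bar>1 / \<rho> c * g z - w z\<bar> = \<bar>1 / \<rho> c - 1 / \<rho> z\<bar> * \<bar>g z\<bar>"
                by (simp add: abs_mult)
              also have "\<dots> \<le> \<epsilon> * \<bar>g z\<bar>"
                by (intro mult_right_mono close c z) simp
              finally show ?thesis using True by simp
            qed simp
          qed
          also have "\<dots> = \<epsilon> * I (\<lambda>z. \<bar>g z\<bar>) x y" by (simp add: I_def)
          finally show ?thesis .
        qed
      qed
    qed
    then show ?thesis by simp
  qed
  let ?J = "I (\<lambda>z. \<bar>g z\<bar>) a b"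
  have "\<bar>ln (\<rho> a) - ln (\<rho> b) - I w a b\<bar> \<le> 0"
  proof (rule LIMSEQ_le_const)
    have "(\<lambda>n. inverse (real (Suc n)) * ?J) \<longlonglongrightarrow> 0 * ?J"
      by (intro tendsto_intros LIMSEQ_inverse_real_of_nat)
    then show "(\<lambda>n. inverse (real (Suc n)) * ?J) \<longlonglongrightarrow> 0" by simp
    show "\<exists>N. \<forall>n\<ge>N. \<bar>ln (\<rho> a) - ln (\<rho> b) - I w a b\<bar> \<le> inverse (real (Suc n)) * ?J"
      using approx by auto
  qed
  then show "(LBINT z:{a<..b}. w z) = ln (\<rho> a) - ln (\<rho> b)" by (simp add: I_def)
qed

text \<open>
When \<open>\<rho>(x) = 0\<close>, the integral up to \<open>y\<close> is \<open>ln \<rho>(a) - ln \<rho>(y)\<close>, which tends to infinity as \<open>y\<close>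
approaches \<open>x\<close>; hence \<open>w\<close> is not integrable up to \<open>x\<close> and the improper integral is infinite.
\<close>
lemma density_formula:
  fixes \<rho> w :: "real \<Rightarrow> real"
  assumes cont: "continuous_on UNIV \<rho>" and nonneg: "\<And>x. \<rho> x \<ge> 0"
    and w [measurable]: "w \<in> borel_measurable borel"
    and g: "integrable lborel (\<lambda>z. w z * \<rho> z)"
    and diff: "\<And>x y. x \<le> y \<Longrightarrow> \<rho> x - \<rho> y = (LBINT z:{x<..y}. w z * \<rho> z)"
    and pos_a: "\<rho> a > 0" and pos: "\<And>y. y \<in> open_segment a x \<Longrightarrow> \<rho> y > 0"
  shows "\<exists>L. has_integral_from_to w a x L \<and> ereal (\<rho> x) = ereal (\<rho> a) * ereal_exp (- L)"
proof -
  have [measurable]: "\<rho> \<in> borel_measurable borel"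
    using cont by (rule borel_measurable_continuous_onI)
  have oriented: "interval_lebesgue_integrable lborel (ereal p) (ereal q) w \<and>
      interval_lebesgue_integral lborel (ereal p) (ereal q) w = ln (\<rho> p) - ln (\<rho> q)"
    if "p \<le> q" "\<And>z. z \<in> {p..q} \<Longrightarrow> \<rho> z > 0" for p q
  proof -
    note ln_integral_of_log_derivative[OF that(1) continuous_on_subset[OF cont] that(2) w _ g diff]
    then have "set_integrable lborel {p..q} w" "(LBINT z:{p<..q}. w z) = ln (\<rho> p) - ln (\<rho> q)"
      by auto
    then show ?thesis
      using that(1) by (auto simp: interval_lebesgue_integrable_def interval_integral_Ioc
          intro: set_integrable_subset)
  qed
  have main: "interval_lebesgue_integrable lborel (ereal a) (ereal y) w"
      "interval_lebesgue_integral lborel (ereal a) (ereal y) w = ln (\<rho> a) - ln (\<rho> y)"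
    if "\<And>z. z \<in> closed_segment a y \<Longrightarrow> \<rho> z > 0" for y
  proof -
    have "interval_lebesgue_integrable lborel (ereal a) (ereal y) w \<and>
      interval_lebesgue_integral lborel (ereal a) (ereal y) w = ln (\<rho> a) - ln (\<rho> y)"
    proof (cases "a \<le> y")
      case True
      then show ?thesis using that by (intro oriented) (auto simp: closed_segment_eq_real_ivl)
    next
      case False
      then have "interval_lebesgue_integrable lborel (ereal y) (ereal a) w \<and>
        interval_lebesgue_integral lborel (ereal y) (ereal a) w = ln (\<rho> y) - ln (\<rho> a)"
        using that by (intro oriented) (auto simp: closed_segment_eq_real_ivl)
      then show ?thesis
        using interval_integral_endpoints_reverse[of "ereal a" "ereal y" w]
          interval_integrable_endpoints_reverse[of "ereal a" "ereal y" w] by simp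
    qed
    then show "interval_lebesgue_integrable lborel (ereal a) (ereal y) w"
      "interval_lebesgue_integral lborel (ereal a) (ereal y) w = ln (\<rho> a) - ln (\<rho> y)" by blast+
  qed
  show ?thesis
  proof (cases "\<rho> x > 0")
    case True
    have "\<rho> z > 0" if "z \<in> closed_segment a x" for z
      using that True pos pos_a by (cases "z = a \<or> z = x") (auto simp: open_segment_def)
    note m = main[OF this]
    have "\<rho> x = \<rho> a * exp (- (ln (\<rho> a) - ln (\<rho> x)))"
      using True pos_a by (simp add: exp_diff)
    then show ?thesis
      using m by (intro exI[of _ "ereal (ln (\<rho> a) - ln (\<rho> x))"]) (simp add: has_integral_from_to_def ereal_exp_def)
  next
    case False
    then have x0: "\<rho> x = 0" using nonneg[of x] by simp
    then have ax: "a \<noteq> x" using pos_a by auto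
    let ?S = "open_segment a x"
    have inner: "interval_lebesgue_integrable lborel (ereal a) (ereal y) w"
      "interval_lebesgue_integral lborel (ereal a) (ereal y) w = ln (\<rho> a) - ln (\<rho> y)" if y: "y \<in> ?S" for y
    proof -
      have p: "\<rho> z > 0" if z: "z \<in> closed_segment a y" for z
      proof -
        have "z = a \<or> z \<in> ?S"
          using z y by (auto simp: open_segment_eq_real_ivl closed_segment_eq_real_ivl split: if_splits)
        then show ?thesis using pos pos_a by blast
      qed
      show "interval_lebesgue_integrable lborel (ereal a) (ereal y) w"
        "interval_lebesgue_integral lborel (ereal a) (ereal y) w = ln (\<rho> a) - ln (\<rho> y)"
        using main[OF p] by simp_all
    qed
    have ev: "\<forall>\<^sub>F y in at x within ?S. y \<in> ?S"
      by (auto simp: eventually_at_filter)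
    have "(\<rho> \<longlongrightarrow> 0) (at x within ?S)"
      using cont x0 unfolding continuous_on_def by (metis UNIV_I subset_UNIV tendsto_within_subset)
    then have "filterlim \<rho> (at_right 0) (at x within ?S)"
      by (rule tendsto_imp_filterlim_at_right) (use ev pos in \<open>auto elim: eventually_mono\<close>)
    then have "filterlim (\<lambda>y. ln (\<rho> y)) at_bot (at x within ?S)"
      by (rule filterlim_compose[OF ln_at_0])
    then have top: "filterlim (\<lambda>y. ln (\<rho> a) - ln (\<rho> y)) at_top (at x within ?S)"
      using filterlim_tendsto_add_at_top[OF tendsto_const, of "\<lambda>y. - ln (\<rho> y)" "at x within ?S" "ln (\<rho> a)"]
      by (simp add: filterlim_uminus_at_bot)
    have nontriv: "at x within ?S \<noteq> bot"
    proof -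
      have "?S - {x} = ?S" by (auto simp: open_segment_def)
      then show ?thesis using ax by (simp add: at_within_eq_bot_iff closure_open_segment)
    qed
    (* Integrability up to x would bound ln \<rho>(a) - ln \<rho>(y) uniformly in y by B. *)
    have not_int: "\<not> interval_lebesgue_integrable lborel (ereal a) (ereal x) w"
    proof
      assume int: "interval_lebesgue_integrable lborel (ereal a) (ereal x) w"
      have S: "?S = {min a x<..<max a x}" by (auto simp: open_segment_eq_real_ivl)
      have intS: "set_integrable lborel ?S w"
        using int unfolding interval_lebesgue_integrable_def S by (auto simp: min_def max_def split: if_splits)
      define B where "B = (LBINT z:?S. \<bar>w z\<bar>)"
      have "ln (\<rho> a) - ln (\<rho> y) \<le> B" if y: "y \<in> ?S" for y
      proof -
        let ?E = "{min a y<..<max a y}"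
        have sub: "?E \<subseteq> ?S" using y by (auto simp: S)
        have "\<bar>interval_lebesgue_integral lborel (ereal a) (ereal y) w\<bar> = \<bar>LBINT z:?E. w z\<bar>"
          by (auto simp: interval_lebesgue_integral_def min_def max_def)
        also have "\<dots> \<le> (LBINT z:?E. \<bar>w z\<bar>)"
          using set_integral_norm_bound[OF set_integrable_subset[OF intS _ sub]] by simp
        also have "\<dots> \<le> B"
          unfolding B_def set_lebesgue_integral_def
        proof (rule integral_mono)
          show "integrable lborel (\<lambda>z. indicator ?E z *\<^sub>R \<bar>w z\<bar>)"
            using set_integrable_abs[OF set_integrable_subset[OF intS _ sub]] by (simp add: set_integrable_def)
          show "integrable lborel (\<lambda>z. indicator ?S z *\<^sub>R \<bar>w z\<bar>)"
            using set_integrable_abs[OF intS] by (simp add: set_integrable_def)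
          show "indicator ?E z *\<^sub>R \<bar>w z\<bar> \<le> indicator ?S z *\<^sub>R \<bar>w z\<bar>" for z
            using sub by (auto simp: indicator_def)
        qed
        finally show ?thesis using inner(2)[OF y] by linarith
      qed
      then have "\<forall>\<^sub>F y in at x within ?S. ln (\<rho> a) - ln (\<rho> y) \<le> B"
        using ev by (auto elim: eventually_mono)
      moreover have "\<forall>\<^sub>F y in at x within ?S. ln (\<rho> a) - ln (\<rho> y) > B"
        using top by (simp add: filterlim_at_top_dense)
      ultimately have "\<forall>\<^sub>F y in at x within ?S. False"
        by eventually_elim simp
      then show False using nontriv by (simp add: eventually_False)
    qed
    have "((\<lambda>y. ereal (ln (\<rho> a) - ln (\<rho> y))) \<longlongrightarrow> \<infinity>) (at x within ?S)"
      using top by (simp add: tendsto_PInfty_eq_at_top)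
    moreover have "\<forall>\<^sub>F y in at x within ?S. ereal (ln (\<rho> a) - ln (\<rho> y))
        = ereal (interval_lebesgue_integral lborel (ereal a) (ereal y) w)"
      using ev by eventually_elim (simp add: inner)
    ultimately have "((\<lambda>y. ereal (interval_lebesgue_integral lborel (ereal a) (ereal y) w)) \<longlongrightarrow> \<infinity>) (at x within ?S)"
      by (rule Lim_transform_eventually)
    then have "has_integral_from_to w a x \<infinity>"
      using not_int inner(1) by (simp add: has_integral_from_to_def)
    then show ?thesis
      by (intro exI[of _ \<infinity>]) (simp add: x0 ereal_exp_def zero_ereal_def)
  qed
qed

section \<open>Positivity of the density and the main result\<close>

text \<open>
Integrating the bound over the interval gives \<open>P \<le> c (q - p) P\<^sup>1\<^sup>/\<^sup>2\<close> for its probability \<open>P\<close>.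
\<close>
lemma (in prob_space) quadratic_interval_bound:
  assumes D: "distributed M lborel F (\<lambda>x. ennreal (\<rho> x))" and c: "c \<ge> 0" and pq: "p \<le> q"
    and bound: "\<And>y. y \<in> {p<..q} \<Longrightarrow> \<rho> y \<le> c * sqrt (prob (F -` {p<..q} \<inter> space M))"
  shows "prob (F -` {p<..q} \<inter> space M) \<le> c\<^sup>2 * (q - p)\<^sup>2"
proof -
  have [measurable]: "F \<in> borel_measurable M"
    using distributed_measurable[OF D] by simp
  define P where "P = prob (F -` {p<..q} \<inter> space M)"
  have P0: "P \<ge> 0" by (simp add: P_def)
  have "ennreal P = emeasure M (F -` {p<..q} \<inter> space M)"
    by (simp add: P_def emeasure_eq_measure)
  also have "\<dots> = (\<integral>\<^sup>+y. ennreal (\<rho> y) * indicator {p<..q} y \<partial>lborel)"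
    by (rule distributed_emeasure[OF D]) simp
  also have "\<dots> \<le> (\<integral>\<^sup>+y. ennreal (c * sqrt P) * indicator {p<..q} y \<partial>lborel)"
    using bound by (intro nn_integral_mono) (auto simp: indicator_def P_def intro!: ennreal_leI)
  also have "\<dots> = ennreal (c * sqrt P * (q - p))"
    using c P0 pq by (simp add: nn_integral_cmult_indicator ennreal_mult)
  finally have "P \<le> c * sqrt P * (q - p)"
    using c P0 pq by (subst (asm) ennreal_le_iff) auto
  then have "sqrt P * sqrt P \<le> (c * (q - p)) * sqrt P"
    using P0 by (simp add: mult_ac)
  then have "sqrt P \<le> c * (q - p)"
  proof (cases "P = 0")
    case False
    then have "sqrt P > 0" using P0 by simp
    with \<open>sqrt P * sqrt P \<le> _\<close> show ?thesis by (rule mult_right_le_imp_le)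
  qed (use c pq in simp)
  then have "(sqrt P)\<^sup>2 \<le> (c * (q - p))\<^sup>2"
    using P0 by (intro power_mono) auto
  then show ?thesis using P0 by (simp add: P_def power_mult_distrib)
qed

context isonormal_gaussian_process
begin

text \<open>
At a zero \<open>z\<close> of \<open>\<rho>\<close> the increments of \<open>\<rho>\<close> bound \<open>\<rho>\<close> near \<open>z\<close> by the square root of the probability
of an interval, so that small balls around \<open>z\<close> have quadratically small probability. Then
\<open>sgn (F - z)\<close> is almost surely constant, although \<open>F\<close> takes values on both sides of \<open>z\<close>.
\<close>
lemma density_pos_between_support_points:
  assumes FG: "has_malliavin_deriv M W F G" and d: "d \<in> L2 M"
    and D: "distributed M lborel F (\<lambda>x. ennreal (\<rho> x))" and nonneg: "\<And>x. \<rho> x \<ge> 0"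
    and diff: "\<And>x y. x \<le> y \<Longrightarrow> \<rho> x - \<rho> y = expectation (\<lambda>\<omega>. d \<omega> * indicator {x<..y} (F \<omega>))"
    and p: "p \<in> law_support M F" and q: "q \<in> law_support M F" and pq: "p < z" "z < q"
  shows "\<rho> z > 0"
proof (rule ccontr)
  assume "\<not> \<rho> z > 0"
  then have z0: "\<rho> z = 0" using nonneg[of z] by simp
  have [measurable]: "F \<in> borel_measurable M"
    using distributed_measurable[OF D] by simp
  define c where "c = sqrt (expectation (\<lambda>\<omega>. (d \<omega>)\<^sup>2))"
  have c: "c \<ge> 0" by (simp add: c_def)
  have incr: "\<bar>\<rho> x - \<rho> y\<bar> \<le> c * sqrt (prob (F -` {p<..q} \<inter> space M))"
    if "p \<le> x" "x \<le> y" "y \<le> q" for x y p q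
  proof -
    have ind: "(\<lambda>\<omega>. indicator {x<..y} (F \<omega>) :: real) \<in> L2 M"
      by (rule L2_bounded[of _ 1]) (auto simp: indicator_def)
    have "\<bar>\<rho> x - \<rho> y\<bar> \<le> expectation (\<lambda>\<omega>. \<bar>d \<omega> * indicator {x<..y} (F \<omega>)\<bar>)"
      unfolding diff[OF that(2)] by (rule integral_abs_bound)
    also have "\<dots> \<le> c * sqrt (expectation (\<lambda>\<omega>. (indicator {x<..y} (F \<omega>) :: real)\<^sup>2))"
      unfolding c_def by (rule L2_Cauchy_Schwarz(2)[OF d ind])
    also have "expectation (\<lambda>\<omega>. (indicator {x<..y} (F \<omega>) :: real)\<^sup>2) = expectation (indicator (F -` {x<..y} \<inter> space M))"
      by (intro Bochner_Integration.integral_cong) (auto simp: indicator_def)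
    also have "\<dots> = prob (F -` {x<..y} \<inter> space M)" by simp
    also have "c * sqrt (prob (F -` {x<..y} \<inter> space M)) \<le> c * sqrt (prob (F -` {p<..q} \<inter> space M))"
      using c that by (intro mult_left_mono real_sqrt_le_mono finite_measure_mono) auto
    finally show ?thesis .
  qed
  have "prob {\<omega> \<in> space M. \<bar>F \<omega> - z\<bar> \<le> \<epsilon>} \<le> (5 * c\<^sup>2) * \<epsilon>\<^sup>2" if \<epsilon>: "\<epsilon> > 0" for \<epsilon>
  proof -
    have right: "prob (F -` {z<..z + \<epsilon>} \<inter> space M) \<le> c\<^sup>2 * (z + \<epsilon> - z)\<^sup>2"
    proof (rule quadratic_interval_bound[OF D c])
      show "\<rho> y \<le> c * sqrt (prob (F -` {z<..z + \<epsilon>} \<inter> space M))" if "y \<in> {z<..z + \<epsilon>}" for y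
        using incr[of z z y "z + \<epsilon>"] that z0 by simp
    qed (use \<epsilon> in simp)
    (* The half-open interval has to contain the point z - \<epsilon>, hence the factor 2. *)
    have left: "prob (F -` {z - 2 * \<epsilon><..z} \<inter> space M) \<le> c\<^sup>2 * (z - (z - 2 * \<epsilon>))\<^sup>2"
    proof (rule quadratic_interval_bound[OF D c])
      show "\<rho> y \<le> c * sqrt (prob (F -` {z - 2 * \<epsilon><..z} \<inter> space M))" if "y \<in> {z - 2 * \<epsilon><..z}" for y
        using incr[of "z - 2 * \<epsilon>" y z z] that z0 by simp
    qed (use \<epsilon> in simp)
    have "prob {\<omega> \<in> space M. \<bar>F \<omega> - z\<bar> \<le> \<epsilon>}
        \<le> prob ((F -` {z<..z + \<epsilon>} \<inter> space M) \<union> (F -` {z - 2 * \<epsilon><..z} \<inter> space M))"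
      using \<epsilon> by (intro finite_measure_mono) auto
    also have "\<dots> \<le> prob (F -` {z<..z + \<epsilon>} \<inter> space M) + prob (F -` {z - 2 * \<epsilon><..z} \<inter> space M)"
      by (intro measure_Un_le) auto
    also have "\<dots> \<le> c\<^sup>2 * \<epsilon>\<^sup>2 + c\<^sup>2 * (2 * \<epsilon>)\<^sup>2"
      using left right by (simp add: power_mult_distrib algebra_simps)
    finally show ?thesis by (simp add: power_mult_distrib algebra_simps)
  qed
  from small_ball_imp_sgn_constant[OF FG this]
  obtain s where s: "AE \<omega> in M. sgn (F \<omega> - z) = s" by blast
  (* An open set charged by the law of F contains a point at which the sign is the constant s. *)
  have null: "A \<inter> {x. sgn (x - z) = s} \<noteq> {}"
    if "open A" "measure (distr M borel F) A > 0" for A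
  proof
    assume e: "A \<inter> {x. sgn (x - z) = s} = {}"
    have [measurable]: "A \<in> sets borel" using that(1) by simp
    have "AE \<omega> in M. F \<omega> \<notin> A" using s by eventually_elim (use e in auto)
    then have "prob {\<omega> \<in> space M. F \<omega> \<in> A} = 0" by (subst prob_eq_0) auto
    moreover have "F -` A \<inter> space M = {\<omega> \<in> space M. F \<omega> \<in> A}" by auto
    ultimately show False using that(2) by (simp add: measure_distr)
  qed
  have "measure (distr M borel F) {..<z} > 0"
    using p pq(1) unfolding law_support_def by simp
  from null[OF _ this] have "s = -1" by auto
  moreover have "measure (distr M borel F) {z<..} > 0"
    using q pq(2) unfolding law_support_def by simp
  from null[OF _ this] have "s = 1" by auto
  ultimately show False by simp
qed

end

text \<open>
Any version \<open>w\<close> of the conditional expectation may replace \<open>d\<close> on events determined by \<open>F\<close>, and the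
expectation then becomes an integral against the density.
\<close>
lemma (in prob_space) cond_exp_given_integral:
  assumes D: "distributed M lborel F (\<lambda>x. ennreal (\<rho> x))" and nonneg: "\<And>x. \<rho> x \<ge> 0"
    and d: "integrable M d" and w: "cond_exp_given M d F w"
  shows "integrable lborel (\<lambda>z. w z * \<rho> z)"
    and "expectation (\<lambda>\<omega>. d \<omega> * indicator {x<..y} (F \<omega>)) = (LBINT z:{x<..y}. w z * \<rho> z)"
proof -
  have [measurable]: "F \<in> borel_measurable M"
    using distributed_measurable[OF D] by simp
  have [measurable]: "w \<in> borel_measurable borel" using w by (simp add: cond_exp_given_def)
  define N where "N = vimage_algebra (space M) F borel"
  have sub: "subalgebra M N"
    unfolding subalgebra_def N_def by (simp add: sets_image_in_sets)
  interpret N: finite_measure_subalgebra M N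
    by unfold_locales (rule sub)
  have ae: "AE \<omega> in M. real_cond_exp M N d \<omega> = w (F \<omega>)"
    using w by (simp add: cond_exp_given_def N_def)
  have int_c: "integrable M (real_cond_exp M N d)" by (rule N.real_cond_exp_int(1)[OF d])
  have [measurable]: "real_cond_exp M N d \<in> borel_measurable M" by simp
  have int_w: "integrable M (\<lambda>\<omega>. w (F \<omega>))"
    by (rule integrable_cong_AE_imp[OF int_c]) (use ae in auto)
  show "integrable lborel (\<lambda>z. w z * \<rho> z)"
    using distributed_integrable[OF D, of w] int_w nonneg by (simp add: mult.commute)
  have set: "F -` {x<..y} \<inter> space M \<in> sets N"
    unfolding N_def by (rule in_vimage_algebra) simp
  have "expectation (\<lambda>\<omega>. d \<omega> * indicator {x<..y} (F \<omega>)) = (LINT \<omega>:F -` {x<..y} \<inter> space M|M. d \<omega>)"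
    unfolding set_lebesgue_integral_def
    by (intro Bochner_Integration.integral_cong) (auto simp: indicator_def)
  also have "\<dots> = (LINT \<omega>:F -` {x<..y} \<inter> space M|M. real_cond_exp M N d \<omega>)"
    by (rule N.real_cond_exp_intA[OF d set])
  also have "\<dots> = expectation (\<lambda>\<omega>. indicator {x<..y} (F \<omega>) * w (F \<omega>))"
    unfolding set_lebesgue_integral_def
  proof (rule integral_cong_AE)
    show "AE \<omega> in M. indicator (F -` {x<..y} \<inter> space M) \<omega> *\<^sub>R real_cond_exp M N d \<omega>
        = indicator {x<..y} (F \<omega>) * w (F \<omega>)"
      using ae AE_space by eventually_elim (simp add: indicator_def)
  qed measurable
  also have "\<dots> = (\<integral>z. \<rho> z * (indicator {x<..y} z * w z) \<partial>lborel)"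
    using distributed_integral[OF D, of "\<lambda>z. indicator {x<..y} z * w z"] nonneg by simp
  also have "\<dots> = (LBINT z:{x<..y}. w z * \<rho> z)"
    unfolding set_lebesgue_integral_def by (simp add: mult_ac)
  finally show "expectation (\<lambda>\<omega>. d \<omega> * indicator {x<..y} (F \<omega>)) = (LBINT z:{x<..y}. w z * \<rho> z)" .
qed

theorem proposition3p1:
  fixes M :: "'a measure"
    and W :: "'h::{real_inner, banach, second_countable_topology} \<Rightarrow> 'a \<Rightarrow> real"
    and F :: "'a \<Rightarrow> real"
    and u v :: "'a \<Rightarrow> 'h"
  assumes "isonormal_gaussian_process M W"
    and "F \<in> D12 M W"
    and "AE \<omega> in M. inner (malliavin_deriv M W F \<omega>) (u \<omega>) \<noteq> 0"
    and v_def: "v = (\<lambda>\<omega>. u \<omega> /\<^sub>R inner (malliavin_deriv M W F \<omega>) (u \<omega>))"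
    and "v \<in> dom_divergence M W"
  shows "\<exists>\<rho> :: real \<Rightarrow> real.
    continuous_on UNIV \<rho> \<and> (\<forall>x. \<rho> x \<ge> 0) \<and>
    distributed M lborel F (\<lambda>x. ennreal (\<rho> x)) \<and>
    (\<forall>w. cond_exp_given M (divergence M W v) F w \<longrightarrow>
      (\<forall>a \<in> interior (law_support M F). \<forall>x \<in> law_support M F.
        \<exists>L. has_integral_from_to w a x L \<and>
            ereal (\<rho> x) = ereal (\<rho> a) * ereal_exp (- L)))"
proof -
  interpret isonormal_gaussian_process M W by fact
  define G where "G = malliavin_deriv M W F"
  define d where "d = divergence M W v"
  have "\<exists>G. has_malliavin_deriv M W F G"
    using assms(2) by (simp add: D12_def)
  then have FG: "has_malliavin_deriv M W F G"
    unfolding G_def malliavin_deriv_def by (rule someI_ex)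
  have F: "F \<in> L2 M" and G: "G \<in> L2 M"
    using FG by (auto simp: has_malliavin_deriv_def)
  have v: "v \<in> L2 M" using assms(5) by (simp add: dom_divergence_def)
  note dv = divergence_duality[OF assms(5), folded d_def]
  note [measurable] = L2_D(1)[OF F] L2_D(1)[OF G] L2_D(1)[OF v]
  have one: "AE \<omega> in M. inner (G \<omega>) (v \<omega>) = 1"
    using assms(3) by eventually_elim (simp add: v_def G_def)
  have dual: "expectation (\<lambda>\<omega>. sgn (F \<omega> - a) - sgn (F \<omega> - b))
      = expectation (\<lambda>\<omega>. (\<bar>F \<omega> - a\<bar> - \<bar>F \<omega> - b\<bar>) * d \<omega>)" for a b
  proof -
    have "expectation (\<lambda>\<omega>. sgn (F \<omega> - a) - sgn (F \<omega> - b))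
        = expectation (\<lambda>\<omega>. (sgn (F \<omega> - a) - sgn (F \<omega> - b)) * inner (G \<omega>) (v \<omega>))"
      by (rule integral_cong_AE) (use one in auto)
    also have "\<dots> = expectation (\<lambda>\<omega>. (\<bar>F \<omega> - a\<bar> - \<bar>F \<omega> - b\<bar>) * d \<omega>)"
      by (rule malliavin_sgn_duality[OF FG v dv])
    finally show ?thesis .
  qed
  obtain \<rho> where cont: "continuous_on UNIV \<rho>" and nonneg: "\<And>x. \<rho> x \<ge> 0"
    and D: "distributed M lborel F (\<lambda>x. ennreal (\<rho> x))"
    and diff: "\<And>x y. x \<le> y \<Longrightarrow> \<rho> x - \<rho> y = expectation (\<lambda>\<omega>. d \<omega> * indicator {x<..y} (F \<omega>))"
    using sgn_duality_density[OF F dv(1) dual] by blast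
  have pos: "\<rho> z > 0" if "p \<in> law_support M F" "q \<in> law_support M F" "p < z" "z < q" for p q z
    by (rule density_pos_between_support_points[OF FG dv(1) D nonneg _ that]) (rule diff)
  have "\<exists>L. has_integral_from_to w a x L \<and> ereal (\<rho> x) = ereal (\<rho> a) * ereal_exp (- L)"
    if w: "cond_exp_given M d F w" and a: "a \<in> interior (law_support M F)" and x: "x \<in> law_support M F"
    for w a x
  proof (rule density_formula[OF cont nonneg])
    note ce = cond_exp_given_integral[OF D nonneg L2_integrable[OF dv(1)] w]
    show "w \<in> borel_measurable borel" using w by (simp add: cond_exp_given_def)
    show "integrable lborel (\<lambda>z. w z * \<rho> z)" by (rule ce(1))
    show "\<rho> x - \<rho> y = (LBINT z:{x<..y}. w z * \<rho> z)" if "x \<le> y" for x y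
      using diff[OF that] ce(2) by simp
    obtain e where e: "e > 0" "ball a e \<subseteq> law_support M F"
      using a by (auto simp: mem_interior)
    have ends: "a - e / 2 \<in> law_support M F" "a + e / 2 \<in> law_support M F"
      using e by (auto simp: dist_real_def subset_iff)
    show "\<rho> a > 0" by (rule pos[OF ends]) (use e in auto)
    have a': "a \<in> law_support M F" using a interior_subset by blast
    show "\<rho> y > 0" if "y \<in> open_segment a x" for y
    proof (cases "a < x")
      case True
      then show ?thesis using that by (intro pos[OF a' x]) (auto simp: open_segment_eq_real_ivl)
    next
      case False
      then show ?thesis using that by (intro pos[OF x a']) (auto simp: open_segment_eq_real_ivl split: if_splits)
    qed
  qed
  then show ?thesis
    using cont nonneg D unfolding d_def by blast
qed

end
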